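(* Let $\overline{x}\in\mathbb{X}$ be a stationary point of the nonlinear semidefinite program (NLSDP) $\min f(x)$ s.t. $h(x)=0$, $g(x)\in\mathbb{S}^n_+$, with a Lagrange multiplier $(\overline\xi,\overline\Gamma)\in M(\overline{x})$, put $\overline Z=(\overline x,\overline\xi,\overline\Gamma)$, and let $\delta\in\big(0,\min\{|\overline\lambda_i|: i\in\alpha\cup\gamma\}\big)$. Then: (i) If the weak second order condition (W-SOC) and the constraint nondegeneracy hold at $\overline Z$, then there exists $\overline\eta>0$ such that for any $\widehat Z^0$ sufficiently close to $\overline Z$ and any $0\le\eta\le\overline\eta$, the semismooth Newton method with correction using $\mathcal U_0$ is well defined and the sequence $\{Z^k\}$ so generated converges to $\overline Z$ superlinearly. (ii) If the strong second order sufficient condition (S-SOSC) and the weak strict Robinson constraint qualification (W-SRCQ) hold at $\overline Z$, then there exists $\overline\eta>0$ such that for any $\widehat Z^0$ sufficiently close to $\overline Z$ and any $0\le\eta\le\overline\eta$, the semismooth Newton method with correction using $\mathcal U_{\mathcal I}$ is well defined and the sequence $\{Z^k\}$ so generated converges to $\overline Z$ superlinearly. Moreover, if $f$, $g$ and $h$ are twice Lipschitz continuously differentiable (i.e., have Lipschitz continuous second order derivatives) and $\tau=1$, then the corresponding convergence rates in (i) and (ii) are quadratic.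
   Context: Setting. $\mathbb{X}$ is a finite-dimensional real Euclidean space; $\mathbb{S}^n$ is the space of real symmetric $n\times n$ matrices with the trace inner product, $\mathbb{S}^n_+$ the positive semidefinite cone. The functions $f:\mathbb{X}\to\mathbb{R}$, $h:\mathbb{X}\to\mathbb{R}^m$, $g:\mathbb{X}\to\mathbb{S}^n$ are twice continuously differentiable. $L(x,\xi,\Gamma)=f(x)+\langle\xi,h(x)\rangle+\langle\Gamma,g(x)\rangle$. Put $\mathbb{Z}=\mathbb{X}\times\mathbb{R}^m\times\mathbb{S}^n$. A KKT point is $(x,\xi,\Gamma)\in\mathbb{Z}$ with $\nabla_xL(x,\xi,\Gamma)=0$, $h(x)=0$, $\Gamma\in\mathcal{N}_{\mathbb{S}^n_+}(g(x))$ (normal cone of convex analysis). $M(x)$ is the set of $(\xi,\Gamma)$ such that $(x,\xi,\Gamma)$ is a KKT point; a feasible $x$ is stationary if $M(x)\ne\emptyset$. With $\Pi_{\mathbb{S}^n_+}$ the metric projection onto $\mathbb{S}^n_+$, the KKT residual mapping $F:\mathbb{Z}\to\mathbb{Z}$ is $F(x,\xi,\Gamma)=\big(\nabla_xL(x,\xi,\Gamma),\,h(x),\,-g(x)+\Pi_{\mathbb{S}^n_+}(g(x)+\Gamma)\big)$. Eigenvalue notation at $\overline Z$. Let $g(\overline x)+\overline\Gamma=\overline P\,\mathrm{Diag}(\overline\lambda)\overline P^T$ with $\overline P$ orthogonal and $\overline\lambda$ nonincreasing; $\alpha=\{i:\overline\lambda_i>0\}$, $\beta=\{i:\overline\lambda_i=0\}$,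 $\gamma=\{i:\overline\lambda_i<0\}$ (if $\alpha\cup\gamma=\emptyset$ the minimum in the condition on $\delta$ is $+\infty$). Let $\overline{\mathcal B}(\Delta x)=\overline P^T(g'(\overline x)\Delta x)\overline P$. Conditions at $\overline Z$. Let $q(\Delta x)=\langle\Delta x,\nabla^2_{xx}L(\overline x,\overline\xi,\overline\Gamma)\Delta x\rangle-2\sum_{i\in\alpha}\sum_{j\in\gamma}\frac{\overline\lambda_j}{\overline\lambda_i}\overline{\mathcal B}(\Delta x)_{ij}^2$. - Constraint nondegeneracy: $(h'(\overline x),g'(\overline x))\mathbb{X}+\{0\}\times\{\overline PB\overline P^T: B\in\mathbb{S}^n,\ B_{\beta\beta}=0,B_{\beta\gamma}=0,B_{\gamma\gamma}=0\}=\mathbb{R}^m\times\mathbb{S}^n$. - W-SRCQ: $(h'(\overline x),g'(\overline x))\mathbb{X}+\{0\}\times\{\overline PB\overline P^T:B\in\mathbb{S}^n,\ B_{\beta\gamma}=0,B_{\gamma\gamma}=0\}=\mathbb{R}^m\times\mathbb{S}^n$. - W-SOC: $q(\Delta x)>0$ for all nonzero $\Delta x$ with $h'(\overline x)\Delta x=0$, $\overline{\mathcal B}(\Delta x)_{\beta\beta}=0$, $\overline{\mathcal B}(\Delta x)_{\beta\gamma}=0$, $\overline{\mathcal B}(\Delta x)_{\gamma\gamma}=0$. - S-SOSC: $q(\Delta x)>0$ for all nonzero $\Delta x$ with $h'(\overline x)\Delta x=0$, $\overline{\mathcal B}(\Delta x)_{\beta\gamma}=0$, $\overline{\mathcal B}(\Delta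 x)_{\gamma\gamma}=0$. Correction mapping. For $\delta>0$ and $Z=(x,\xi,\Gamma)\in\mathbb{Z}$ with $g(x)+\Gamma=P\,\mathrm{Diag}(\lambda)P^T$ ($P$ orthogonal with columns $P_i$), $\mathcal P_\delta(Z)=\big(x,\xi,\Gamma-\sum_{i:|\lambda_i|\le\delta}\lambda_iP_iP_i^T\big)$. Operators $\mathcal U_0,\mathcal U_{\mathcal I}$ at an arbitrary $Z=(x,\xi,\Gamma)$. Write $g(x)+\Gamma=P\,\mathrm{Diag}(\lambda)P^T$ with $\lambda$ nonincreasing, and let $a,b,c$ be the index sets of positive, zero, negative $\lambda_i$; $\Xi_{ij}=\lambda_i/(\lambda_i-\lambda_j)$ for $i\in a,j\in c$, $\Xi_{ca}=\Xi_{ac}^T$. With $\widetilde H=P^THP$ and $\circ$ the Hadamard product, $$\mathcal V_0(H)=P\begin{bmatrix}\widetilde H_{aa}&\widetilde H_{ab}&\Xi_{ac}\circ\widetilde H_{ac}\\ \widetilde H_{ba}&0&0\\ \Xi_{ca}\circ\widetilde H_{ca}&0&0\end{bmatrix}P^T,$$ and $\mathcal V_{\mathcal I}(H)$ is the same with the $bb$ block replaced by $\widetilde H_{bb}$. For $l\in\{0,\mathcal I\}$, $\mathcal U_l(\Delta x,\Delta\xi,\Delta\Gamma)=\big(\nabla^2_{xx}L(Z)\Delta x+h'(x)^*\Delta\xi+g'(x)^*\Delta\Gamma,\ h'(x)\Delta x,\ -g'(x)\Delta x+\mathcal V_l(g'(x)\Delta x+\Delta\Gamma)\big)$. These belong to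 the Bouligand generalized Jacobian $\partial_BF(Z)$. Algorithm (semismooth Newton method with correction using $\mathcal U_l$, $l\in\{0,\mathcal I\}$). Parameters: $\widehat Z^0\in\mathbb{Z}$, $\delta>0$, $\eta\ge0$, $\tau\in(0,1]$. Set $Z^0=\mathcal P_\delta(\widehat Z^0)$. For $k=0,1,\dots$: let $\mathcal U^k$ be the operator $\mathcal U_l$ at $Z^k$; find an approximate solution $d^k$ of $\mathcal U^kd+F(Z^k)=0$ with $\|\mathcal U^kd^k+F(Z^k)\|\le\min(\eta,\|F(Z^k)\|^\tau)\,\|F(Z^k)\|$; set $\widehat Z^{k+1}=Z^k+d^k$ and $Z^{k+1}=\mathcal P_\delta(\widehat Z^{k+1})$. "Well defined" means that every $\mathcal U^k$ is nonsingular, so that suitable $d^k$ exist. Superlinear convergence: $Z^k\to\overline Z$ and $\|Z^{k+1}-\overline Z\|=o(\|Z^k-\overline Z\|)$; quadratic: $\|Z^{k+1}-\overline Z\|=O(\|Z^k-\overline Z\|^2)$. *)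

theory Defs
  imports "HOL-Analysis.Analysis" "HOL-Library.Set_Algebras"
begin

section \<open>Derivatives\<close>

definition second_derivs ::
  "('a::real_normed_vector \<Rightarrow> 'b::real_normed_vector) \<Rightarrow> ('a \<Rightarrow> 'a \<Rightarrow>\<^sub>L 'b) \<Rightarrow>
   ('a \<Rightarrow> 'a \<Rightarrow>\<^sub>L 'a \<Rightarrow>\<^sub>L 'b) \<Rightarrow> bool" where
  "second_derivs \<phi> \<phi>' \<phi>'' \<longleftrightarrow>
     (\<forall>x. (\<phi> has_derivative blinfun_apply (\<phi>' x)) (at x)) \<and>
     (\<forall>x. (\<phi>' has_derivative blinfun_apply (\<phi>'' x)) (at x))"

definition twice_cont_diff ::
  "('a::real_normed_vector \<Rightarrow> 'b::real_normed_vector) \<Rightarrow> bool" where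
  "twice_cont_diff \<phi> \<longleftrightarrow> (\<exists>\<phi>' \<phi>''. second_derivs \<phi> \<phi>' \<phi>'' \<and> continuous_on UNIV \<phi>'')"

text \<open>Lipschitz continuity of the second derivative is required only locally; a globally Lipschitz
  second derivative is a special case.\<close>

definition twice_lipschitz_diff ::
  "('a::real_normed_vector \<Rightarrow> 'b::real_normed_vector) \<Rightarrow> bool" where
  "twice_lipschitz_diff \<phi> \<longleftrightarrow> (\<exists>\<phi>' \<phi>''. second_derivs \<phi> \<phi>' \<phi>'' \<and>
     (\<forall>x. \<exists>r>0. \<exists>K. K-lipschitz_on (ball x r) \<phi>''))"

definition gradient :: "('a::real_inner \<Rightarrow> real) \<Rightarrow> 'a \<Rightarrow> 'a" where
  "gradient \<phi> x = (THE v. GDERIV \<phi> x :> v)"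

definition hessian :: "('a::real_inner \<Rightarrow> real) \<Rightarrow> 'a \<Rightarrow> 'a \<Rightarrow> 'a" where
  "hessian \<phi> x = frechet_derivative (gradient \<phi>) (at x)"

abbreviation jac :: "('a::real_normed_vector \<Rightarrow> 'b::real_normed_vector) \<Rightarrow> 'a \<Rightarrow> 'a \<Rightarrow> 'b" where
  "jac \<phi> x \<equiv> frechet_derivative \<phi> (at x)"


section \<open>Symmetric matrices\<close>

type_synonym 'n rvec = "(real, 'n) vec"
type_synonym 'n rmat = "((real, 'n) vec, 'n) vec"

text \<open>The inner product and norm of the library on \<^typ>\<open>real^'n^'n\<close> are the trace inner product
  and the Frobenius norm; symmetric matrices form a subspace. Closest points of the semidefinite
  cone and adjoints of operators with symmetric values are the same whether taken in this
  subspace or in the space of all matrices.\<close>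

definition sym_mats :: "(real^'n^'n) set" where
  "sym_mats = {A. transpose A = A}"

definition psd_cone :: "(real^'n^'n) set" where
  "psd_cone = {A \<in> sym_mats. \<forall>v. 0 \<le> v \<bullet> (A *v v)}"

definition proj_psd :: "real^'n^'n \<Rightarrow> real^'n^'n" where
  "proj_psd A = closest_point psd_cone A"

definition normal_cone_sym :: "(real^'n^'n) set \<Rightarrow> real^'n^'n \<Rightarrow> (real^'n^'n) set" where
  "normal_cone_sym K A = {V \<in> sym_mats. A \<in> K \<and> (\<forall>B\<in>K. V \<bullet> (B - A) \<le> 0)}"

definition Diag :: "real^'n \<Rightarrow> real^'n^'n" where
  "Diag l = (\<chi> i j. if i = j then l $ i else 0)"

definition eigen_decomp :: "real^'n^'n \<Rightarrow> real^'n^'n \<Rightarrow> real^'n \<Rightarrow> bool" where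
  "eigen_decomp A P l \<longleftrightarrow> orthogonal_matrix P \<and> A = P ** Diag l ** transpose P"

definition ordered_eigen_decomp ::
  "'n::{finite,linorder} rmat \<Rightarrow> 'n rmat \<Rightarrow> 'n rvec \<Rightarrow> bool" where
  "ordered_eigen_decomp A P l \<longleftrightarrow> eigen_decomp A P l \<and> antimono (\<lambda>i. l $ i)"

definition pos_idx :: "real^'n \<Rightarrow> 'n set" where
  "pos_idx l = {i. l $ i > 0}"

definition zero_idx :: "real^'n \<Rightarrow> 'n set" where
  "zero_idx l = {i. l $ i = 0}"

definition neg_idx :: "real^'n \<Rightarrow> 'n set" where
  "neg_idx l = {i. l $ i < 0}"

definition zero_block :: "'n set \<Rightarrow> 'n set \<Rightarrow> real^'n^'n \<Rightarrow> bool" where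
  "zero_block I J B \<longleftrightarrow> (\<forall>i\<in>I. \<forall>j\<in>J. B $ i $ j = 0)"

definition outer_prod :: "real^'n \<Rightarrow> real^'n \<Rightarrow> real^'n^'n" where
  "outer_prod u v = (\<chi> i j. u $ i * v $ j)"


section \<open>The nonlinear semidefinite program\<close>

definition Zspace :: "('x::euclidean_space \<times> (real^'m) \<times> (real^'n^'n)) set" where
  "Zspace = UNIV \<times> UNIV \<times> sym_mats"

definition Lagr ::
  "('x \<Rightarrow> real) \<Rightarrow> ('x \<Rightarrow> real^'m) \<Rightarrow> ('x \<Rightarrow> real^'n^'n) \<Rightarrow>
   real^'m \<Rightarrow> real^'n^'n \<Rightarrow> 'x::euclidean_space \<Rightarrow> real" where
  "Lagr f h g \<xi> \<Gamma> x = f x + \<xi> \<bullet> h x + \<Gamma> \<bullet> g x"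

definition KKT_point ::
  "('x \<Rightarrow> real) \<Rightarrow> ('x \<Rightarrow> real^'m) \<Rightarrow> ('x \<Rightarrow> real^'n^'n) \<Rightarrow>
   'x::euclidean_space \<times> (real^'m) \<times> (real^'n^'n) \<Rightarrow> bool" where
  "KKT_point f h g = (\<lambda>(x, \<xi>, \<Gamma>).
     gradient (Lagr f h g \<xi> \<Gamma>) x = 0 \<and> h x = 0 \<and> \<Gamma> \<in> normal_cone_sym psd_cone (g x))"

definition multipliers ::
  "('x \<Rightarrow> real) \<Rightarrow> ('x \<Rightarrow> real^'m) \<Rightarrow> ('x \<Rightarrow> real^'n^'n) \<Rightarrow>
   'x::euclidean_space \<Rightarrow> ((real^'m) \<times> (real^'n^'n)) set" where
  "multipliers f h g x = {(\<xi>, \<Gamma>). KKT_point f h g (x, \<xi>, \<Gamma>)}"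

definition stationary_point ::
  "('x \<Rightarrow> real) \<Rightarrow> ('x \<Rightarrow> real^'m) \<Rightarrow> ('x \<Rightarrow> real^'n^'n) \<Rightarrow>
   'x::euclidean_space \<Rightarrow> bool" where
  "stationary_point f h g x \<longleftrightarrow> h x = 0 \<and> g x \<in> psd_cone \<and> multipliers f h g x \<noteq> {}"

definition KKT_residual ::
  "('x \<Rightarrow> real) \<Rightarrow> ('x \<Rightarrow> real^'m) \<Rightarrow> ('x \<Rightarrow> real^'n^'n) \<Rightarrow>
   'x::euclidean_space \<times> (real^'m) \<times> (real^'n^'n) \<Rightarrow> 'x \<times> (real^'m) \<times> (real^'n^'n)" where
  "KKT_residual f h g = (\<lambda>(x, \<xi>, \<Gamma>).
     (gradient (Lagr f h g \<xi> \<Gamma>) x, h x, - g x + proj_psd (g x + \<Gamma>)))"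


section \<open>Regularity conditions\<close>

text \<open>Here \<open>P\<close> and \<open>l\<close> are an eigenvector matrix and the eigenvalues of \<open>g x + \<Gamma>\<close>.\<close>

definition rotated_deriv ::
  "('x \<Rightarrow> real^'n^'n) \<Rightarrow> 'x::euclidean_space \<Rightarrow> real^'n^'n \<Rightarrow> 'x \<Rightarrow> real^'n^'n" where
  "rotated_deriv g x P dx = transpose P ** jac g x dx ** P"

definition constraint_nondegeneracy ::
  "('x \<Rightarrow> real^'m) \<Rightarrow> ('x \<Rightarrow> real^'n^'n) \<Rightarrow> 'x::euclidean_space \<Rightarrow>
   real^'n^'n \<Rightarrow> real^'n \<Rightarrow> bool" where
  "constraint_nondegeneracy h g x P l \<longleftrightarrow>
     range (\<lambda>dx. (jac h x dx, jac g x dx)) +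
     {0} \<times> {P ** B ** transpose P | B. B \<in> sym_mats \<and> zero_block (zero_idx l) (zero_idx l) B \<and>
               zero_block (zero_idx l) (neg_idx l) B \<and> zero_block (neg_idx l) (neg_idx l) B}
     = UNIV \<times> sym_mats"

definition W_SRCQ ::
  "('x \<Rightarrow> real^'m) \<Rightarrow> ('x \<Rightarrow> real^'n^'n) \<Rightarrow> 'x::euclidean_space \<Rightarrow>
   real^'n^'n \<Rightarrow> real^'n \<Rightarrow> bool" where
  "W_SRCQ h g x P l \<longleftrightarrow>
     range (\<lambda>dx. (jac h x dx, jac g x dx)) +
     {0} \<times> {P ** B ** transpose P | B. B \<in> sym_mats \<and>
               zero_block (zero_idx l) (neg_idx l) B \<and> zero_block (neg_idx l) (neg_idx l) B}
     = UNIV \<times> sym_mats"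

definition curvature ::
  "('x \<Rightarrow> real) \<Rightarrow> ('x \<Rightarrow> real^'m) \<Rightarrow> ('x \<Rightarrow> real^'n^'n) \<Rightarrow>
   'x::euclidean_space \<times> (real^'m) \<times> (real^'n^'n) \<Rightarrow> real^'n^'n \<Rightarrow> real^'n \<Rightarrow> 'x \<Rightarrow> real" where
  "curvature f h g = (\<lambda>(x, \<xi>, \<Gamma>) P l dx.
     dx \<bullet> hessian (Lagr f h g \<xi> \<Gamma>) x dx
     - 2 * (\<Sum>i\<in>pos_idx l. \<Sum>j\<in>neg_idx l. l $ j / l $ i * (rotated_deriv g x P dx $ i $ j)\<^sup>2))"

definition W_SOC ::
  "('x \<Rightarrow> real) \<Rightarrow> ('x \<Rightarrow> real^'m) \<Rightarrow> ('x \<Rightarrow> real^'n^'n) \<Rightarrow>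
   'x::euclidean_space \<times> (real^'m) \<times> (real^'n^'n) \<Rightarrow> real^'n^'n \<Rightarrow> real^'n \<Rightarrow> bool" where
  "W_SOC f h g = (\<lambda>(x, \<xi>, \<Gamma>) P l.
     \<forall>dx. dx \<noteq> 0 \<and> jac h x dx = 0 \<and>
          zero_block (zero_idx l) (zero_idx l) (rotated_deriv g x P dx) \<and>
          zero_block (zero_idx l) (neg_idx l) (rotated_deriv g x P dx) \<and>
          zero_block (neg_idx l) (neg_idx l) (rotated_deriv g x P dx)
       \<longrightarrow> curvature f h g (x, \<xi>, \<Gamma>) P l dx > 0)"

definition S_SOSC ::
  "('x \<Rightarrow> real) \<Rightarrow> ('x \<Rightarrow> real^'m) \<Rightarrow> ('x \<Rightarrow> real^'n^'n) \<Rightarrow>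
   'x::euclidean_space \<times> (real^'m) \<times> (real^'n^'n) \<Rightarrow> real^'n^'n \<Rightarrow> real^'n \<Rightarrow> bool" where
  "S_SOSC f h g = (\<lambda>(x, \<xi>, \<Gamma>) P l.
     \<forall>dx. dx \<noteq> 0 \<and> jac h x dx = 0 \<and>
          zero_block (zero_idx l) (neg_idx l) (rotated_deriv g x P dx) \<and>
          zero_block (neg_idx l) (neg_idx l) (rotated_deriv g x P dx)
       \<longrightarrow> curvature f h g (x, \<xi>, \<Gamma>) P l dx > 0)"


section \<open>The semismooth Newton method with correction\<close>

text \<open>The correction and the operators below depend only on the decomposed matrix, not on the
  chosen eigenvalue decomposition.\<close>

definition correction ::
  "('x \<Rightarrow> real^'n^'n) \<Rightarrow> real \<Rightarrow>
   'x::euclidean_space \<times> (real^'m) \<times> (real^'n^'n) \<Rightarrow> 'x \<times> (real^'m) \<times> (real^'n^'n)" where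
  "correction g \<delta> = (\<lambda>(x, \<xi>, \<Gamma>).
     let (P, l) = (SOME (P, l). eigen_decomp (g x + \<Gamma>) P l)
     in (x, \<xi>, \<Gamma> - (\<Sum>i | \<bar>l $ i\<bar> \<le> \<delta>. l $ i *\<^sub>R outer_prod (column i P) (column i P))))"

text \<open>Entrywise weights of the block matrices: 1 on the blocks \<open>aa\<close>, \<open>ab\<close>, \<open>ba\<close>, the quotient
  \<open>\<Xi>\<close> on \<open>ac\<close> and its transpose on \<open>ca\<close>, 0 on \<open>bc\<close>, \<open>cb\<close>, \<open>cc\<close>, and \<open>w\<close> on \<open>bb\<close>. Thus \<open>w = 0\<close>
  gives the operator with zero \<open>bb\<close> block and \<open>w = 1\<close> the one with identity \<open>bb\<close> block.\<close>

definition block_weight :: "real \<Rightarrow> real^'n \<Rightarrow> 'n \<Rightarrow> 'n \<Rightarrow> real" where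
  "block_weight w l i j =
    (let a = pos_idx l; b = zero_idx l; c = neg_idx l in
     if i \<in> a \<and> j \<in> a \<or> i \<in> a \<and> j \<in> b \<or> i \<in> b \<and> j \<in> a then 1
     else if i \<in> a \<and> j \<in> c then l $ i / (l $ i - l $ j)
     else if i \<in> c \<and> j \<in> a then l $ j / (l $ j - l $ i)
     else if i \<in> b \<and> j \<in> b then w
     else 0)"

definition V_op :: "real \<Rightarrow> 'n::{finite,linorder} rmat \<Rightarrow> 'n rmat \<Rightarrow> 'n rmat" where
  "V_op w A H =
    (let (P, l) = (SOME (P, l). ordered_eigen_decomp A P l);
         Ht = transpose P ** H ** P
     in P ** (\<chi> i j. block_weight w l i j * Ht $ i $ j) ** transpose P)"

definition U_op ::
  "real \<Rightarrow> ('x \<Rightarrow> real) \<Rightarrow> ('x \<Rightarrow> real^'m) \<Rightarrow> ('x \<Rightarrow> 'n rmat) \<Rightarrow>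
   'x::euclidean_space \<times> (real^'m) \<times> 'n::{finite,linorder} rmat \<Rightarrow>
   'x \<times> (real^'m) \<times> 'n rmat \<Rightarrow> 'x \<times> (real^'m) \<times> 'n rmat" where
  "U_op w f h g = (\<lambda>(x, \<xi>, \<Gamma>) (dx, d\<xi>, d\<Gamma>).
     (hessian (Lagr f h g \<xi> \<Gamma>) x dx + adjoint (jac h x) d\<xi> + adjoint (jac g x) d\<Gamma>,
      jac h x dx,
      - jac g x dx + V_op w (g x + \<Gamma>) (jac g x dx + d\<Gamma>)))"

abbreviation "U_zero \<equiv> U_op 0"
abbreviation "U_id \<equiv> U_op 1"

definition nonsingular_on :: "'a set \<Rightarrow> ('a \<Rightarrow> 'a) \<Rightarrow> bool" where
  "nonsingular_on S T \<longleftrightarrow> bij_betw T S S"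

text \<open>The first \<open>K\<close> steps of the method, where \<open>U Z\<close> is the operator used at the iterate \<open>Z\<close>.\<close>

definition newton_steps ::
  "('x \<Rightarrow> real) \<Rightarrow> ('x \<Rightarrow> real^'m) \<Rightarrow> ('x \<Rightarrow> real^'n^'n) \<Rightarrow>
   ('x \<times> (real^'m) \<times> (real^'n^'n) \<Rightarrow> 'x \<times> (real^'m) \<times> (real^'n^'n) \<Rightarrow> 'x \<times> (real^'m) \<times> (real^'n^'n)) \<Rightarrow>
   real \<Rightarrow> real \<Rightarrow> real \<Rightarrow> 'x \<times> (real^'m) \<times> (real^'n^'n) \<Rightarrow>
   (nat \<Rightarrow> 'x::euclidean_space \<times> (real^'m) \<times> (real^'n^'n)) \<Rightarrow>
   (nat \<Rightarrow> 'x \<times> (real^'m) \<times> (real^'n^'n)) \<Rightarrow> nat \<Rightarrow> bool" where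
  "newton_steps f h g U \<delta> \<eta> \<tau> Zhat0 Z d K \<longleftrightarrow>
     Z 0 = correction g \<delta> Zhat0 \<and>
     (\<forall>k<K. d k \<in> Zspace \<and>
        norm (U (Z k) (d k) + KKT_residual f h g (Z k))
          \<le> min \<eta> (norm (KKT_residual f h g (Z k)) powr \<tau>) * norm (KKT_residual f h g (Z k)) \<and>
        Z (Suc k) = correction g \<delta> (Z k + d k))"

text \<open>Every operator met at an iterate reachable in finitely many steps is nonsingular; this
  guarantees that each step can be carried out.\<close>

definition newton_well_defined ::
  "('x \<Rightarrow> real) \<Rightarrow> ('x \<Rightarrow> real^'m) \<Rightarrow> ('x \<Rightarrow> real^'n^'n) \<Rightarrow>
   ('x \<times> (real^'m) \<times> (real^'n^'n) \<Rightarrow> 'x \<times> (real^'m) \<times> (real^'n^'n) \<Rightarrow> 'x \<times> (real^'m) \<times> (real^'n^'n)) \<Rightarrow>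
   real \<Rightarrow> real \<Rightarrow> real \<Rightarrow> 'x::euclidean_space \<times> (real^'m) \<times> (real^'n^'n) \<Rightarrow> bool" where
  "newton_well_defined f h g U \<delta> \<eta> \<tau> Zhat0 \<longleftrightarrow>
     (\<forall>Z d K. newton_steps f h g U \<delta> \<eta> \<tau> Zhat0 Z d K \<longrightarrow> nonsingular_on Zspace (U (Z K)))"

definition newton_sequence ::
  "('x \<Rightarrow> real) \<Rightarrow> ('x \<Rightarrow> real^'m) \<Rightarrow> ('x \<Rightarrow> real^'n^'n) \<Rightarrow>
   ('x \<times> (real^'m) \<times> (real^'n^'n) \<Rightarrow> 'x \<times> (real^'m) \<times> (real^'n^'n) \<Rightarrow> 'x \<times> (real^'m) \<times> (real^'n^'n)) \<Rightarrow>
   real \<Rightarrow> real \<Rightarrow> real \<Rightarrow> 'x \<times> (real^'m) \<times> (real^'n^'n) \<Rightarrow>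
   (nat \<Rightarrow> 'x::euclidean_space \<times> (real^'m) \<times> (real^'n^'n)) \<Rightarrow> bool" where
  "newton_sequence f h g U \<delta> \<eta> \<tau> Zhat0 Z \<longleftrightarrow>
     (\<exists>d. \<forall>K. newton_steps f h g U \<delta> \<eta> \<tau> Zhat0 Z d K)"

definition superlinear_conv :: "(nat \<Rightarrow> 'a::real_normed_vector) \<Rightarrow> 'a \<Rightarrow> bool" where
  "superlinear_conv Z Zbar \<longleftrightarrow> Z \<longlonglongrightarrow> Zbar \<and>
     (\<lambda>k. norm (Z (Suc k) - Zbar)) \<in> o(\<lambda>k. norm (Z k - Zbar))"

definition quadratic_conv :: "(nat \<Rightarrow> 'a::real_normed_vector) \<Rightarrow> 'a \<Rightarrow> bool" where
  "quadratic_conv Z Zbar \<longleftrightarrow> Z \<longlonglongrightarrow> Zbar \<and>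
     (\<lambda>k. norm (Z (Suc k) - Zbar)) \<in> O(\<lambda>k. (norm (Z k - Zbar))\<^sup>2)"

end

theory Submission
  imports Defs
begin

text \<open>After a correction step every eigenvalue of \<open>A = g x + \<Gamma>\<close> is either \<open>0\<close> or larger than \<open>\<delta>\<close> in
  modulus, as at the reference point \<open>A' = g xbar + \<Gamma>bar\<close>. If \<open>R = P\<^sup>T P'\<close> relates eigenbases of \<open>A\<close>
  and \<open>A'\<close>, then \<open>R\<^sub>i\<^sub>k (\<lambda>\<^sub>i - \<lambda>'\<^sub>k) = (P\<^sup>T (A - A') P')\<^sub>i\<^sub>k\<close>, so \<open>R\<^sub>i\<^sub>k\<close> is of order \<open>\<parallel>A - A'\<parallel>\<close> whenever
  \<open>\<lambda>\<^sub>i\<close> and \<open>\<lambda>'\<^sub>k\<close> have different signs. On corrected points the operators of the method are therefore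
  Lipschitz in \<open>A\<close> and the projection onto the cone has a second-order expansion around \<open>A'\<close>; without
  the correction the operators are discontinuous at \<open>A'\<close> if \<open>0\<close> is an eigenvalue. Thus only the single operator at the KKT point has to be
  nonsingular, which is what the second order condition and the constraint qualification give, and
  the usual Newton estimate applies. The correction itself is harmless because it removes only
  eigenvalues which are bounded by \<open>\<parallel>A - A'\<parallel>\<close>.\<close>

section \<open>Frobenius inner product and orthogonal matrices\<close>

text \<open>Eigenvectors of \<open>A\<close> need not converge when \<open>A\<close> tends to
  \<open>A'\<close>, and a multiple eigenvalue admits no canonical matching of eigenvectors. Hence
  none is tracked and no eigenvalues are paired by rank: estimates are written in the entries of the
  overlap \<open>R\<close>, and each difference \<open>l $ i - l' $ k\<close> is placed next to the
  factor \<open>R $ i $ k\<close> that absorbs it. Between eigenvalues of equal sign it is this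
  pairing, not smallness of \<open>R\<close>, that gives the Lipschitz bounds. A second-order bound
  needs two such differences, one for each factor of \<open>R $ i $ k * R $ j $ k\<close>. The two
  operators differ only in the weight \<open>w\<close> of the block of zero eigenvalues, so one
  argument with \<open>w\<close> equal to 0 or 1 serves both parts. The Taylor remainder of the
  Lagrangian gradient, \<open>grad_rem\<close>, is carried as a separate term through the Newton
  estimate. It is the only place where the smoothness of the second derivatives enters: continuity
  makes it small against the distance to the KKT point, Lipschitz continuity makes it quadratic. The
  inexactness is controlled by the power of the residual in the stopping rule.\<close>

lemma inner_matrix: "A \<bullet> B = (\<Sum>i\<in>UNIV. \<Sum>j\<in>UNIV. A $ i $ j * B $ i $ j)"
  for A B :: "real^'m^'n"
  by (simp add: inner_vec_def)

lemma transpose_nth [simp]: "transpose A $ i $ j = A $ j $ i"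
  by (simp add: transpose_def)

lemma matrix_mul_nth: "(A ** B) $ i $ j = (\<Sum>k\<in>UNIV. A $ i $ k * B $ k $ j)"
  by (simp add: matrix_matrix_mult_def)

lemma matrix_diff_ldistrib: "A ** (B - C) = A ** B - A ** C" for A :: "real^'m^'n"
  by (simp add: vec_eq_iff matrix_mul_nth sum_subtractf algebra_simps)

lemma matrix_diff_rdistrib: "(B - C) ** A = B ** A - C ** A" for A :: "real^'m^'n"
  by (simp add: vec_eq_iff matrix_mul_nth sum_subtractf algebra_simps)

lemma matrix_add_rdistrib: "(B + C) ** A = B ** A + C ** A" for A :: "real^'m^'n"
  by (simp add: vec_eq_iff matrix_mul_nth sum.distrib algebra_simps)

lemma inner_transpose: "transpose A \<bullet> transpose B = A \<bullet> B" for A B :: "real^'m^'n"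
  unfolding inner_matrix by (subst sum.swap) simp

lemma inner_matrix_mul_left: "A \<bullet> (P ** B) = (transpose P ** A) \<bullet> B"
  for A :: "real^'m^'n" and P :: "real^'k^'n"
proof -
  have "A \<bullet> (P ** B) = (\<Sum>i\<in>UNIV. \<Sum>j\<in>UNIV. \<Sum>k\<in>UNIV. A $ i $ j * P $ i $ k * B $ k $ j)"
    by (simp add: inner_matrix matrix_mul_nth sum_distrib_left mult.assoc)
  also have "\<dots> = (\<Sum>i\<in>UNIV. \<Sum>k\<in>UNIV. \<Sum>j\<in>UNIV. A $ i $ j * P $ i $ k * B $ k $ j)"
    by (rule sum.cong[OF refl], rule sum.swap)
  also have "\<dots> = (\<Sum>k\<in>UNIV. \<Sum>i\<in>UNIV. \<Sum>j\<in>UNIV. A $ i $ j * P $ i $ k * B $ k $ j)"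
    by (rule sum.swap)
  also have "\<dots> = (\<Sum>k\<in>UNIV. \<Sum>j\<in>UNIV. \<Sum>i\<in>UNIV. A $ i $ j * P $ i $ k * B $ k $ j)"
    by (rule sum.cong[OF refl], rule sum.swap)
  also have "\<dots> = (transpose P ** A) \<bullet> B"
    by (simp add: inner_matrix matrix_mul_nth sum_distrib_left sum_distrib_right mult_ac)
  finally show ?thesis .
qed

lemma inner_matrix_mul_right: "A \<bullet> (B ** P) = (A ** transpose P) \<bullet> B"
  for A :: "real^'m^'n" and P :: "real^'m^'k"
proof -
  have "A \<bullet> (B ** P) = transpose A \<bullet> (transpose P ** transpose B)"
    by (metis inner_transpose matrix_transpose_mul)
  also have "\<dots> = transpose (A ** transpose P) \<bullet> transpose B"
    by (simp add: inner_matrix_mul_left matrix_transpose_mul)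
  finally show ?thesis by (simp add: inner_transpose)
qed

lemma orthogonal_matrixD:
  "orthogonal_matrix P \<Longrightarrow> transpose P ** P = mat 1"
  "orthogonal_matrix P \<Longrightarrow> P ** transpose P = mat 1"
  by (auto simp: orthogonal_matrix_def)

lemma orthogonal_cancel:
  assumes "orthogonal_matrix P"
  shows "transpose P ** (P ** A) = A" "P ** (transpose P ** A) = A"
    "A ** P ** transpose P = A" "A ** transpose P ** P = A"
proof -
  show "transpose P ** (P ** A) = A" "P ** (transpose P ** A) = A"
    by (simp_all add: matrix_mul_assoc orthogonal_matrixD[OF assms])
  show "A ** P ** transpose P = A" "A ** transpose P ** P = A"
    by (simp_all add: matrix_mul_assoc[symmetric] orthogonal_matrixD[OF assms])
qed

lemma inner_conj:
  "A \<bullet> (P ** B ** transpose P) = (transpose P ** A ** P) \<bullet> B"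
  for A B P :: "real^'n^'n"
proof -
  have "A \<bullet> (P ** B ** transpose P) = (A ** P) \<bullet> (P ** B)"
    by (subst inner_matrix_mul_right) simp
  then show ?thesis by (simp add: inner_matrix_mul_left[of "A ** P"] matrix_mul_assoc)
qed

lemma norm_orthogonal_mul_left:
  fixes P A :: "real^'n^'n"
  assumes "orthogonal_matrix P"
  shows "norm (P ** A) = norm A"
  by (simp add: norm_eq_sqrt_inner inner_matrix_mul_left[of "P ** A"] orthogonal_cancel[OF assms])

lemma norm_orthogonal_mul_right:
  fixes P A :: "real^'n^'n"
  assumes "orthogonal_matrix P"
  shows "norm (A ** P) = norm A"
  by (simp add: norm_eq_sqrt_inner inner_matrix_mul_right[of "A ** P"] orthogonal_cancel[OF assms])

lemma norm_conj:
  fixes P Q :: "real^'n^'n"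
  assumes "orthogonal_matrix P" "orthogonal_matrix Q"
  shows "norm (transpose P ** A ** Q) = norm A"
  using assms by (simp add: norm_orthogonal_mul_right norm_orthogonal_mul_left)

lemma matrix_entry_le_norm: "\<bar>A $ i $ j\<bar> \<le> norm A" for A :: "real^'m^'n"
  by (metis component_le_norm_cart Finite_Cartesian_Product.norm_nth_le order_trans)

lemma norm_le_sum_entries: "norm A \<le> (\<Sum>i\<in>UNIV. \<Sum>j\<in>UNIV. \<bar>A $ i $ j\<bar>)" for A :: "real^'m^'n"
proof -
  have "norm A \<le> (\<Sum>i\<in>UNIV. norm (A $ i))"
    by (simp add: norm_vec_def L2_set_le_sum)
  also have "\<dots> \<le> (\<Sum>i\<in>UNIV. \<Sum>j\<in>UNIV. \<bar>A $ i $ j\<bar>)"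
    by (intro sum_mono norm_le_l1_cart)
  finally show ?thesis .
qed

text \<open>Matrix estimates below are made entry by entry in an eigenbasis; this crude way back to
  the Frobenius norm is one source of the powers of the dimension in the constants.\<close>

lemma norm_le_entry_bound:
  fixes A :: "real^'n^'n"
  assumes "\<And>i j. \<bar>A $ i $ j\<bar> \<le> c"
  shows "norm A \<le> (real CARD('n))\<^sup>2 * c"
proof -
  have "(\<Sum>i\<in>UNIV. \<Sum>j\<in>UNIV. \<bar>A $ i $ j\<bar>) \<le> (\<Sum>i\<in>(UNIV::'n set). \<Sum>j\<in>(UNIV::'n set). c)"
    by (intro sum_mono assms)
  then show ?thesis
    using norm_le_sum_entries[of A] by (simp add: power2_eq_square mult.assoc)
qed

lemma column_dot:
  "column i P \<bullet> column j P = (transpose P ** P) $ i $ j"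
  by (simp add: matrix_mult_transpose_dot_column)

lemma conj_nth_columns:
  "(transpose P ** A ** Q) $ i $ j = column i P \<bullet> (A *v column j Q)"
  for A :: "real^'n^'n"
  by (simp add: matrix_mul_nth matrix_vector_mult_def inner_vec_def column_def
      matrix_mul_assoc[symmetric])

lemma orthogonal_entry_le_1: "orthogonal_matrix P \<Longrightarrow> \<bar>P $ i $ j\<bar> \<le> 1" for P :: "real^'n^'n"
  by (metis orthogonal_matrix_orthonormal_rows component_le_norm_cart row_def vec_lambda_eta)

lemma orthogonal_row_sums:
  fixes P :: "real^'n^'n"
  assumes "orthogonal_matrix P"
  shows "(\<Sum>k\<in>UNIV. P $ i $ k * P $ j $ k) = (if i = j then 1 else 0)"
  using arg_cong[OF orthogonal_matrixD(2)[OF assms], of "\<lambda>A. A $ i $ j"]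
  by (simp add: matrix_mul_nth mat_def)

lemma Diag_nth [simp]: "Diag l $ i $ j = (if i = j then l $ i else 0)"
  by (simp add: Diag_def)

lemma mul_Diag_nth: "(A ** Diag l) $ i $ j = A $ i $ j * l $ j"
  by (simp add: matrix_mul_nth if_distrib cong: if_cong)

lemma Diag_mul_nth: "(Diag l ** A) $ i $ j = l $ i * A $ i $ j"
  by (simp add: matrix_mul_nth if_distrib if_distribR cong: if_cong)

lemma conj_Diag_nth:
  "(P ** Diag l ** transpose P) $ i $ j = (\<Sum>k\<in>UNIV. l $ k * (P $ i $ k * P $ j $ k))"
  by (subst matrix_mul_nth) (simp add: mul_Diag_nth mult_ac)

lemma transpose_Diag [simp]: "transpose (Diag l) = Diag l"
  by (simp add: vec_eq_iff)

lemma sym_matsD: "A \<in> sym_mats \<Longrightarrow> A $ i $ j = A $ j $ i"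
  by (metis (mono_tags, lifting) mem_Collect_eq sym_mats_def transpose_nth)

lemma sym_matsI: "(\<And>i j. A $ i $ j = A $ j $ i) \<Longrightarrow> A \<in> sym_mats"
  by (simp add: sym_mats_def vec_eq_iff)

lemma subspace_sym_mats: "subspace sym_mats"
  by (auto simp: subspace_def sym_mats_def vec_eq_iff)

lemma sym_conj: "A \<in> sym_mats \<Longrightarrow> P ** A ** transpose P \<in> sym_mats"
  by (simp add: sym_mats_def matrix_transpose_mul matrix_mul_assoc)

lemma sym_conj': "A \<in> sym_mats \<Longrightarrow> transpose P ** A ** P \<in> sym_mats"
  by (simp add: sym_mats_def matrix_transpose_mul matrix_mul_assoc)

lemma Diag_sym [simp]: "Diag l \<in> sym_mats"
  by (simp add: sym_mats_def)

lemma eigen_decomp_sym: "eigen_decomp A P l \<Longrightarrow> A \<in> sym_mats"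
  by (simp add: eigen_decomp_def sym_conj)

section \<open>Ordered spectral decomposition\<close>

text \<open>Entries of modulus at most 1 give boundedness; closedness holds because
  \<open>transpose P ** P = mat 1\<close> is a system of polynomial equations in the entries.
  Compactness supplies the maximiser in the spectral theorem.\<close>

lemma compact_orthogonal: "compact {P :: real^'n^'n. orthogonal_matrix P}"
proof -
  have "\<And>P::real^'n^'n. orthogonal_matrix P \<Longrightarrow> norm P \<le> (real CARD('n))\<^sup>2 * 1"
    by (intro norm_le_entry_bound orthogonal_entry_le_1)
  then have "bounded {P :: real^'n^'n. orthogonal_matrix P}"
    by (auto simp: bounded_iff)
  moreover have "{P :: real^'n^'n. orthogonal_matrix P}
     = (\<Inter>i j. {P. (\<Sum>k\<in>UNIV. P $ k $ i * P $ k $ j) = (if i = j then 1 else 0)})"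
    by (auto simp: orthogonal_matrix vec_eq_iff matrix_mul_nth mat_def)
  then have "closed {P :: real^'n^'n. orthogonal_matrix P}"
    by (auto intro!: closed_Collect_eq continuous_intros)
  ultimately show ?thesis by (simp add: compact_eq_bounded_closed)
qed

text \<open>Plane rotations of two columns are the variations against which a maximiser over the
  orthogonal matrices is tested.\<close>

lemma orthogonal_matrix_rotate_columns:
  fixes P :: "real^'n^'n"
  assumes P: "orthogonal_matrix P" and "i \<noteq> j" and cs: "c\<^sup>2 + s\<^sup>2 = 1"
  obtains Q where "orthogonal_matrix Q" "column i Q = c *\<^sub>R column i P + s *\<^sub>R column j P"
    "column j Q = c *\<^sub>R column j P - s *\<^sub>R column i P" "\<And>k. k \<noteq> i \<Longrightarrow> k \<noteq> j \<Longrightarrow> column k Q = column k P"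
proof -
  define q where "q k = (if k = i then c *\<^sub>R column i P + s *\<^sub>R column j P
    else if k = j then c *\<^sub>R column j P - s *\<^sub>R column i P else column k P)" for k
  define Q where "Q = (\<chi> r k. q k $ r)"
  have col: "column k Q = q k" for k by (simp add: Q_def column_def vec_eq_iff)
  have dot: "column k P \<bullet> column m P = (if k = m then 1 else 0)" for k m
    by (simp add: column_dot orthogonal_matrixD[OF P] mat_def)
  have "(transpose Q ** Q) $ k $ m = mat 1 $ k $ m" for k m
    using \<open>i \<noteq> j\<close> cs
    by (auto simp: column_dot[symmetric] col mat_def q_def inner_add inner_diff dot power2_eq_square algebra_simps)
  then have "orthogonal_matrix Q" by (simp add: orthogonal_matrix vec_eq_iff)
  then show thesis using that[of Q] \<open>i \<noteq> j\<close> by (simp add: col q_def)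
qed

text \<open>Maximise \<open>\<Sum>k. d\<^sub>k (P\<^sup>T A P)\<^sub>k\<^sub>k\<close> with strictly decreasing weights \<open>d\<close> over the orthogonal
  matrices: rotations in the \<open>(i,j)\<close>-plane show that a maximiser diagonalises \<open>A\<close> and orders the
  eigenvalues.\<close>

theorem ordered_eigen_decomp_exists:
  fixes A :: "'n::{finite,linorder} rmat"
  assumes A: "A \<in> sym_mats"
  shows "\<exists>P l. ordered_eigen_decomp A P l"
proof -
  \<comment> \<open>Any strictly decreasing weights would do; counting predecessors provides them on
    an arbitrary finite linear order.\<close>
  define d :: "'n \<Rightarrow> real" where "d k = - real (card {..k})" for k
  have d: "d j < d i" if "i < j" for i j
    unfolding d_def using that
    by (simp add: psubset_card_mono[OF finite, of "{..i}" "{..j}"] psubset_eq order.strict_implies_order)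
  define \<phi> where "\<phi> P = (\<Sum>k\<in>UNIV. d k * (transpose P ** A ** P) $ k $ k)" for P
  have "continuous_on UNIV \<phi>"
    unfolding \<phi>_def by (auto simp: matrix_mul_nth intro!: continuous_intros)
  then have "\<exists>P\<in>{P. orthogonal_matrix P}. \<forall>Q\<in>{P. orthogonal_matrix P}. \<phi> Q \<le> \<phi> P"
    by (intro continuous_attains_sup compact_orthogonal)
      (auto intro: orthogonal_matrix_id continuous_on_subset)
  then obtain P where P: "orthogonal_matrix P" and max: "\<And>Q. orthogonal_matrix Q \<Longrightarrow> \<phi> Q \<le> \<phi> P"
    by auto
  define M where "M = transpose P ** A ** P"
  have Msym: "M $ i $ j = M $ j $ i" for i j
    using sym_conj'[OF A, of P] by (simp add: M_def sym_matsD)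
  have M: "M $ i $ j = column i P \<bullet> (A *v column j P)" for i j
    by (simp add: M_def conj_nth_columns)
  have key: "(d i - d j) * (s\<^sup>2 * (M $ j $ j - M $ i $ i) + 2 * c * s * M $ i $ j) \<le> 0"
    if "i \<noteq> j" for i j c s
  proof -
    have unit: "(d i - d j) * (s\<^sup>2 * (M $ j $ j - M $ i $ i) + 2 * c * s * M $ i $ j) \<le> 0"
      if cs: "c\<^sup>2 + s\<^sup>2 = 1" for c s
    proof -
      obtain Q where Q: "orthogonal_matrix Q"
        and qi: "column i Q = c *\<^sub>R column i P + s *\<^sub>R column j P"
        and qj: "column j Q = c *\<^sub>R column j P - s *\<^sub>R column i P"
        and qk: "\<And>k. k \<noteq> i \<Longrightarrow> k \<noteq> j \<Longrightarrow> column k Q = column k P"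
        using orthogonal_matrix_rotate_columns[OF P \<open>i \<noteq> j\<close> cs] by blast
      define N where "N = transpose Q ** A ** Q"
      have N: "N $ k $ m = column k Q \<bullet> (A *v column m Q)" for k m
        by (simp add: N_def conj_nth_columns)
      have Nk: "N $ k $ k = M $ k $ k" if "k \<noteq> i" "k \<noteq> j" for k
        using that by (simp add: N M qk)
      have Ni: "N $ i $ i = c\<^sup>2 * M $ i $ i + s\<^sup>2 * M $ j $ j + 2 * c * s * M $ i $ j"
        using Msym[of i j] by (simp add: N qi matrix_vector_right_distrib matrix_vector_mult_scaleR
            inner_add power2_eq_square M[symmetric] algebra_simps)
      have Nj: "N $ j $ j = c\<^sup>2 * M $ j $ j + s\<^sup>2 * M $ i $ i - 2 * c * s * M $ i $ j"
        using Msym[of i j] by (simp add: N qj matrix_vector_mult_diff_distrib matrix_vector_mult_scaleR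
            inner_diff power2_eq_square M[symmetric] algebra_simps)
      have "(\<Sum>k\<in>UNIV. d k * (N $ k $ k - M $ k $ k)) = (\<Sum>k\<in>{i,j}. d k * (N $ k $ k - M $ k $ k))"
        by (rule sum.mono_neutral_right) (auto simp: Nk)
      also have "\<dots> = d i * (N $ i $ i - M $ i $ i) + d j * (N $ j $ j - M $ j $ j)"
        using \<open>i \<noteq> j\<close> by simp
      also have "\<dots> = (d i - d j) * (s\<^sup>2 * (M $ j $ j - M $ i $ i) + 2 * c * s * M $ i $ j)"
      proof -
        have c2: "c\<^sup>2 = 1 - s\<^sup>2" using cs by simp
        show ?thesis by (simp add: Ni Nj c2 algebra_simps)
      qed
      also have "(\<Sum>k\<in>UNIV. d k * (N $ k $ k - M $ k $ k)) = \<phi> Q - \<phi> P"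
        by (simp add: \<phi>_def N_def[symmetric] M_def[symmetric] sum_subtractf algebra_simps)
      finally show ?thesis using max[OF Q] by simp
    qed
    show ?thesis
    proof (cases "c = 0 \<and> s = 0")
      case False
      define r where "r = sqrt (c\<^sup>2 + s\<^sup>2)"
      have r: "r > 0" and r2: "r\<^sup>2 = c\<^sup>2 + s\<^sup>2"
        using False by (auto simp: r_def sum_power2_gt_zero_iff)
      have "(c / r)\<^sup>2 + (s / r)\<^sup>2 = 1"
        using r by (simp add: power_divide r2[symmetric] add_divide_distrib[symmetric])
      from unit[OF this]
      have "r\<^sup>2 * ((d i - d j) * ((s / r)\<^sup>2 * (M $ j $ j - M $ i $ i) + 2 * (c / r) * (s / r) * M $ i $ j)) \<le> 0"
        by (rule mult_nonneg_nonpos[rotated]) simp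
      also have "r\<^sup>2 * ((d i - d j) * ((s / r)\<^sup>2 * (M $ j $ j - M $ i $ i) + 2 * (c / r) * (s / r) * M $ i $ j))
        = (d i - d j) * (s\<^sup>2 * (M $ j $ j - M $ i $ i) + 2 * c * s * M $ i $ j)"
        using r by (simp add: field_simps power2_eq_square)
      finally show ?thesis .
    qed simp
  qed
  have ord: "M $ j $ j \<le> M $ i $ i" if "i \<le> j" for i j
  proof (cases "i = j")
    case False
    then have "(d i - d j) * (M $ j $ j - M $ i $ i) \<le> 0" using key[of i j 1 0] by simp
    moreover have "d i - d j > 0" using d[of i j] False that by simp
    ultimately show ?thesis by (simp add: mult_le_0_iff)
  qed simp
  have diag: "M $ i $ j = 0" if "i < j" for i j
  proof (rule ccontr)
    assume nz: "M $ i $ j \<noteq> 0"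
    \<comment> \<open>With \<open>s = 1\<close> the inequality bounds an affine function of
      \<open>c\<close> from above by 0, which forces its slope to vanish; the value of
      \<open>c\<close> chosen below would make the function equal to 1.\<close>
    define a where "a = M $ j $ j - M $ i $ i"
    have "(d i - d j) * (a + 2 * c * M $ i $ j) \<le> 0" for c
      using key[of i j 1 c] that by (simp add: a_def)
    moreover have "d i - d j > 0" using d[OF that] by simp
    ultimately have "a + 2 * c * M $ i $ j \<le> 0" for c by (simp add: mult_le_0_iff not_less)
    from this[of "(1 - a) / (2 * M $ i $ j)"] nz show False by (simp add: diff_divide_distrib left_diff_distrib)
  qed
  define l where "l = (\<chi> k. M $ k $ k)"
  have "M = Diag l"
    unfolding vec_eq_iff l_def using diag Msym by (auto, metis linorder_neqE)
  then have "A = P ** Diag l ** transpose P"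
    by (metis M_def P matrix_mul_assoc orthogonal_cancel(2) orthogonal_cancel(3))
  then have "eigen_decomp A P l" using P by (simp add: eigen_decomp_def)
  moreover have "antimono (\<lambda>i. l $ i)" using ord by (auto simp: l_def intro: antimonoI)
  ultimately show ?thesis by (auto simp: ordered_eigen_decomp_def)
qed

section \<open>Schur multipliers in an eigenbasis\<close>

text \<open>The eigenvalues that can survive the correction. The strict inequality matches the
  removal of every eigenvalue of modulus at most \<open>\<delta>\<close>.\<close>

definition gapped :: "real \<Rightarrow> real set" where
  "gapped \<delta> = {x. x = 0 \<or> \<delta> < \<bar>x\<bar>}"

text \<open>For distinct \<open>s\<close> and \<open>t\<close> this is the first divided difference
  of \<open>max 0\<close>, that is \<open>(max 0 s - max 0 t) / (s - t)\<close>; on the diagonal it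
  is the derivative, with \<open>w\<close> in place of the missing derivative at 0.\<close>

definition sign_weight :: "real \<Rightarrow> real \<Rightarrow> real \<Rightarrow> real" where
  "sign_weight w s t =
    (if s = 0 \<and> t = 0 then w
     else if 0 \<le> s \<and> 0 \<le> t then 1
     else if 0 < s \<and> t < 0 then s / (s - t)
     else if s < 0 \<and> 0 < t then t / (t - s)
     else 0)"

lemma block_weight_eq: "block_weight w l i j = sign_weight w (l $ i) (l $ j)"
  by (auto simp: block_weight_def sign_weight_def pos_idx_def zero_idx_def neg_idx_def Let_def)

lemma sign_weight_sym: "sign_weight w s t = sign_weight w t s"
  by (auto simp: sign_weight_def)

lemma sign_weight_bounds: "0 \<le> w \<Longrightarrow> w \<le> 1 \<Longrightarrow> 0 \<le> sign_weight w s t \<and> sign_weight w s t \<le> 1"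
  by (auto simp: sign_weight_def divide_simps)

lemma gapped_dist:
  assumes "s \<in> gapped \<delta>" "s' \<in> gapped \<delta>" "sgn s \<noteq> sgn s'"
  shows "\<delta> \<le> \<bar>s - s'\<bar>"
  using assms by (auto simp: gapped_def sgn_real_def split: if_splits)

text \<open>A change of the sign pattern costs at least \<open>\<delta>\<close> in one argument, so
  the right side is then at least 1, while weights lie between 0 and 1. With a fixed pattern only
  the quotient for opposite signs varies, and its denominator stays above
  \<open>\<delta>\<close>.\<close>

lemma sign_weight_lipschitz:
  assumes "0 < \<delta>" and w: "0 \<le> w" "w \<le> 1"
    and s: "s \<in> gapped \<delta>" "s' \<in> gapped \<delta>" and t: "t \<in> gapped \<delta>" "t' \<in> gapped \<delta>"
  shows "\<bar>sign_weight w s t - sign_weight w s' t'\<bar> \<le> (1 / \<delta>) * (\<bar>s - s'\<bar> + \<bar>t - t'\<bar>)"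
proof (cases "sgn s = sgn s' \<and> sgn t = sgn t'")
  case False
  then have "\<delta> \<le> \<bar>s - s'\<bar> + \<bar>t - t'\<bar>"
    using gapped_dist[OF s] gapped_dist[OF t] by fastforce
  moreover have "\<bar>sign_weight w s t - sign_weight w s' t'\<bar> \<le> 1"
    using sign_weight_bounds[OF w, of s t] sign_weight_bounds[OF w, of s' t'] by linarith
  moreover have "1 \<le> (1 / \<delta>) * (\<bar>s - s'\<bar> + \<bar>t - t'\<bar>)"
    using calculation(1) \<open>0 < \<delta>\<close> by simp
  ultimately show ?thesis by linarith
next
  case True
  have main: "\<bar>s / (s - t) - s' / (s' - t')\<bar> \<le> (1 / \<delta>) * (\<bar>s - s'\<bar> + \<bar>t - t'\<bar>)"
    if "\<delta> < s" "\<delta> < s'" "t < - \<delta>" "t' < - \<delta>" for s s' t t'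
  proof -
    have p: "0 < s - t" "\<delta> \<le> s' - t'" "0 < s' - t'" using that \<open>0 < \<delta>\<close> by auto
    \<comment> \<open>Both \<open>t / (s - t)\<close> and \<open>s / (s - t)\<close> have modulus at
      most 1 since \<open>s\<close> and \<open>t\<close> have opposite signs, so after this
      rewriting only \<open>s' - t'\<close> remains in the denominator.\<close>
    have "s / (s - t) - s' / (s' - t') = (t / (s - t) * (s' - s) + s / (s - t) * (t - t')) / (s' - t')"
    proof -
      obtain D D' where "s = t + D" "s' = t' + D'" by (metis add.commute diff_add_cancel)
      then show ?thesis using p by (simp add: field_simps)
    qed
    also have "\<bar>\<dots>\<bar> \<le> (\<bar>s - s'\<bar> + \<bar>t - t'\<bar>) / (s' - t')"
    proof -
      have "\<bar>t / (s - t)\<bar> \<le> 1" "\<bar>s / (s - t)\<bar> \<le> 1" using that \<open>0 < \<delta>\<close> by (auto simp: divide_simps)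
      then have "\<bar>t / (s - t) * (s' - s)\<bar> \<le> \<bar>s - s'\<bar>" "\<bar>s / (s - t) * (t - t')\<bar> \<le> \<bar>t - t'\<bar>"
        unfolding abs_mult by (metis abs_ge_zero abs_minus_commute mult_left_le_one_le)+
      then have "\<bar>t / (s - t) * (s' - s) + s / (s - t) * (t - t')\<bar> \<le> \<bar>s - s'\<bar> + \<bar>t - t'\<bar>"
        by (intro order_trans[OF abs_triangle_ineq] add_mono)
      then show ?thesis using p by (simp add: divide_right_mono)
    qed
    also have "\<dots> \<le> (\<bar>s - s'\<bar> + \<bar>t - t'\<bar>) / \<delta>"
      using p \<open>0 < \<delta>\<close> by (intro divide_left_mono) auto
    finally show ?thesis by simp
  qed
  have nn: "0 \<le> (1 / \<delta>) * (\<bar>s - s'\<bar> + \<bar>t - t'\<bar>)" using \<open>0 < \<delta>\<close> by simp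
  consider (pn) "s > 0" "t < 0" | (np) "s < 0" "t > 0" | (o) "\<not> (s > 0 \<and> t < 0)" "\<not> (s < 0 \<and> t > 0)"
    by blast
  then show ?thesis
  proof cases
    case pn
    then have "s' > 0" "t' < 0" using True by (auto simp: sgn_real_def split: if_splits)
    then show ?thesis using pn main[of s s' t t'] s t by (auto simp: sign_weight_def gapped_def)
  next
    case np
    then have "s' < 0" "t' > 0" using True by (auto simp: sgn_real_def split: if_splits)
    then show ?thesis using np main[of t t' s s'] s t by (auto simp: sign_weight_def gapped_def add.commute)
  next
    case o
    then have "sign_weight w s t = sign_weight w s' t'" using True by (auto simp: sgn_real_def sign_weight_def split: if_splits)
    then show ?thesis using nn by simp
  qed
qed

text \<open>The second-order expansion behind semismoothness: the correction term depends on \<open>s\<close> and \<open>t\<close>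
  only and vanishes for \<open>s = t\<close>, hence it disappears after summing against orthonormal rows.\<close>

lemma sign_weight_second_order:
  assumes "0 < \<delta>" and w: "w = 0 \<or> w = 1"
    and s: "s \<in> gapped \<delta>" and t: "t \<in> gapped \<delta>" and u: "u \<in> gapped \<delta>"
  shows "\<bar>max 0 u - sign_weight w s t * u - (if s * t < 0 then - (s * t) / \<bar>s - t\<bar> else 0)\<bar>
    \<le> \<bar>s - u\<bar> * \<bar>t - u\<bar> / \<delta>"
proof -
  \<comment> \<open>The subtracted function of \<open>u\<close> is the line through the points of
    the graph of \<open>max 0\<close> over \<open>s\<close> and \<open>t\<close>. The interpolation
    error vanishes at both nodes, which explains the product on the right. For \<open>u\<close> on
    the side of one node it is linear in the distance to that node, and the distance to the other
    node exceeds \<open>\<delta>\<close>; for \<open>u = 0\<close> it is computed exactly.\<close>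
  have opp: "\<bar>max 0 u - s / (s - t) * u - (- (s * t) / (s - t))\<bar> \<le> \<bar>s - u\<bar> * \<bar>t - u\<bar> / \<delta>"
    if st: "\<delta> < s" "t < - \<delta>" for s t
  proof -
    have p: "0 < s - t" "\<delta> \<le> s - t" using st \<open>0 < \<delta>\<close> by auto
    obtain D where D: "s = t + D" by (metis add.commute diff_add_cancel)
    have q: "\<bar>t / (s - t)\<bar> \<le> 1" "\<bar>s / (s - t)\<bar> \<le> 1" using st \<open>0 < \<delta>\<close> by (auto simp: divide_simps)
    consider "\<delta> < u" | "u < - \<delta>" | "u = 0" using u unfolding gapped_def by (smt (verit) mem_Collect_eq)
    then show ?thesis
    proof cases
      case 1
      then have max0: "max 0 u = u" using \<open>0 < \<delta>\<close> by simp
      then have "max 0 u - s / (s - t) * u - (- (s * t) / (s - t)) = (t / (s - t)) * (s - u)"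
        using p(1) max0 by (simp add: D field_simps)
      moreover have "\<bar>(t / (s - t)) * (s - u)\<bar> \<le> \<bar>s - u\<bar>"
        using mult_left_le_one_le[OF abs_ge_zero abs_ge_zero q(1), of "s - u"] by (simp only: abs_mult)
      moreover have "\<bar>s - u\<bar> * \<delta> \<le> \<bar>s - u\<bar> * \<bar>t - u\<bar>"
        using 1 st \<open>0 < \<delta>\<close> by (intro mult_left_mono) auto
      then have "\<bar>s - u\<bar> \<le> \<bar>s - u\<bar> * \<bar>t - u\<bar> / \<delta>"
        using \<open>0 < \<delta>\<close> by (simp add: pos_le_divide_eq)
      ultimately show ?thesis by (metis order_trans)
    next
      case 2
      then have max0: "max 0 u = 0" using \<open>0 < \<delta>\<close> by simp
      then have "max 0 u - s / (s - t) * u - (- (s * t) / (s - t)) = (s / (s - t)) * (t - u)"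
        using p(1) max0 by (simp add: D field_simps)
      moreover have "\<bar>(s / (s - t)) * (t - u)\<bar> \<le> \<bar>t - u\<bar>"
        using mult_left_le_one_le[OF abs_ge_zero abs_ge_zero q(2), of "t - u"] by (simp only: abs_mult)
      moreover have "\<delta> * \<bar>t - u\<bar> \<le> \<bar>s - u\<bar> * \<bar>t - u\<bar>"
        using 2 st \<open>0 < \<delta>\<close> by (intro mult_right_mono) auto
      then have "\<bar>t - u\<bar> \<le> \<bar>s - u\<bar> * \<bar>t - u\<bar> / \<delta>"
        using \<open>0 < \<delta>\<close> by (simp add: pos_le_divide_eq mult.commute)
      ultimately show ?thesis by (metis order_trans)
    next
      case 3
      then have "max 0 u - s / (s - t) * u - (- (s * t) / (s - t)) = s * t / (s - t)"
        by simp
      moreover have "\<bar>s * t / (s - t)\<bar> = \<bar>s - u\<bar> * \<bar>t - u\<bar> / (s - t)"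
        using 3 p by (simp add: abs_mult)
      moreover have "\<bar>s - u\<bar> * \<bar>t - u\<bar> / (s - t) \<le> \<bar>s - u\<bar> * \<bar>t - u\<bar> / \<delta>"
        using p \<open>0 < \<delta>\<close> by (intro divide_left_mono) auto
      ultimately show ?thesis by simp
    qed
  qed
  consider (pn) "s > 0" "t < 0" | (np) "s < 0" "t > 0" | (o) "\<not> s * t < 0"
    by (auto simp: mult_less_0_iff)
  then show ?thesis
  proof cases
    case pn
    then show ?thesis using opp[of s t] s t by (simp add: sign_weight_def gapped_def mult_less_0_iff)
  next
    case np
    then show ?thesis using opp[of t s] s t
      by (simp add: sign_weight_def gapped_def mult_less_0_iff mult.commute)
  next
    case o
    have nn: "0 \<le> \<bar>s - u\<bar> * \<bar>t - u\<bar> / \<delta>" using \<open>0 < \<delta>\<close> by simp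
    have far: "\<bar>u\<bar> \<le> \<bar>s - u\<bar> * \<bar>t - u\<bar> / \<delta>" if "\<bar>u\<bar> \<le> \<bar>s - u\<bar>" "\<bar>u\<bar> \<le> \<bar>t - u\<bar>" "u \<noteq> 0"
    proof -
      have "\<bar>u\<bar> * \<delta> \<le> \<bar>s - u\<bar> * \<bar>t - u\<bar>"
        using that u \<open>0 < \<delta>\<close> by (intro mult_mono) (auto simp: gapped_def)
      then show ?thesis using \<open>0 < \<delta>\<close> by (simp add: pos_le_divide_eq)
    qed
    \<comment> \<open>An error can occur only if \<open>u\<close> is nonzero and neither node lies
      strictly on its side of 0. Then both distances are at least \<open>\<bar>u\<bar>\<close>, and
      \<open>\<bar>u\<bar>\<close> exceeds \<open>\<delta>\<close>, so the linear bound turns into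
      the product bound.\<close>
    have "max 0 u = sign_weight w s t * u \<or>
       \<bar>max 0 u - sign_weight w s t * u\<bar> \<le> \<bar>u\<bar> \<and> \<bar>u\<bar> \<le> \<bar>s - u\<bar> \<and> \<bar>u\<bar> \<le> \<bar>t - u\<bar> \<and> u \<noteq> 0"
      using o w unfolding sign_weight_def mult_less_0_iff by (auto simp: max_def)
    then show ?thesis using nn o far by auto
  qed
qed

text \<open>Schur (Hadamard) multiplication in a given eigenbasis. The decomposition is an argument
  so that two different ones can be compared, including two decompositions of the same
  matrix.\<close>

definition spectral_schur ::
  "(real \<Rightarrow> real \<Rightarrow> real) \<Rightarrow> real^'n^'n \<Rightarrow> real^'n \<Rightarrow> real^'n^'n \<Rightarrow> real^'n^'n" where
  "spectral_schur \<kappa> P l H =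
     P ** (\<chi> i j. \<kappa> (l $ i) (l $ j) * (transpose P ** H ** P) $ i $ j) ** transpose P"

lemma linear_spectral_schur: "linear (spectral_schur \<kappa> P l)" for P :: "real^'n^'n"
proof (rule linearI)
  fix x y :: "real^'n^'n" and r :: real
  show "spectral_schur \<kappa> P l (x + y) = spectral_schur \<kappa> P l x + spectral_schur \<kappa> P l y"
  proof -
    have "(\<chi> i j. \<kappa> (l $ i) (l $ j) * (transpose P ** (x + y) ** P) $ i $ j)
      = (\<chi> i j. \<kappa> (l $ i) (l $ j) * (transpose P ** x ** P) $ i $ j)
      + (\<chi> i j. \<kappa> (l $ i) (l $ j) * (transpose P ** y ** P) $ i $ j)"
      by (simp add: vec_eq_iff matrix_add_ldistrib matrix_add_rdistrib algebra_simps)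
    then show ?thesis by (simp add: spectral_schur_def matrix_add_ldistrib matrix_add_rdistrib)
  qed
  show "spectral_schur \<kappa> P l (r *\<^sub>R x) = r *\<^sub>R spectral_schur \<kappa> P l x"
  proof -
    have "(\<chi> i j. \<kappa> (l $ i) (l $ j) * (transpose P ** (r *\<^sub>R x) ** P) $ i $ j)
      = r *\<^sub>R (\<chi> i j. \<kappa> (l $ i) (l $ j) * (transpose P ** x ** P) $ i $ j)"
      by (simp add: vec_eq_iff matrix_scalar_ac scalar_matrix_assoc[symmetric])
    then show ?thesis by (simp add: spectral_schur_def matrix_scalar_ac scalar_matrix_assoc[symmetric])
  qed
qed

lemma sym_spectral_schur:
  assumes "\<And>s t. \<kappa> s t = \<kappa> t s" and "H \<in> sym_mats"
  shows "spectral_schur \<kappa> P l H \<in> sym_mats"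
  unfolding spectral_schur_def
proof (intro sym_conj sym_matsI)
  show "(\<chi> i j. \<kappa> (l $ i) (l $ j) * (transpose P ** H ** P) $ i $ j) $ i $ j =
     (\<chi> i j. \<kappa> (l $ i) (l $ j) * (transpose P ** H ** P) $ i $ j) $ j $ i" for i j
    using sym_matsD[OF sym_conj'[OF assms(2), of P], of i j] assms(1)[of "l $ i"] by simp
qed

lemma norm_spectral_schur_le:
  fixes P :: "real^'n^'n"
  assumes P: "orthogonal_matrix P" and \<kappa>: "\<And>s t. \<bar>\<kappa> s t\<bar> \<le> 1"
  shows "norm (spectral_schur \<kappa> P l H) \<le> (real CARD('n))\<^sup>2 * norm H"
proof -
  have "norm (spectral_schur \<kappa> P l H) = norm (\<chi> i j. \<kappa> (l $ i) (l $ j) * (transpose P ** H ** P) $ i $ j)"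
    using P by (simp add: spectral_schur_def norm_orthogonal_mul_left norm_orthogonal_mul_right)
  also have "\<dots> \<le> (real CARD('n))\<^sup>2 * norm H"
  proof (rule norm_le_entry_bound)
    fix i j
    have "\<bar>(transpose P ** H ** P) $ i $ j\<bar> \<le> norm H"
      using matrix_entry_le_norm[of "transpose P ** H ** P" i j] by (simp add: norm_conj P)
    then show "\<bar>(\<chi> i j. \<kappa> (l $ i) (l $ j) * (transpose P ** H ** P) $ i $ j) $ i $ j\<bar> \<le> norm H"
      using \<kappa>[of "l $ i" "l $ j"] mult_mono[of "\<bar>\<kappa> (l $ i) (l $ j)\<bar>" 1] by (fastforce simp: abs_mult)
  qed
  finally show ?thesis .
qed

lemma V_op_eq:
  assumes "A \<in> sym_mats"
  obtains P l where "eigen_decomp A P l" "V_op w A = spectral_schur (sign_weight w) P l"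
proof -
  define Pl where "Pl = (SOME (P, l). ordered_eigen_decomp A P l)"
  have "\<exists>Pl. case Pl of (P, l) \<Rightarrow> ordered_eigen_decomp A P l"
    using ordered_eigen_decomp_exists[OF assms] by auto
  then have "case Pl of (P, l) \<Rightarrow> ordered_eigen_decomp A P l"
    unfolding Pl_def by (rule someI_ex)
  then have "eigen_decomp A (fst Pl) (snd Pl)"
    by (auto simp: ordered_eigen_decomp_def split: prod.splits)
  moreover have "V_op w A = spectral_schur (sign_weight w) (fst Pl) (snd Pl)"
    unfolding V_op_def Pl_def[symmetric] spectral_schur_def fun_eq_iff
    by (simp add: Let_def block_weight_eq split: prod.split)
  ultimately show thesis by (rule that)
qed

section \<open>Perturbation of eigenvectors and eigenvalues\<close>

text \<open>The eigenvector equations \<open>transpose P ** A = Diag l ** transpose P\<close> and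
  \<open>A' ** P' = P' ** Diag l'\<close> turn the conjugated difference into a Sylvester operator
  with diagonal coefficients applied to the overlap.\<close>

lemma overlap_eq:
  fixes P P' :: "real^'n^'n"
  assumes A: "eigen_decomp A P l" and A': "eigen_decomp A' P' l'"
  shows "(transpose P ** P') $ i $ k * (l $ i - l' $ k) = (transpose P ** (A - A') ** P') $ i $ k"
proof -
  have P: "orthogonal_matrix P" "orthogonal_matrix P'" using assms by (auto simp: eigen_decomp_def)
  have "transpose P ** A = Diag l ** transpose P" "A' ** P' = P' ** Diag l'"
    using assms P by (auto simp: eigen_decomp_def matrix_mul_assoc orthogonal_matrixD)
      (simp add: matrix_mul_assoc[symmetric] orthogonal_matrixD)
  then have "transpose P ** (A - A') ** P' = Diag l ** (transpose P ** P') - (transpose P ** P') ** Diag l'"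
    by (simp add: matrix_diff_ldistrib matrix_diff_rdistrib matrix_mul_assoc)
       (simp add: matrix_mul_assoc[symmetric])
  then show ?thesis
    by (simp only: vector_minus_component Diag_mul_nth mul_Diag_nth) (simp add: right_diff_distrib left_diff_distrib mult.commute)
qed

lemma overlap_bound:
  fixes P P' :: "real^'n^'n"
  assumes "eigen_decomp A P l" "eigen_decomp A' P' l'"
  shows "\<bar>(transpose P ** P') $ i $ k\<bar> * \<bar>l $ i - l' $ k\<bar> \<le> norm (A - A')"
proof -
  have "norm (transpose P ** (A - A') ** P') = norm (A - A')"
    using assms by (simp add: norm_conj eigen_decomp_def)
  then show ?thesis
    using matrix_entry_le_norm[of "transpose P ** (A - A') ** P'" i k]
    unfolding overlap_eq[OF assms, symmetric] by (simp add: abs_mult)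
qed

lemma overlap_orthogonal:
  "eigen_decomp A P l \<Longrightarrow> eigen_decomp A' P' l' \<Longrightarrow> orthogonal_matrix (transpose P ** P')"
  by (simp add: eigen_decomp_def orthogonal_matrix_mul)

text \<open>Row \<open>i\<close> of the overlap is a unit vector. If all \<open>l' $ k\<close> were
  farther away than \<open>norm (A - A')\<close>, then by the overlap identity row \<open>i\<close>
  of the conjugated difference alone would be longer than the whole matrix
  \<open>A - A'\<close>.\<close>

lemma eigenvalue_perturbation:
  fixes P P' :: "real^'n^'n"
  assumes A: "eigen_decomp A P l" and A': "eigen_decomp A' P' l'"
  shows "\<exists>k. \<bar>l $ i - l' $ k\<bar> \<le> norm (A - A')"
proof (rule ccontr)
  assume "\<not> ?thesis"
  then have far: "norm (A - A') < \<bar>l $ i - l' $ k\<bar>" for k by (auto simp: not_le)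
  define R where "R = transpose P ** P'"
  define K where "K = transpose P ** (A - A') ** P'"
  have row: "(\<Sum>k\<in>UNIV. (R $ i $ k)\<^sup>2) = 1"
    using orthogonal_row_sums[OF overlap_orthogonal[OF A A'], of i i]
    by (simp add: R_def power2_eq_square)
  have "norm K = norm (A - A')"
    using assms by (simp add: K_def norm_conj eigen_decomp_def)
  have "(norm (A - A'))\<^sup>2 = (\<Sum>k\<in>UNIV. (R $ i $ k)\<^sup>2 * (norm (A - A'))\<^sup>2)"
    by (simp add: sum_distrib_right[symmetric] row)
  also have "\<dots> < (\<Sum>k\<in>UNIV. (R $ i $ k)\<^sup>2 * (l $ i - l' $ k)\<^sup>2)"
  proof (rule sum_strict_mono_ex1)
    have sq: "(norm (A - A'))\<^sup>2 < (l $ i - l' $ k)\<^sup>2" for k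
      using far[of k] by (metis norm_ge_zero power2_abs power_strict_mono zero_less_numeral)
    then show "\<forall>k\<in>UNIV. (R $ i $ k)\<^sup>2 * (norm (A - A'))\<^sup>2 \<le> (R $ i $ k)\<^sup>2 * (l $ i - l' $ k)\<^sup>2"
      by (intro ballI mult_left_mono less_imp_le[OF sq] zero_le_power2)
    obtain k where "R $ i $ k \<noteq> 0"
      using row by fastforce
    then have "(R $ i $ k)\<^sup>2 * (norm (A - A'))\<^sup>2 < (R $ i $ k)\<^sup>2 * (l $ i - l' $ k)\<^sup>2"
      by (intro mult_strict_left_mono sq) simp
    then show "\<exists>k\<in>UNIV. (R $ i $ k)\<^sup>2 * (norm (A - A'))\<^sup>2 < (R $ i $ k)\<^sup>2 * (l $ i - l' $ k)\<^sup>2"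
      by blast
  qed simp
  also have "\<dots> = (\<Sum>k\<in>UNIV. (K $ i $ k)\<^sup>2)"
    unfolding R_def K_def overlap_eq[OF assms, symmetric] by (simp add: power_mult_distrib)
  also have "\<dots> = (norm (K $ i))\<^sup>2"
    by (simp add: norm_vec_def L2_set_def sum_nonneg)
  also have "\<dots> \<le> (norm K)\<^sup>2"
    by (intro power_mono Finite_Cartesian_Product.norm_nth_le) simp
  finally show False using \<open>norm K = norm (A - A')\<close> by simp
qed

text \<open>Perturbation by the zero matrix: each eigenvalue in one decomposition occurs in the
  other, so the gap is a property of the matrix.\<close>

lemma gapped_transfer:
  assumes "eigen_decomp A P l" "eigen_decomp A P' l'" "\<And>k. l' $ k \<in> gapped \<delta>"
  shows "l $ i \<in> gapped \<delta>"
  using eigenvalue_perturbation[OF assms(1,2), of i] assms(3) by auto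

lemma conj_nth:
  "(transpose R ** M ** R) $ p $ q = (\<Sum>i\<in>UNIV. \<Sum>j\<in>UNIV. R $ i $ p * R $ j $ q * M $ i $ j)"
  for R M :: "real^'n^'n"
  by (simp add: matrix_mul_nth sum_distrib_left sum_distrib_right mult_ac) (subst sum.swap, simp add: mult_ac)

text \<open>In the basis \<open>P'\<close> each entry of the difference is a double sum whose terms
  contain \<open>R $ i $ p * R $ j $ q\<close> and a difference of multipliers. The Lipschitz
  hypothesis splits the latter into \<open>l $ i - l' $ p\<close> and \<open>l $ j - l' $ q\<close>;
  each is absorbed by the overlap factor with the same indices, and the other factor is at most
  1.\<close>

lemma spectral_schur_lipschitz:
  fixes P P' H :: "real^'n^'n"
  assumes A: "eigen_decomp A P l" and A': "eigen_decomp A' P' l'" and "0 \<le> C"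
    and lip: "\<And>i j p q. \<bar>\<kappa> (l $ i) (l $ j) - \<kappa> (l' $ p) (l' $ q)\<bar> \<le> C * (\<bar>l $ i - l' $ p\<bar> + \<bar>l $ j - l' $ q\<bar>)"
  shows "norm (spectral_schur \<kappa> P l H - spectral_schur \<kappa> P' l' H)
    \<le> (real CARD('n)) ^ 4 * (2 * C * norm (A - A') * norm H)"
proof -
  have P: "orthogonal_matrix P" "orthogonal_matrix P'" using assms by (auto simp: eigen_decomp_def)
  define R where "R = transpose P ** P'"
  have R: "orthogonal_matrix R" using overlap_orthogonal[OF A A'] by (simp add: R_def)
  define K where "K = transpose P ** H ** P"
  define N where "N = (\<chi> i j. \<kappa> (l $ i) (l $ j) * K $ i $ j)"
  have PR: "P ** R = P'" using P by (simp add: R_def orthogonal_cancel)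
  have RT: "transpose R ** transpose P = transpose P'"
    by (metis PR matrix_transpose_mul)
  have K': "transpose P' ** H ** P' = transpose R ** K ** R"
    using P by (simp add: K_def PR[symmetric] matrix_transpose_mul matrix_mul_assoc)
  define X where "X = spectral_schur \<kappa> P l H - spectral_schur \<kappa> P' l' H"
  have PX: "transpose P' ** X ** P' = transpose R ** N ** R
      - (\<chi> p q. \<kappa> (l' $ p) (l' $ q) * (transpose R ** K ** R) $ p $ q)"
  proof -
    have "transpose P' ** spectral_schur \<kappa> P l H ** P' = transpose R ** N ** R"
      unfolding spectral_schur_def N_def[unfolded K_def, symmetric]
      unfolding R_def by (simp add: matrix_transpose_mul matrix_mul_assoc)
    moreover have "transpose P' ** spectral_schur \<kappa> P' l' H ** P'
      = (\<chi> p q. \<kappa> (l' $ p) (l' $ q) * (transpose R ** K ** R) $ p $ q)"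
      unfolding spectral_schur_def K'
      using P by (simp add: matrix_mul_assoc orthogonal_matrixD) (simp add: orthogonal_cancel)
    ultimately show ?thesis by (simp add: X_def matrix_diff_ldistrib matrix_diff_rdistrib)
  qed
  have "(transpose P' ** X ** P') $ p $ q
    = (transpose R ** N ** R) $ p $ q - \<kappa> (l' $ p) (l' $ q) * (transpose R ** K ** R) $ p $ q" for p q
    by (simp add: PX)
  \<comment> \<open>Both conjugated matrices are double sums with the same factors of
    \<open>R\<close>, since \<open>H\<close> in the basis \<open>P'\<close> is
    \<open>transpose R ** K ** R\<close>; hence the two multipliers can be subtracted term by
    term.\<close>
  then have entry: "(transpose P' ** X ** P') $ p $ q
    = (\<Sum>i\<in>UNIV. \<Sum>j\<in>UNIV. R $ i $ p * R $ j $ q * (\<kappa> (l $ i) (l $ j) - \<kappa> (l' $ p) (l' $ q)) * K $ i $ j)" for p q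
    unfolding conj_nth by (simp add: N_def sum_distrib_left sum_subtractf[symmetric] algebra_simps)
  define h where "h = norm (A - A')"
  have tm: "\<bar>R $ i $ p * R $ j $ q * (\<kappa> (l $ i) (l $ j) - \<kappa> (l' $ p) (l' $ q)) * K $ i $ j\<bar>
    \<le> 2 * C * h * norm H" for i j p q
  proof -
    have "\<bar>R $ i $ p * R $ j $ q * (\<kappa> (l $ i) (l $ j) - \<kappa> (l' $ p) (l' $ q))\<bar>
      \<le> \<bar>R $ i $ p\<bar> * \<bar>R $ j $ q\<bar> * (C * (\<bar>l $ i - l' $ p\<bar> + \<bar>l $ j - l' $ q\<bar>))"
      unfolding abs_mult by (intro mult_left_mono lip) auto
    also have "\<dots> = C * (\<bar>R $ j $ q\<bar> * (\<bar>R $ i $ p\<bar> * \<bar>l $ i - l' $ p\<bar>) + \<bar>R $ i $ p\<bar> * (\<bar>R $ j $ q\<bar> * \<bar>l $ j - l' $ q\<bar>))"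
      by (simp add: algebra_simps)
    also have "\<dots> \<le> C * (1 * h + 1 * h)"
      unfolding h_def R_def
      by (intro mult_left_mono add_mono mult_mono overlap_bound[OF A A'] orthogonal_entry_le_1
          overlap_orthogonal[OF A A'] \<open>0 \<le> C\<close>) auto
    finally have 1: "\<bar>R $ i $ p * R $ j $ q * (\<kappa> (l $ i) (l $ j) - \<kappa> (l' $ p) (l' $ q))\<bar> \<le> 2 * C * h"
      by simp
    have "norm K = norm H" using P by (simp add: K_def norm_conj)
    then have 2: "\<bar>K $ i $ j\<bar> \<le> norm H" using matrix_entry_le_norm[of K] by metis
    show ?thesis unfolding abs_mult[of _ "K $ i $ j"] using \<open>0 \<le> C\<close>
      by (intro mult_mono 1 2) (auto simp: h_def)
  qed
  have "\<bar>(transpose P' ** X ** P') $ p $ q\<bar> \<le> (real CARD('n))\<^sup>2 * (2 * C * h * norm H)" for p q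
  proof -
    have "\<bar>(transpose P' ** X ** P') $ p $ q\<bar>
      \<le> (\<Sum>i\<in>(UNIV::'n set). \<Sum>j\<in>(UNIV::'n set). 2 * C * h * norm H)"
      unfolding entry by (intro order_trans[OF sum_abs] sum_mono tm)
    then show ?thesis by (simp add: power2_eq_square mult.assoc)
  qed
  then have "norm (transpose P' ** X ** P') \<le> (real CARD('n))\<^sup>2 * ((real CARD('n))\<^sup>2 * (2 * C * h * norm H))"
    by (rule norm_le_entry_bound)
  then show ?thesis using P by (simp add: norm_conj X_def h_def power4_eq_xxxx power2_eq_square mult.assoc)
qed

lemma sign_weight_schur_lipschitz:
  fixes P P' H :: "real^'n^'n"
  assumes A: "eigen_decomp A P l" and A': "eigen_decomp A' P' l'"
    and l: "\<And>i. l $ i \<in> gapped \<delta>" and l': "\<And>i. l' $ i \<in> gapped \<delta>"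
    and "0 < \<delta>" "0 \<le> w" "w \<le> 1"
  shows "norm (spectral_schur (sign_weight w) P l H - spectral_schur (sign_weight w) P' l' H)
    \<le> (real CARD('n)) ^ 4 * (2 * (1 / \<delta>) * norm (A - A') * norm H)"
  using assms by (intro spectral_schur_lipschitz sign_weight_lipschitz) auto

text \<open>Independence of the chosen decomposition comes for free: the Lipschitz estimate for two
  decompositions of the same matrix bounds the difference by 0.\<close>

lemma V_op_eq_schur:
  assumes A: "eigen_decomp A P l" and l: "\<And>i. l $ i \<in> gapped \<delta>" and "0 < \<delta>" "0 \<le> w" "w \<le> 1"
  shows "V_op w A = spectral_schur (sign_weight w) P l"
proof
  fix H
  obtain P' l' where A': "eigen_decomp A P' l'" and V: "V_op w A = spectral_schur (sign_weight w) P' l'"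
    using V_op_eq[OF eigen_decomp_sym[OF A]] by blast
  have "l' $ i \<in> gapped \<delta>" for i by (rule gapped_transfer[OF A' A l])
  from sign_weight_schur_lipschitz[OF A' A this l assms(3-5), of H] show "V_op w A H = spectral_schur (sign_weight w) P l H"
    by (simp add: V)
qed

section \<open>Projection onto the semidefinite cone\<close>

lemma psd_coneI: "A \<in> sym_mats \<Longrightarrow> (\<And>v. 0 \<le> v \<bullet> (A *v v)) \<Longrightarrow> A \<in> psd_cone"
  by (simp add: psd_cone_def)

lemma convex_psd_cone: "convex psd_cone"
proof (rule convexI)
  fix A B :: "real^'n^'n" and u v :: real
  assume "A \<in> psd_cone" "B \<in> psd_cone" "0 \<le> u" "0 \<le> v" "u + v = 1"
  then show "u *\<^sub>R A + v *\<^sub>R B \<in> psd_cone"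
    by (auto simp: psd_cone_def matrix_vector_mult_add_rdistrib scaleR_matrix_vector_assoc[symmetric] inner_add_right
      intro!: subspace_add subspace_scale subspace_sym_mats)
qed

lemma closed_psd_cone: "closed (psd_cone :: (real^'n^'n) set)"
proof -
  have eq: "(psd_cone :: (real^'n^'n) set) = (\<Inter>i j. {A. A $ i $ j = A $ j $ i})
     \<inter> (\<Inter>v. {A. 0 \<le> (\<Sum>i\<in>UNIV. v $ i * (\<Sum>j\<in>UNIV. A $ i $ j * v $ j))})"
    by (auto simp: psd_cone_def sym_mats_def vec_eq_iff inner_vec_def matrix_vector_mult_def)
  show ?thesis unfolding eq
    by (intro closed_Int closed_INT ballI closed_Collect_eq closed_Collect_le continuous_intros)
qed

lemma proj_psd_eqI:
  fixes A G :: "real^'n^'n"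
  assumes G: "G \<in> psd_cone" and ineq: "\<And>B. B \<in> psd_cone \<Longrightarrow> (A - G) \<bullet> (B - G) \<le> 0"
  shows "proj_psd A = G"
  unfolding proj_psd_def
proof (rule sym, rule closest_point_unique[OF convex_psd_cone closed_psd_cone G], rule ballI)
  fix B :: "real^'n^'n" assume "B \<in> psd_cone"
  have "(norm (A - B))\<^sup>2 = (norm (A - G))\<^sup>2 + (norm (B - G))\<^sup>2 - 2 * ((A - G) \<bullet> (B - G))"
    by (simp add: power2_norm_eq_inner inner_diff inner_commute algebra_simps)
  then have "(norm (A - G))\<^sup>2 \<le> (norm (A - B))\<^sup>2"
    using ineq[OF \<open>B \<in> psd_cone\<close>] zero_le_power2[of "norm (B - G)"] by linarith
  then show "dist A G \<le> dist A B"
    unfolding dist_norm by (rule power2_le_imp_le) simp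
qed

text \<open>The residual of the candidate has the eigenvalues \<open>min 0 (l $ i)\<close>. Its
  inner product with the candidate vanishes, as \<open>min\<close> and \<open>max\<close> never are
  both nonzero, and with a semidefinite matrix it is a sum of nonpositive terms; this is the
  variational inequality.\<close>

lemma proj_psd_eigen_decomp:
  fixes P :: "real^'n^'n"
  assumes A: "eigen_decomp A P l"
  shows "proj_psd A = P ** Diag (\<chi> i. max 0 (l $ i)) ** transpose P"
proof (rule proj_psd_eqI)
  have P: "orthogonal_matrix P" and Aeq: "A = P ** Diag l ** transpose P"
    using A by (auto simp: eigen_decomp_def)
  let ?G = "P ** Diag (\<chi> i. max 0 (l $ i)) ** transpose P"
  show "?G \<in> psd_cone"
  proof (rule psd_coneI)
    show "?G \<in> sym_mats" by (simp add: sym_conj)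
    fix v :: "real^'n"
    have "v \<bullet> (?G *v v) = (v v* P) \<bullet> (Diag (\<chi> i. max 0 (l $ i)) *v (transpose P *v v))"
      by (simp add: dot_lmul_matrix matrix_vector_mul_assoc del: transpose_matrix_vector)
         (simp add: matrix_mul_assoc matrix_vector_mul_assoc[symmetric])
    also have "\<dots> = (\<Sum>i\<in>UNIV. max 0 (l $ i) * ((v v* P) $ i)\<^sup>2)"
      by (simp add: inner_vec_def matrix_vector_mult_def[of "Diag _"] if_distrib if_distribR power2_eq_square mult_ac
          cong: if_cong)
    also have "\<dots> \<ge> 0" by (intro sum_nonneg) auto
    finally show "0 \<le> v \<bullet> (?G *v v)" .
  qed
  fix B :: "real^'n^'n" assume B: "B \<in> psd_cone"
  have AG: "A - ?G = P ** Diag (\<chi> i. min 0 (l $ i)) ** transpose P"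
    unfolding Aeq vec_eq_iff
    by (simp only: conj_Diag_nth vector_minus_component sum_subtractf[symmetric])
       (auto intro!: sum.cong simp: max_def min_def)
  have "(A - ?G) \<bullet> (B - ?G) = Diag (\<chi> i. min 0 (l $ i)) \<bullet> (transpose P ** (B - ?G) ** P)"
    unfolding AG by (metis inner_commute inner_conj)
  also have "transpose P ** (B - ?G) ** P = transpose P ** B ** P - Diag (\<chi> i. max 0 (l $ i))"
    using P by (simp add: matrix_diff_ldistrib matrix_diff_rdistrib matrix_mul_assoc orthogonal_matrixD)
      (simp add: orthogonal_cancel)
  also have "Diag (\<chi> i. min 0 (l $ i)) \<bullet> (transpose P ** B ** P - Diag (\<chi> i. max 0 (l $ i)))
    = (\<Sum>i\<in>UNIV. min 0 (l $ i) * (column i P \<bullet> (B *v column i P)))"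
    unfolding inner_matrix
    by (simp add: if_distrib if_distribR conj_nth_columns cong: if_cong)
       (auto intro!: sum.cong simp: algebra_simps min_def max_def)
  also have "\<dots> \<le> 0"
    using B by (intro sum_nonpos mult_nonpos_nonneg) (auto simp: psd_cone_def)
  finally show "(A - ?G) \<bullet> (B - ?G) \<le> 0" .
qed

text \<open>In the eigenbasis of \<open>A\<close> the terms from \<open>A\<close> itself cancel, and
  what remains is a sum over the eigenvalues of \<open>A'\<close> against
  \<open>R $ i $ k * R $ j $ k\<close>. After passing to the linear interpolation error of
  \<open>max 0\<close>, each summand has two eigenvalue distances, one for each overlap
  factor.\<close>

lemma proj_psd_semismooth:
  fixes P P' :: "real^'n^'n"
  assumes A: "eigen_decomp A P l" and A': "eigen_decomp A' P' l'"
    and l: "\<And>i. l $ i \<in> gapped \<delta>" and l': "\<And>i. l' $ i \<in> gapped \<delta>"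
    and "0 < \<delta>" and w: "w = 0 \<or> w = 1"
  shows "norm (spectral_schur (sign_weight w) P l (A - A') - (proj_psd A - proj_psd A'))
    \<le> (real CARD('n))^3 / \<delta> * (norm (A - A'))\<^sup>2"
proof -
  have P: "orthogonal_matrix P" "orthogonal_matrix P'" using assms by (auto simp: eigen_decomp_def)
  define R where "R = transpose P ** P'"
  have R: "orthogonal_matrix R" using overlap_orthogonal[OF A A'] by (simp add: R_def)
  define lp where "lp = (\<chi> i. max 0 (l $ i))"
  define lp' where "lp' = (\<chi> i. max 0 (l' $ i))"
  define c where "c s t = (if s * t < 0 then - (s * t) / \<bar>s - t\<bar> else 0)" for s t :: real
  have conj1: "transpose P ** (P ** M ** transpose P) ** P = M" for M :: "real^'n^'n"
    using P by (simp add: matrix_mul_assoc orthogonal_matrixD) (simp add: orthogonal_cancel)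
  have conj2: "transpose P ** (P' ** M ** transpose P') ** P = R ** M ** transpose R" for M :: "real^'n^'n"
    by (simp add: R_def matrix_transpose_mul matrix_mul_assoc)
  have KA: "transpose P ** (A - A') ** P = Diag l - R ** Diag l' ** transpose R"
    using A A' by (simp add: eigen_decomp_def matrix_diff_ldistrib matrix_diff_rdistrib conj1 conj2)
  define X where "X = spectral_schur (sign_weight w) P l (A - A') - (proj_psd A - proj_psd A')"
  have "transpose P ** X ** P = (\<chi> i j. sign_weight w (l $ i) (l $ j) * (Diag l - R ** Diag l' ** transpose R) $ i $ j)
     - (Diag lp - R ** Diag lp' ** transpose R)"
    unfolding X_def spectral_schur_def KA proj_psd_eigen_decomp[OF A] proj_psd_eigen_decomp[OF A']
      lp_def[symmetric] lp'_def[symmetric]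
    by (simp add: matrix_diff_ldistrib matrix_diff_rdistrib conj1 conj2)
  \<comment> \<open>Off the diagonal both sides are 0; on it a positive eigenvalue has weight 1 and
    a negative one weight 0.\<close>
  moreover have "sign_weight w (l $ i) (l $ j) * Diag l $ i $ j = Diag lp $ i $ j" for i j
    by (auto simp: lp_def sign_weight_def max_def)
  ultimately have "(transpose P ** X ** P) $ i $ j = (R ** Diag lp' ** transpose R) $ i $ j
     - sign_weight w (l $ i) (l $ j) * (R ** Diag l' ** transpose R) $ i $ j" for i j
    by (simp add: right_diff_distrib del: Diag_nth)
  then have entry: "(transpose P ** X ** P) $ i $ j =
     (\<Sum>k\<in>UNIV. (max 0 (l' $ k) - sign_weight w (l $ i) (l $ j) * l' $ k) * (R $ i $ k * R $ j $ k))" for i j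
    unfolding conj_Diag_nth by (simp add: lp'_def sum_distrib_left sum_subtractf[symmetric] algebra_simps)
  \<comment> \<open>For \<open>i = j\<close> the constant is 0 because a square is not negative; for
    \<open>i \<noteq> j\<close> the rows of \<open>R\<close> are orthogonal.\<close>
  have cz: "(\<Sum>k\<in>UNIV. c (l $ i) (l $ j) * (R $ i $ k * R $ j $ k)) = 0" for i j
    using orthogonal_row_sums[OF R, of i j] by (simp add: sum_distrib_left[symmetric] c_def mult_less_0_iff)
  have "\<bar>(transpose P ** X ** P) $ i $ j\<bar> \<le> real CARD('n) * ((norm (A - A'))\<^sup>2 / \<delta>)" for i j
  proof -
    have "(transpose P ** X ** P) $ i $ j =
      (\<Sum>k\<in>UNIV. (max 0 (l' $ k) - sign_weight w (l $ i) (l $ j) * l' $ k - c (l $ i) (l $ j)) * (R $ i $ k * R $ j $ k))"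
      unfolding entry using cz[of i j] by (simp add: sum_subtractf left_diff_distrib)
    also have "\<bar>\<dots>\<bar> \<le> (\<Sum>k\<in>(UNIV :: 'n set). (norm (A - A'))\<^sup>2 / \<delta>)"
    proof (intro order_trans[OF sum_abs] sum_mono)
      fix k
      have "\<bar>(max 0 (l' $ k) - sign_weight w (l $ i) (l $ j) * l' $ k - c (l $ i) (l $ j)) * (R $ i $ k * R $ j $ k)\<bar>
        \<le> (\<bar>l $ i - l' $ k\<bar> * \<bar>l $ j - l' $ k\<bar> / \<delta>) * \<bar>R $ i $ k * R $ j $ k\<bar>"
        unfolding abs_mult[of _ "R $ i $ k * R $ j $ k"] c_def
        by (intro mult_right_mono sign_weight_second_order \<open>0 < \<delta>\<close> w l l') auto
      also have "\<dots> = (\<bar>R $ i $ k\<bar> * \<bar>l $ i - l' $ k\<bar>) * (\<bar>R $ j $ k\<bar> * \<bar>l $ j - l' $ k\<bar>) / \<delta>"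
        by (simp add: abs_mult mult_ac)
      also have "\<dots> \<le> norm (A - A') * norm (A - A') / \<delta>"
        unfolding R_def using \<open>0 < \<delta>\<close>
        by (intro divide_right_mono mult_mono overlap_bound[OF A A']) auto
      finally show "\<bar>(max 0 (l' $ k) - sign_weight w (l $ i) (l $ j) * l' $ k - c (l $ i) (l $ j)) * (R $ i $ k * R $ j $ k)\<bar>
        \<le> (norm (A - A'))\<^sup>2 / \<delta>" by (simp add: power2_eq_square)
    qed
    finally show ?thesis by simp
  qed
  then have "norm (transpose P ** X ** P) \<le> (real CARD('n))\<^sup>2 * (real CARD('n) * ((norm (A - A'))\<^sup>2 / \<delta>))"
    by (rule norm_le_entry_bound)
  then show ?thesis using P by (simp add: norm_conj X_def power3_eq_cube power2_eq_square mult.assoc)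
qed

section \<open>The correction mapping\<close>

lemma sum_outer_prod_columns:
  "(\<Sum>i | Q i. c i *\<^sub>R outer_prod (column i P) (column i P)) = P ** Diag (\<chi> i. if Q i then c i else 0) ** transpose P"
  for P :: "real^'n^'n"
  unfolding vec_eq_iff conj_Diag_nth
  by (simp add: outer_prod_def column_def sum.inter_filter[symmetric] if_distrib if_distribR sum.If_cases
      sum_component cong: if_cong)

lemma correction_eq:
  fixes g :: "'x::euclidean_space \<Rightarrow> 'n::{finite,linorder} rmat"
  assumes "g x + \<Gamma> \<in> sym_mats"
  obtains P l where "eigen_decomp (g x + \<Gamma>) P l"
    "correction g \<delta> (x, \<xi>, \<Gamma>) = (x, \<xi>, \<Gamma> - P ** Diag (\<chi> i. if \<bar>l $ i\<bar> \<le> \<delta> then l $ i else 0) ** transpose P)"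
proof -
  define Pl where "Pl = (SOME (P, l). eigen_decomp (g x + \<Gamma>) P l)"
  have "\<exists>Pl. case Pl of (P, l) \<Rightarrow> eigen_decomp (g x + \<Gamma>) P l"
    using ordered_eigen_decomp_exists[OF assms] by (auto simp: ordered_eigen_decomp_def)
  then have "case Pl of (P, l) \<Rightarrow> eigen_decomp (g x + \<Gamma>) P l"
    unfolding Pl_def by (rule someI_ex)
  then have "eigen_decomp (g x + \<Gamma>) (fst Pl) (snd Pl)" by (auto split: prod.splits)
  moreover have "correction g \<delta> (x, \<xi>, \<Gamma>) = (x, \<xi>, \<Gamma> -
      fst Pl ** Diag (\<chi> i. if \<bar>snd Pl $ i\<bar> \<le> \<delta> then snd Pl $ i else 0) ** transpose (fst Pl))"
    by (cases Pl) (simp add: correction_def Pl_def[symmetric] Let_def sum_outer_prod_columns cong: if_cong)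
  ultimately show thesis by (rule that)
qed

section \<open>Derivatives of the Lagrangian\<close>

text \<open>The adjoint by an explicit basis formula, which makes bilinearity in the operator and
  the vector evident; derivatives and limits of adjoint terms then follow from the rules for bounded
  bilinear maps.\<close>

definition badj :: "'a::euclidean_space \<Rightarrow>\<^sub>L 'b::euclidean_space \<Rightarrow> 'b \<Rightarrow> 'a" where
  "badj T y = (\<Sum>b\<in>Basis. (y \<bullet> blinfun_apply T b) *\<^sub>R b)"

lemma inner_badj: "badj T y \<bullet> v = y \<bullet> blinfun_apply T v"
proof -
  have "badj T y \<bullet> v = y \<bullet> (\<Sum>b\<in>Basis. (v \<bullet> b) *\<^sub>R blinfun_apply T b)"
    by (simp add: badj_def inner_sum_left inner_sum_right inner_commute mult.commute)
  also have "(\<Sum>b\<in>Basis. (v \<bullet> b) *\<^sub>R blinfun_apply T b) = blinfun_apply T v"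
    by (subst (2) euclidean_representation[symmetric, of v]) (simp add: blinfun.sum_right blinfun.scaleR_right)
  finally show ?thesis .
qed

lemma norm_badj: "norm (badj T y) \<le> norm T * norm y"
proof -
  have "norm (badj T y) * norm (badj T y) = y \<bullet> blinfun_apply T (badj T y)"
    by (metis inner_badj power2_eq_square power2_norm_eq_inner)
  also have "\<dots> \<le> norm y * (norm T * norm (badj T y))"
    by (rule order_trans[OF norm_cauchy_schwarz]) (intro mult_left_mono norm_blinfun norm_ge_zero)
  finally have "norm (badj T y) * norm (badj T y) \<le> (norm T * norm y) * norm (badj T y)"
    by (simp add: mult_ac)
  then show ?thesis
    by (cases "norm (badj T y) = 0") (auto simp: mult_le_cancel_right)
qed

lemma bounded_bilinear_badj: "bounded_bilinear badj"
proof
  show "\<exists>K. \<forall>a b. norm (badj a b) \<le> norm a * norm b * K"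
    by (intro exI[of _ 1] allI) (simp add: norm_badj)
qed (simp_all add: badj_def blinfun.add_left blinfun.scaleR_left inner_add_left inner_add_right
    scaleR_add_left sum.distrib scaleR_sum_right)

interpretation badj: bounded_bilinear badj by (rule bounded_bilinear_badj)

lemma adjoint_blinfun: "adjoint (blinfun_apply T) = badj T"
  by (intro adjoint_unique allI) (metis inner_badj inner_commute)

lemma gradient_eqI:
  assumes "(\<phi> has_derivative (\<lambda>v. D \<bullet> v)) (at x)"
  shows "gradient \<phi> x = D"
  unfolding gradient_def
proof (rule the_equality)
  show "GDERIV \<phi> x :> D" using assms by (simp add: gderiv_def inner_commute)
  fix E assume "GDERIV \<phi> x :> E"
  then have "(\<phi> has_derivative (\<lambda>v. v \<bullet> E)) (at x)" by (simp add: gderiv_def)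
  then have "(\<lambda>v. v \<bullet> E) = (\<lambda>v. D \<bullet> v)" using assms has_derivative_unique by blast
  then have "(E - D) \<bullet> (E - D) = 0" by (metis (no_types) inner_commute inner_diff_left right_minus_eq)
  then show "E = D" by simp
qed

text \<open>Identifies the derivatives hidden in \<open>twice_lipschitz_diff\<close> with the ones
  fixed beforehand, so that both smoothness assumptions speak of the same second derivative.\<close>

lemma second_derivs_unique:
  assumes "second_derivs \<phi> a b" "second_derivs \<phi> c d"
  shows "a = c" "b = d"
proof -
  show "a = c"
  proof
    fix x show "a x = c x"
      using assms unfolding second_derivs_def by (metis has_derivative_unique blinfun_apply_inject)
  qed
  then show "b = d"
    using assms unfolding second_derivs_def
    by (intro ext) (metis has_derivative_unique blinfun_apply_inject)
qed

text \<open>Transposition is linear and fixes \<open>g\<close>, so by uniqueness of the derivative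
  it fixes the derivative as well.\<close>

lemma has_derivative_sym_mats:
  fixes g :: "'x::euclidean_space \<Rightarrow> real^'n^'n"
  assumes "(g has_derivative D) (at x)" and sym: "\<And>x. g x \<in> sym_mats"
  shows "D v \<in> sym_mats"
proof -
  have bl: "bounded_linear (transpose :: real^'n^'n \<Rightarrow> real^'n^'n)"
    by (intro linear_conv_bounded_linear[THEN iffD1] linearI)
      (simp_all add: vec_eq_iff)
  have "((\<lambda>y. transpose (g y)) has_derivative (\<lambda>v. transpose (D v))) (at x)"
    by (rule bounded_linear.has_derivative[OF bl assms(1)])
  moreover have "(\<lambda>y. transpose (g y)) = g" using sym by (auto simp: sym_mats_def)
  ultimately have "(\<lambda>v. transpose (D v)) = D" using assms(1) has_derivative_unique by metis
  then show ?thesis by (metis (mono_tags, lifting) mem_Collect_eq sym_mats_def)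
qed

section \<open>Derivative data of the program and linearity of the Newton operators\<close>

locale nlsdp =
  fixes f :: "'x::euclidean_space \<Rightarrow> real"
    and h :: "'x \<Rightarrow> real^'m"
    and g :: "'x \<Rightarrow> 'n::{finite,linorder} rmat"
    and f' f'' h' h'' g' g''
  assumes f: "second_derivs f f' f''" and f'': "continuous_on UNIV f''"
    and h: "second_derivs h h' h''" and h'': "continuous_on UNIV h''"
    and g: "second_derivs g g' g''" and g'': "continuous_on UNIV g''"
    and g_sym: "\<And>x. g x \<in> sym_mats"
begin

lemma derivs:
  "(f has_derivative blinfun_apply (f' x)) (at x)"
  "(f' has_derivative blinfun_apply (f'' x)) (at x)"
  "(h has_derivative blinfun_apply (h' x)) (at x)"
  "(h' has_derivative blinfun_apply (h'' x)) (at x)"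
  "(g has_derivative blinfun_apply (g' x)) (at x)"
  "(g' has_derivative blinfun_apply (g'' x)) (at x)"
  using f g h by (auto simp: second_derivs_def)

lemma jac_eq: "jac h x = blinfun_apply (h' x)" "jac g x = blinfun_apply (g' x)"
  by (simp_all add: frechet_derivative_at[OF derivs(3), symmetric] frechet_derivative_at[OF derivs(5), symmetric])

definition gradL :: "real^'m \<Rightarrow> 'n rmat \<Rightarrow> 'x \<Rightarrow> 'x" where
  "gradL \<xi> \<Gamma> x = badj (f' x) 1 + badj (h' x) \<xi> + badj (g' x) \<Gamma>"

definition hessL :: "real^'m \<Rightarrow> 'n rmat \<Rightarrow> 'x \<Rightarrow> 'x \<Rightarrow> 'x" where
  "hessL \<xi> \<Gamma> x v = badj (f'' x v) 1 + badj (h'' x v) \<xi> + badj (g'' x v) \<Gamma>"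

lemma gradient_Lagr: "gradient (Lagr f h g \<xi> \<Gamma>) = gradL \<xi> \<Gamma>"
proof
  fix x
  have "(Lagr f h g \<xi> \<Gamma> has_derivative (\<lambda>v. gradL \<xi> \<Gamma> x \<bullet> v)) (at x)"
    unfolding Lagr_def gradL_def
    by (auto intro!: derivative_eq_intros derivs simp: inner_add_left inner_badj)
  then show "gradient (Lagr f h g \<xi> \<Gamma>) x = gradL \<xi> \<Gamma> x" by (rule gradient_eqI)
qed

lemma gradL_has_derivative: "(gradL \<xi> \<Gamma> has_derivative hessL \<xi> \<Gamma> x) (at x)"
  unfolding gradL_def[abs_def] hessL_def[abs_def]
  by (intro has_derivative_add bounded_linear.has_derivative[OF badj.bounded_linear_left] derivs)

lemma hessian_Lagr: "hessian (Lagr f h g \<xi> \<Gamma>) x = hessL \<xi> \<Gamma> x"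
  by (simp add: hessian_def gradient_Lagr frechet_derivative_at[OF gradL_has_derivative, symmetric])

lemma g'_sym: "blinfun_apply (g' x) v \<in> sym_mats"
  by (rule has_derivative_sym_mats[OF derivs(5) g_sym])

lemma U_op_eq:
  "U_op w f h g (x, \<xi>, \<Gamma>) (dx, d\<xi>, d\<Gamma>) =
    (hessL \<xi> \<Gamma> x dx + badj (h' x) d\<xi> + badj (g' x) d\<Gamma>, h' x dx,
     - g' x dx + V_op w (g x + \<Gamma>) (g' x dx + d\<Gamma>))"
  by (simp add: U_op_def hessian_Lagr jac_eq adjoint_blinfun)

lemma KKT_residual_eq:
  "KKT_residual f h g (x, \<xi>, \<Gamma>) = (gradL \<xi> \<Gamma> x, h x, - g x + proj_psd (g x + \<Gamma>))"
  by (simp add: KKT_residual_def gradient_Lagr)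

lemma linear_hessL: "linear (hessL \<xi> \<Gamma> x)"
  using gradL_has_derivative has_derivative_linear by blast

lemma linear_V_op: "A \<in> sym_mats \<Longrightarrow> linear (V_op w A)"
  by (metis V_op_eq linear_spectral_schur)

lemma V_op_sym: "A \<in> sym_mats \<Longrightarrow> H \<in> sym_mats \<Longrightarrow> V_op w A H \<in> sym_mats"
  by (metis V_op_eq sym_spectral_schur sign_weight_sym)

lemma ZspaceD: "(x, \<xi>, \<Gamma>) \<in> Zspace \<Longrightarrow> \<Gamma> \<in> sym_mats"
  by (simp add: Zspace_def)

lemma subspace_Zspace: "subspace (Zspace :: ('x \<times> (real^'m) \<times> 'n rmat) set)"
  unfolding Zspace_def by (intro subspace_Times subspace_UNIV subspace_sym_mats)

lemma g_plus_sym: "(x, \<xi>, \<Gamma>) \<in> Zspace \<Longrightarrow> g x + \<Gamma> \<in> sym_mats"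
  by (intro subspace_add subspace_sym_mats g_sym ZspaceD)

lemma linear_U_op:
  assumes "Z \<in> Zspace"
  shows "linear (U_op w f h g Z)"
proof -
  obtain x \<xi> \<Gamma> where Z: "Z = (x, \<xi>, \<Gamma>)" by (cases Z) auto
  have A: "g x + \<Gamma> \<in> sym_mats" using assms by (auto simp: Z intro: g_plus_sym)
  note V = linear_V_op[OF A, of w]
  show ?thesis
  proof (rule linearI)
    fix d e :: "'x \<times> (real^'m) \<times> 'n rmat" and r :: real
    obtain d1 d2 d3 e1 e2 e3 where de: "d = (d1, d2, d3)" "e = (e1, e2, e3)"
      by (metis surj_pair)
    have "g' x (d1 + e1) + (d3 + e3) = (g' x d1 + d3) + (g' x e1 + e3)"
      by (simp add: blinfun.add_right)
    then have "V_op w (g x + \<Gamma>) (g' x (d1 + e1) + (d3 + e3))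
      = V_op w (g x + \<Gamma>) (g' x d1 + d3) + V_op w (g x + \<Gamma>) (g' x e1 + e3)"
      using linear_add[OF V] by metis
    then show "U_op w f h g Z (d + e) = U_op w f h g Z d + U_op w f h g Z e"
      by (simp add: Z de U_op_eq linear_add[OF linear_hessL] blinfun.add_right badj.add_right)
    have "g' x (r *\<^sub>R d1) + r *\<^sub>R d3 = r *\<^sub>R (g' x d1 + d3)"
      by (simp add: blinfun.scaleR_right scaleR_add_right)
    then have "V_op w (g x + \<Gamma>) (g' x (r *\<^sub>R d1) + r *\<^sub>R d3) = r *\<^sub>R V_op w (g x + \<Gamma>) (g' x d1 + d3)"
      using linear_scale[OF V] by metis
    then show "U_op w f h g Z (r *\<^sub>R d) = r *\<^sub>R U_op w f h g Z d"
      by (simp add: Z de U_op_eq linear_scale[OF linear_hessL] blinfun.scaleR_right badj.scaleR_right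
          scaleR_add_right scaleR_diff_right)
  qed
qed

lemma U_op_Zspace:
  assumes "Z \<in> Zspace" "d \<in> Zspace"
  shows "U_op w f h g Z d \<in> Zspace"
proof -
  obtain x \<xi> \<Gamma> dx d\<xi> d\<Gamma> where Z: "Z = (x, \<xi>, \<Gamma>)" and d: "d = (dx, d\<xi>, d\<Gamma>)"
    by (metis surj_pair)
  have "g x + \<Gamma> \<in> sym_mats" "d\<Gamma> \<in> sym_mats"
    using assms by (auto simp: Z d intro: g_plus_sym ZspaceD)
  then have "V_op w (g x + \<Gamma>) (g' x dx + d\<Gamma>) \<in> sym_mats"
    by (intro V_op_sym subspace_add[OF subspace_sym_mats g'_sym])
  then have "- g' x dx + V_op w (g x + \<Gamma>) (g' x dx + d\<Gamma>) \<in> sym_mats"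
    by (intro subspace_add[OF subspace_sym_mats] subspace_neg subspace_sym_mats g'_sym)
  then show ?thesis by (simp add: Z d U_op_eq) (simp add: Zspace_def)
qed

text \<open>The operators are defined for all matrices but matter only on the subspace
  \<open>Zspace\<close>, which they map into itself. There a dimension count turns injectivity into
  bijectivity.\<close>

lemma nonsingular_U_op:
  assumes Z: "Z \<in> Zspace" and inj: "\<And>d. d \<in> Zspace \<Longrightarrow> U_op w f h g Z d = 0 \<Longrightarrow> d = 0"
  shows "nonsingular_on Zspace (U_op w f h g Z)"
proof -
  note lin = linear_U_op[OF Z, of w]
  have inj': "inj_on (U_op w f h g Z) Zspace"
  proof (rule inj_onI)
    fix d e assume "d \<in> Zspace" "e \<in> Zspace" "U_op w f h g Z d = U_op w f h g Z e"
    then have "d - e = 0"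
      by (intro inj[OF subspace_diff[OF subspace_Zspace]]) (simp_all only: linear_diff[OF lin] diff_self)
    then show "d = e" by simp
  qed
  have "U_op w f h g Z ` Zspace = Zspace"
  proof (rule subspace_dim_equal)
    show "subspace (U_op w f h g Z ` Zspace)" by (rule linear_subspace_image[OF lin subspace_Zspace])
    show "U_op w f h g Z ` Zspace \<subseteq> Zspace" using U_op_Zspace[OF Z] by auto
    have "span Zspace = (Zspace :: ('x \<times> (real^'m) \<times> 'n rmat) set)"
      by (rule span_eq_iff[THEN iffD2, OF subspace_Zspace])
    then have "dim (U_op w f h g Z ` Zspace) = dim (Zspace :: ('x \<times> (real^'m) \<times> 'n rmat) set)"
      by (intro dim_image_eq[OF lin]) (simp only: inj')
    then show "dim (Zspace :: ('x \<times> (real^'m) \<times> 'n rmat) set) \<le> dim (U_op w f h g Z ` Zspace)" by simp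
  qed (rule subspace_Zspace)
  then show ?thesis using inj' by (simp add: nonsingular_on_def bij_betw_def)
qed

end

section \<open>Nonsingularity at the KKT point\<close>

lemma sum_if_conj:
  "(\<Sum>i\<in>UNIV. \<Sum>j\<in>UNIV. if p i \<and> q j then c i j else 0) = (\<Sum>i\<in>{i. p i}. \<Sum>j\<in>{j. q j}. c i j)"
  for c :: "'a::finite \<Rightarrow> 'b::finite \<Rightarrow> real"
proof -
  have "(\<Sum>j\<in>UNIV. if p i \<and> q j then c i j else 0) = (if p i then \<Sum>j\<in>{j. q j}. c i j else 0)" for i
    by (simp add: sum.If_cases)
  then show ?thesis by (simp add: sum.If_cases)
qed

lemma sign_weight_cases:
  assumes "w = 0 \<or> w = 1"
  shows "(0 < s \<and> t < 0) \<or> (0 < t \<and> s < 0) \<or> sign_weight w s t = 0 \<or>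
    sign_weight w s t = 1 \<and> \<not> (0 < s \<and> t < 0) \<and> \<not> (0 < t \<and> s < 0)"
  using assms by (cases s "0::real" rule: linorder_cases; cases t "0::real" rule: linorder_cases)
    (auto simp: sign_weight_def)

text \<open>\<open>w = 0\<close> stands for the method with \<open>U_zero\<close> and
  \<open>w = 1\<close> for the one with \<open>U_id\<close>.\<close>

locale kkt = nlsdp f h g f' f'' h' h'' g' g''
  for f :: "'x::euclidean_space \<Rightarrow> real"
    and h :: "'x \<Rightarrow> real^'m"
    and g :: "'x \<Rightarrow> 'n::{finite,linorder} rmat"
    and f' f'' h' h'' g' g'' +
  fixes xbar :: 'x and \<xi>bar :: "real^'m" and \<Gamma>bar :: "'n rmat"
    and Pbar :: "'n rmat" and lbar :: "'n rvec" and \<delta> w :: real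
  assumes kkt: "KKT_point f h g (xbar, \<xi>bar, \<Gamma>bar)"
    and Abar: "eigen_decomp (g xbar + \<Gamma>bar) Pbar lbar"
    and \<delta>: "0 < \<delta>"
    and lbar_gapped: "\<And>i. lbar $ i \<in> gapped \<delta>"
    and w: "w = 0 \<or> w = 1"
begin

abbreviation "Zbar \<equiv> (xbar, \<xi>bar, \<Gamma>bar)"
abbreviation "U \<equiv> U_op w f h g"
abbreviation "F \<equiv> KKT_residual f h g"

lemma w01: "0 \<le> w" "w \<le> 1" using w by auto

lemma kktD: "gradL \<xi>bar \<Gamma>bar xbar = 0" "h xbar = 0" "\<Gamma>bar \<in> sym_mats" "proj_psd (g xbar + \<Gamma>bar) = g xbar"
proof -
  show "gradL \<xi>bar \<Gamma>bar xbar = 0" "h xbar = 0" "\<Gamma>bar \<in> sym_mats"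
    using kkt by (auto simp: KKT_point_def gradient_Lagr normal_cone_sym_def)
  \<comment> \<open>Membership in the normal cone is precisely the variational inequality for
    \<open>g xbar\<close>, because the residual of the projection is \<open>\<Gamma>bar\<close>.
    Hence the reference point is a zero of the residual mapping.\<close>
  show "proj_psd (g xbar + \<Gamma>bar) = g xbar"
    using kkt by (intro proj_psd_eqI) (auto simp: KKT_point_def normal_cone_sym_def)
qed

lemma Zbar_Zspace: "Zbar \<in> Zspace"
  by (simp add: Zspace_def kktD)

text \<open>The third equation gives \<open>B = k \<circ> (B + G)\<close> entrywise for the rotated
  increments. It puts \<open>dx\<close> into the subspace of the second order condition, and it
  makes the pairing of \<open>d\<Gamma>\<close> with the derivative of \<open>g\<close> equal to the
  sigma term of the curvature. Testing the first equation with \<open>dx\<close> gives curvature 0,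
  so \<open>dx = 0\<close>. Then the multiplier increment is orthogonal to everything that the
  constraint qualification generates, itself included.\<close>

lemma U_Zbar_inj:
  assumes soc: "\<And>dx. dx \<noteq> 0 \<Longrightarrow> h' xbar dx = 0 \<Longrightarrow>
      (w = 0 \<Longrightarrow> zero_block (zero_idx lbar) (zero_idx lbar) (rotated_deriv g xbar Pbar dx)) \<Longrightarrow>
      zero_block (zero_idx lbar) (neg_idx lbar) (rotated_deriv g xbar Pbar dx) \<Longrightarrow>
      zero_block (neg_idx lbar) (neg_idx lbar) (rotated_deriv g xbar Pbar dx) \<Longrightarrow>
      curvature f h g Zbar Pbar lbar dx > 0"
    and cq: "\<And>\<eta> \<Theta>. \<Theta> \<in> sym_mats \<Longrightarrow> \<exists>dx B. B \<in> sym_mats \<and>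
      (w = 0 \<longrightarrow> zero_block (zero_idx lbar) (zero_idx lbar) B) \<and>
      zero_block (zero_idx lbar) (neg_idx lbar) B \<and> zero_block (neg_idx lbar) (neg_idx lbar) B \<and>
      \<eta> = h' xbar dx \<and> \<Theta> = g' xbar dx + Pbar ** B ** transpose Pbar"
    and d: "d \<in> Zspace" "U Zbar d = 0"
  shows "d = 0"
proof -
  obtain dx d\<xi> d\<Gamma> where deq: "d = (dx, d\<xi>, d\<Gamma>)" by (metis surj_pair)
  have P: "orthogonal_matrix Pbar" using Abar by (simp add: eigen_decomp_def)
  define k where "k i j = sign_weight w (lbar $ i) (lbar $ j)" for i j
  have d\<Gamma>: "d\<Gamma> \<in> sym_mats" using d by (simp add: deq Zspace_def)
  have e1: "hessL \<xi>bar \<Gamma>bar xbar dx + badj (h' xbar) d\<xi> + badj (g' xbar) d\<Gamma> = 0"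
    and e2: "h' xbar dx = 0"
    and e3: "spectral_schur (sign_weight w) Pbar lbar (g' xbar dx + d\<Gamma>) = g' xbar dx"
    using d V_op_eq_schur[OF Abar lbar_gapped \<delta> w01] by (auto simp: deq U_op_eq zero_prod_def)
  define B where "B = rotated_deriv g xbar Pbar dx"
  define G where "G = transpose Pbar ** d\<Gamma> ** Pbar"
  have B: "B = transpose Pbar ** g' xbar dx ** Pbar" by (simp add: B_def rotated_deriv_def jac_eq)
  have BG: "B $ i $ j = k i j * (B $ i $ j + G $ i $ j)" for i j
  proof -
    have "B = transpose Pbar ** spectral_schur (sign_weight w) Pbar lbar (g' xbar dx + d\<Gamma>) ** Pbar"
      by (simp add: B e3)
    also have "\<dots> = (\<chi> i j. k i j * (B + G) $ i $ j)"
      using P by (simp add: spectral_schur_def k_def B G_def matrix_add_ldistrib matrix_add_rdistrib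
          matrix_mul_assoc orthogonal_matrixD) (simp add: orthogonal_cancel)
    finally show ?thesis by (metis (no_types, lifting) vec_lambda_beta vector_add_component)
  qed
  have Bsym: "B $ i $ j = B $ j $ i" for i j
    unfolding B by (intro sym_matsD sym_conj' g'_sym)
  have B0: "B $ i $ j = 0" if "k i j = 0" for i j
    using BG[of i j] that by simp
  \<comment> \<open>Weight 0 forces the entry of \<open>B\<close> to vanish and weight 1 that of
    \<open>G\<close>. Only pairs of opposite sign contribute: there the relation between
    \<open>B\<close> and \<open>G\<close> reads \<open>s * y = - t * x\<close>.\<close>
  have pair: "G $ i $ j * B $ i $ j =
      - (if 0 < lbar $ i \<and> lbar $ j < 0 then lbar $ j / lbar $ i * (B $ i $ j)\<^sup>2 else 0)
      - (if 0 < lbar $ j \<and> lbar $ i < 0 then lbar $ i / lbar $ j * (B $ j $ i)\<^sup>2 else 0)" for i j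
  proof -
    have opp: "y * x = - (t / s * x\<^sup>2)" if "0 < s" "t < 0" "x = s / (s - t) * (x + y)" for s t x y :: real
    proof -
      have "x * (s - t) = s * (x + y)" using that by (simp add: field_simps)
      then have "s * y = - t * x" by (simp add: algebra_simps)
      then have "y = - (t / s) * x" using that by (simp add: field_simps)
      then show ?thesis by (simp add: power2_eq_square)
    qed
    consider "0 < lbar $ i" "lbar $ j < 0" | "0 < lbar $ j" "lbar $ i < 0" | "k i j = 0" | "k i j = 1"
        "\<not> (0 < lbar $ i \<and> lbar $ j < 0)" "\<not> (0 < lbar $ j \<and> lbar $ i < 0)"
      using sign_weight_cases[OF w, of "lbar $ i" "lbar $ j"] unfolding k_def by blast
    then show ?thesis
    proof cases
      case 1
      then have "k i j = lbar $ i / (lbar $ i - lbar $ j)" by (simp add: k_def sign_weight_def)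
      then have "G $ i $ j * B $ i $ j = - (lbar $ j / lbar $ i * (B $ i $ j)\<^sup>2)"
        using BG[of i j] by (intro opp[OF 1]) (simp only:)
      then show ?thesis using 1 by simp
    next
      case 2
      then have "k i j = lbar $ j / (lbar $ j - lbar $ i)" by (simp add: k_def sign_weight_def)
      then have "G $ i $ j * B $ i $ j = - (lbar $ i / lbar $ j * (B $ i $ j)\<^sup>2)"
        using BG[of i j] by (intro opp[OF 2]) (simp only:)
      then show ?thesis using 2 by (simp add: Bsym[of j i])
    next
      case 3
      then show ?thesis using B0[of i j] Bsym[of i j] by simp
    next
      case 4
      then show ?thesis using BG[of i j] by auto
    qed
  qed
  have GB: "d\<Gamma> \<bullet> g' xbar dx = - 2 * (\<Sum>i\<in>pos_idx lbar. \<Sum>j\<in>neg_idx lbar. lbar $ j / lbar $ i * (B $ i $ j)\<^sup>2)"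
  proof -
    have "d\<Gamma> \<bullet> g' xbar dx = G \<bullet> B"
      unfolding G_def inner_conj[symmetric] using P
      by (simp add: B matrix_mul_assoc orthogonal_matrixD) (simp add: orthogonal_cancel)
    also have "\<dots> = (\<Sum>i\<in>UNIV. \<Sum>j\<in>UNIV. - (if 0 < lbar $ i \<and> lbar $ j < 0 then lbar $ j / lbar $ i * (B $ i $ j)\<^sup>2 else 0))
      + (\<Sum>i\<in>UNIV. \<Sum>j\<in>UNIV. - (if 0 < lbar $ j \<and> lbar $ i < 0 then lbar $ i / lbar $ j * (B $ j $ i)\<^sup>2 else 0))"
      unfolding inner_matrix pair by (simp add: sum.distrib[symmetric])
    \<comment> \<open>Exchanging the names of the indices identifies the contributions of the two
      off-diagonal blocks; this is the factor 2 in the curvature.\<close>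
    also have "(\<Sum>i\<in>UNIV. \<Sum>j\<in>UNIV. - (if 0 < lbar $ j \<and> lbar $ i < 0 then lbar $ i / lbar $ j * (B $ j $ i)\<^sup>2 else 0))
      = (\<Sum>i\<in>UNIV. \<Sum>j\<in>UNIV. - (if 0 < lbar $ i \<and> lbar $ j < 0 then lbar $ j / lbar $ i * (B $ i $ j)\<^sup>2 else 0))"
      by (rule sum.swap)
    also have "(\<Sum>i\<in>UNIV. \<Sum>j\<in>UNIV. - (if 0 < lbar $ i \<and> lbar $ j < 0 then lbar $ j / lbar $ i * (B $ i $ j)\<^sup>2 else 0))
      = - (\<Sum>i\<in>pos_idx lbar. \<Sum>j\<in>neg_idx lbar. lbar $ j / lbar $ i * (B $ i $ j)\<^sup>2)"
      unfolding sum_negf pos_idx_def neg_idx_def by (simp only: sum_if_conj)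
    finally show ?thesis by simp
  qed
  have "dx = 0"
  proof (rule ccontr)
    assume "dx \<noteq> 0"
    have "0 < curvature f h g Zbar Pbar lbar dx"
    proof (rule soc[OF \<open>dx \<noteq> 0\<close> e2])
      show "w = 0 \<Longrightarrow> zero_block (zero_idx lbar) (zero_idx lbar) (rotated_deriv g xbar Pbar dx)"
        "zero_block (zero_idx lbar) (neg_idx lbar) (rotated_deriv g xbar Pbar dx)"
        "zero_block (neg_idx lbar) (neg_idx lbar) (rotated_deriv g xbar Pbar dx)"
        using B0 by (auto simp: zero_block_def B_def[symmetric] zero_idx_def neg_idx_def k_def sign_weight_def)
    qed
    also have "curvature f h g Zbar Pbar lbar dx = dx \<bullet> hessL \<xi>bar \<Gamma>bar xbar dx + d\<Gamma> \<bullet> g' xbar dx"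
      by (simp add: curvature_def hessian_Lagr GB B_def)
    also have "\<dots> = (hessL \<xi>bar \<Gamma>bar xbar dx + badj (h' xbar) d\<xi> + badj (g' xbar) d\<Gamma>) \<bullet> dx"
      by (simp add: inner_add_left inner_badj e2 inner_commute[of dx])
    finally show False by (simp add: e1)
  qed
  then have Bz: "B = 0" by (simp add: B)
  have G0: "G $ i $ j = 0" if "k i j \<noteq> 0" for i j
    using BG[of i j] that by (simp add: Bz)
  have orth: "d\<xi> \<bullet> h' xbar v + d\<Gamma> \<bullet> g' xbar v = 0" for v
  proof -
    have "(badj (h' xbar) d\<xi> + badj (g' xbar) d\<Gamma>) \<bullet> v = 0"
      using e1 \<open>dx = 0\<close> by (simp add: linear_0[OF linear_hessL])
    then show ?thesis by (simp add: inner_add_left inner_badj)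
  qed
  \<comment> \<open>The qualification is applied to the multiplier increment itself. The block
    pattern of \<open>C\<close> is the set of weight-zero entries complemented, and \<open>G\<close>
    vanishes wherever the weight is nonzero, so \<open>G\<close> and \<open>C\<close> are
    orthogonal.\<close>
  obtain v C where C: "C \<in> sym_mats" "w = 0 \<longrightarrow> zero_block (zero_idx lbar) (zero_idx lbar) C"
      "zero_block (zero_idx lbar) (neg_idx lbar) C" "zero_block (neg_idx lbar) (neg_idx lbar) C"
      and vC: "d\<xi> = h' xbar v" "d\<Gamma> = g' xbar v + Pbar ** C ** transpose Pbar"
    using cq[OF d\<Gamma>, of d\<xi>] by blast
  have "G \<bullet> C = 0"
  proof -
    have GC: "G $ i $ j * C $ i $ j = 0" for i j
    proof (cases "k i j = 0")
      case True
      consider "lbar $ i = 0" "lbar $ j = 0" "w = 0" | "lbar $ i \<le> 0" "lbar $ j < 0"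
        | "lbar $ i < 0" "lbar $ j \<le> 0"
        using True by (auto simp: k_def sign_weight_def split: if_splits)
      then have "C $ i $ j = 0"
        using C sym_matsD[OF C(1), of i j]
        by cases (auto simp: zero_block_def zero_idx_def neg_idx_def le_less)
      then show ?thesis by simp
    qed (simp add: G0)
    show ?thesis unfolding inner_matrix GC by simp
  qed
  then have "d\<Gamma> \<bullet> (Pbar ** C ** transpose Pbar) = 0" by (simp add: inner_conj G_def)
  then have "d\<xi> \<bullet> d\<xi> + d\<Gamma> \<bullet> d\<Gamma> = 0"
    using orth[of v] by (subst (2) vC(1), subst (2) vC(2)) (simp add: inner_add_right)
  then have "d\<xi> = 0" "d\<Gamma> = 0"
    by (simp_all add: add_nonneg_eq_0_iff)
  then show ?thesis by (simp add: deq \<open>dx = 0\<close> zero_prod_def)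
qed

end

section \<open>Local estimates\<close>

text \<open>The linearisation is taken at the moving point \<open>x\<close>, not at
  \<open>a\<close>, because the Newton operator is evaluated at the iterate. Only the oscillation of
  the derivative on the ball around \<open>a\<close> through \<open>x\<close> enters.\<close>

lemma remainder_bound:
  fixes \<phi> :: "'a::real_normed_vector \<Rightarrow> 'b::real_normed_vector"
  assumes D: "\<And>y. (\<phi> has_derivative D y) (at y)" and "0 \<le> B"
    and B: "\<And>y v. norm (y - a) \<le> norm (x - a) \<Longrightarrow> norm (D y v - D x v) \<le> B * norm v"
  shows "norm (\<phi> x - \<phi> a - D x (x - a)) \<le> B * norm (x - a)"
proof -
  have "norm (\<phi> x - \<phi> a - D x (x - a)) \<le> norm (x - a) * B"
  proof (rule differentiable_bound_linearization[where S = "cball a (norm (x - a))"])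
    show "a + t *\<^sub>R (x - a) \<in> cball a (norm (x - a))" if "t \<in> {0..1}" for t
      using that by (simp add: dist_norm mult_left_le_one_le)
    show "(\<phi> has_derivative D y) (at y within cball a (norm (x - a)))" for y
      using D has_derivative_at_withinI by blast
    show "onorm (D y - D x) \<le> B" if "y \<in> cball a (norm (x - a))" for y
      using that \<open>0 \<le> B\<close> B[of y] by (intro onorm_bound) (auto simp: dist_norm norm_minus_commute)
    show "x \<in> cball a (norm (x - a))" by (simp add: dist_norm norm_minus_commute)
  qed
  then show ?thesis by (simp add: mult.commute)
qed

lemma continuous_on_UNIV_dist:
  assumes "continuous_on UNIV \<phi>" "0 < e"
  shows "\<exists>r>0. \<forall>x. dist x a < r \<longrightarrow> dist (\<phi> x) (\<phi> a) < e"
  using assms unfolding continuous_on_iff by blast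

lemma second_derivs_local_bounds:
  fixes \<phi> :: "'a::euclidean_space \<Rightarrow> 'b::real_normed_vector"
  assumes d: "second_derivs \<phi> \<phi>' \<phi>''" and c: "continuous_on UNIV \<phi>''"
  shows "\<exists>r>0. \<exists>K\<ge>0. \<forall>x. norm (x - a) < r \<longrightarrow> norm (\<phi>'' x) \<le> K \<and> norm (\<phi> x - \<phi> a) \<le> K * norm (x - a) \<and>
    norm (\<phi> x - \<phi> a - blinfun_apply (\<phi>' x) (x - a)) \<le> K * (norm (x - a))\<^sup>2"
proof -
  have D1: "\<And>x. (\<phi> has_derivative blinfun_apply (\<phi>' x)) (at x)"
    and D2: "\<And>x. (\<phi>' has_derivative blinfun_apply (\<phi>'' x)) (at x)"
    using d by (auto simp: second_derivs_def)
  obtain r0 where "r0 > 0" and r0: "\<And>x. dist x a < r0 \<Longrightarrow> dist (\<phi>'' x) (\<phi>'' a) < 1"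
    using continuous_on_UNIV_dist[OF c, of 1 a] by auto
  \<comment> \<open>The cap at 1 lets the first derivative be bounded by its value at
    \<open>a\<close> plus \<open>K0\<close>.\<close>
  define r where "r = min r0 1"
  have r: "0 < r" "r \<le> r0" "r \<le> 1" using \<open>r0 > 0\<close> by (auto simp: r_def)
  define K0 where "K0 = norm (\<phi>'' a) + 1"
  have K0: "0 \<le> K0" by (simp add: K0_def add_nonneg_nonneg)
  have b2: "norm (\<phi>'' x) \<le> K0" if "norm (x - a) < r" for x
  proof -
    have "norm (\<phi>'' x - \<phi>'' a) < 1" using r0[of x] that r by (simp add: dist_norm)
    then show ?thesis using norm_triangle_sub[of "\<phi>'' x" "\<phi>'' a"] by (simp add: K0_def)
  qed
  have lip1: "norm (\<phi>' x - \<phi>' y) \<le> K0 * norm (x - y)" if "norm (x - a) < r" "norm (y - a) < r" for x y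
  proof (rule differentiable_bound[where S = "ball a r"])
    show "(\<phi>' has_derivative blinfun_apply (\<phi>'' z)) (at z within ball a r)" for z
      using D2 has_derivative_at_withinI by blast
    show "onorm (blinfun_apply (\<phi>'' z)) \<le> K0" if "z \<in> ball a r" for z
      using b2[of z] that by (simp add: norm_blinfun.rep_eq[symmetric] dist_norm norm_minus_commute)
  qed (use that in \<open>auto simp: dist_norm norm_minus_commute\<close>)
  define K1 where "K1 = norm (\<phi>' a) + K0"
  have b1: "norm (\<phi>' x) \<le> K1" if "norm (x - a) < r" for x
  proof -
    have "norm (\<phi>' x - \<phi>' a) \<le> K0 * norm (x - a)" using lip1[of x a] that r by simp
    also have "\<dots> \<le> K0" using that r K0 by (intro mult_left_le) auto
    finally show ?thesis using norm_triangle_sub[of "\<phi>' x" "\<phi>' a"] by (simp add: K1_def)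
  qed
  have lip0: "norm (\<phi> x - \<phi> a) \<le> K1 * norm (x - a)" if "norm (x - a) < r" for x
  proof (rule differentiable_bound[where S = "ball a r"])
    show "(\<phi> has_derivative blinfun_apply (\<phi>' z)) (at z within ball a r)" for z
      using D1 has_derivative_at_withinI by blast
    show "onorm (blinfun_apply (\<phi>' z)) \<le> K1" if "z \<in> ball a r" for z
      using b1[of z] that by (simp add: norm_blinfun.rep_eq[symmetric] dist_norm norm_minus_commute)
  qed (use that r in \<open>auto simp: dist_norm norm_minus_commute\<close>)
  have rem: "norm (\<phi> x - \<phi> a - blinfun_apply (\<phi>' x) (x - a)) \<le> 2 * K0 * (norm (x - a))\<^sup>2"
    if "norm (x - a) < r" for x
  proof -
    have "norm (\<phi> x - \<phi> a - blinfun_apply (\<phi>' x) (x - a)) \<le> (K0 * (2 * norm (x - a))) * norm (x - a)"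
    proof (rule remainder_bound[OF D1])
      fix y v assume y: "norm (y - a) \<le> norm (x - a)"
      have "norm (\<phi>' y - \<phi>' x) \<le> K0 * norm (y - x)" using lip1[of y x] y that by simp
      also have "\<dots> \<le> K0 * (2 * norm (x - a))"
        using y norm_triangle_ineq4[of "y - a" "x - a"] K0 by (intro mult_left_mono) auto
      finally have "norm (\<phi>' y - \<phi>' x) \<le> K0 * (2 * norm (x - a))" .
      then have "norm (blinfun_apply (\<phi>' y - \<phi>' x) v) \<le> K0 * (2 * norm (x - a)) * norm v"
        by (rule order_trans[OF norm_blinfun mult_right_mono]) simp
      then show "norm (blinfun_apply (\<phi>' y) v - blinfun_apply (\<phi>' x) v) \<le> K0 * (2 * norm (x - a)) * norm v"
        by (simp add: blinfun.diff_left)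
    qed (use K0 in simp)
    then show ?thesis by (simp add: power2_eq_square mult_ac)
  qed
  have K1: "0 \<le> K1" using K0 by (simp add: K1_def)
  show ?thesis
  proof (intro exI conjI allI impI)
    show "0 < r" by (fact r)
    show "0 \<le> 2 * K0 + K1" using K0 K1 by simp
    fix x assume x: "norm (x - a) < r"
    show "norm (\<phi>'' x) \<le> 2 * K0 + K1" using b2[OF x] K0 K1 by simp
    show "norm (\<phi> x - \<phi> a) \<le> (2 * K0 + K1) * norm (x - a)"
      by (rule order_trans[OF lip0[OF x] mult_right_mono]) (use K0 in auto)
    show "norm (\<phi> x - \<phi> a - blinfun_apply (\<phi>' x) (x - a)) \<le> (2 * K0 + K1) * (norm (x - a))\<^sup>2"
      by (rule order_trans[OF rem[OF x] mult_right_mono]) (use K1 in auto)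
  qed
qed

text \<open>In finite dimension convergence on the basis vectors is already convergence in operator
  norm; expanding \<open>d\<close> in the basis costs a factor equal to the dimension.\<close>

lemma uniform_operator_limit:
  fixes L :: "'z::metric_space \<Rightarrow> 'a::euclidean_space \<Rightarrow> 'b::real_normed_vector"
  assumes lin: "\<And>Z. Z \<in> S \<Longrightarrow> linear (L Z)" "linear (L Z0)"
    and lim: "\<And>b. b \<in> Basis \<Longrightarrow> ((\<lambda>Z. L Z b) \<longlongrightarrow> L Z0 b) (at Z0 within S)" and "0 < \<epsilon>"
  shows "\<exists>r>0. \<forall>Z\<in>S. dist Z Z0 < r \<longrightarrow> (\<forall>d. norm (L Z d - L Z0 d) \<le> \<epsilon> * norm d)"
proof -
  define e where "e = \<epsilon> / real DIM('a)"
  have "0 < e" using \<open>0 < \<epsilon>\<close> by (simp add: e_def)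
  have "eventually (\<lambda>Z. \<forall>b\<in>Basis. dist (L Z b) (L Z0 b) < e) (at Z0 within S)"
    using lim \<open>0 < e\<close> by (intro eventually_ball_finite ballI finite_Basis) (auto dest: tendstoD)
  then obtain r where "r > 0" and r: "\<And>Z. Z \<in> S \<Longrightarrow> Z \<noteq> Z0 \<Longrightarrow> dist Z Z0 < r \<Longrightarrow>
      \<forall>b\<in>Basis. dist (L Z b) (L Z0 b) < e"
    by (auto simp: eventually_at)
  have "norm (L Z d - L Z0 d) \<le> \<epsilon> * norm d" if Z: "Z \<in> S" "dist Z Z0 < r" for Z d
  proof (cases "Z = Z0")
    case False
    have "L Z d - L Z0 d = (\<Sum>b\<in>Basis. (d \<bullet> b) *\<^sub>R (L Z b - L Z0 b))"
      using linear_sum[OF lin(1)[OF Z(1)], of "\<lambda>b. (d \<bullet> b) *\<^sub>R b" Basis]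
        linear_sum[OF lin(2), of "\<lambda>b. (d \<bullet> b) *\<^sub>R b" Basis]
      by (simp add: euclidean_representation linear_scale[OF lin(1)[OF Z(1)]] linear_scale[OF lin(2)]
          scaleR_diff_right sum_subtractf)
    also have "norm \<dots> \<le> (\<Sum>b\<in>(Basis :: 'a set). norm d * e)"
    proof (intro sum_norm_le)
      fix b :: 'a assume b: "b \<in> Basis"
      have "norm (L Z b - L Z0 b) \<le> e"
        using r[OF Z(1) False Z(2)] b by (auto simp: dist_norm less_imp_le)
      then show "norm ((d \<bullet> b) *\<^sub>R (L Z b - L Z0 b)) \<le> norm d * e"
        using Basis_le_norm[OF b, of d] by (auto intro!: mult_mono)
    qed
    also have "\<dots> = \<epsilon> * norm d" by (simp add: e_def)
    finally show ?thesis .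
  qed (use \<open>0 < \<epsilon>\<close> in simp)
  then show ?thesis using \<open>r > 0\<close> by blast
qed

section \<open>Corrected points, the operators and the residual near the KKT point\<close>

context kkt begin

text \<open>One decomposition with gapped spectrum is asked for; by \<open>gapped_transfer\<close>
  all others are then gapped too.\<close>

definition corrected :: "('x \<times> (real^'m) \<times> 'n rmat) set" where
  "corrected = {Z \<in> Zspace. \<exists>P l. eigen_decomp (g (fst Z) + snd (snd Z)) P l \<and> (\<forall>i. l $ i \<in> gapped \<delta>)}"

lemma correctedD: "Z \<in> corrected \<Longrightarrow> Z \<in> Zspace"
  by (simp add: corrected_def)

lemma correction_corrected:
  assumes "Z \<in> Zspace"
  shows "correction g \<delta> Z \<in> corrected"
proof -
  obtain x \<xi> \<Gamma> where Z: "Z = (x, \<xi>, \<Gamma>)" by (metis surj_pair)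
  have "\<Gamma> \<in> sym_mats" using assms by (simp add: Z Zspace_def)
  obtain P l where P: "eigen_decomp (g x + \<Gamma>) P l"
    and c: "correction g \<delta> (x, \<xi>, \<Gamma>) = (x, \<xi>, \<Gamma> - P ** Diag (\<chi> i. if \<bar>l $ i\<bar> \<le> \<delta> then l $ i else 0) ** transpose P)"
    using correction_eq[where g = g and x = x and \<Gamma> = \<Gamma>, OF g_plus_sym[OF assms[unfolded Z]]] by blast
  let ?D = "P ** Diag (\<chi> i. if \<bar>l $ i\<bar> \<le> \<delta> then l $ i else 0) ** transpose P"
  define l' where "l' = (\<chi> i. if \<bar>l $ i\<bar> \<le> \<delta> then 0 else l $ i)"
  have "g x + \<Gamma> - ?D = P ** Diag l' ** transpose P"
    using P unfolding eigen_decomp_def vec_eq_iff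
    by (simp only: vector_minus_component conj_Diag_nth sum_subtractf[symmetric])
      (auto intro!: sum.cong simp: l'_def)
  then have "eigen_decomp (g x + (\<Gamma> - ?D)) P l'"
    using P by (simp add: eigen_decomp_def add_diff_eq)
  moreover have "l' $ i \<in> gapped \<delta>" for i by (auto simp: l'_def gapped_def)
  moreover have "\<Gamma> - ?D \<in> sym_mats"
    by (intro subspace_diff[OF subspace_sym_mats] \<open>\<Gamma> \<in> sym_mats\<close> sym_conj Diag_sym)
  ultimately show ?thesis by (auto simp: corrected_def Z c Zspace_def)
qed

lemma norm_components:
  "norm (x - xbar) \<le> norm ((x, \<xi>, \<Gamma>) - Zbar)"
  "norm (\<xi> - \<xi>bar) \<le> norm ((x, \<xi>, \<Gamma>) - Zbar)"
  "norm (\<Gamma> - \<Gamma>bar) \<le> norm ((x, \<xi>, \<Gamma>) - Zbar)"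
  using norm_fst_le[of "x - xbar" "(\<xi> - \<xi>bar, \<Gamma> - \<Gamma>bar)"] norm_snd_le[of "(\<xi> - \<xi>bar, \<Gamma> - \<Gamma>bar)" "x - xbar"]
    norm_fst_le[of "\<xi> - \<xi>bar" "\<Gamma> - \<Gamma>bar"] norm_snd_le[of "\<Gamma> - \<Gamma>bar" "\<xi> - \<xi>bar"]
  by auto

lemma norm_A_diff_le:
  "norm ((g x + \<Gamma>) - (g xbar + \<Gamma>bar)) \<le> norm (g x - g xbar) + norm (\<Gamma> - \<Gamma>bar)"
  using norm_triangle_ineq[of "g x - g xbar" "\<Gamma> - \<Gamma>bar"] by (simp add: algebra_simps)

lemma spectral_gap: "\<exists>\<mu>>0. \<forall>k. lbar $ k = 0 \<or> \<delta> + \<mu> \<le> \<bar>lbar $ k\<bar>"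
proof -
  \<comment> \<open>The element 1 keeps the minimum meaningful when all eigenvalues are 0.\<close>
  define T where "T = insert 1 ((\<lambda>k. \<bar>lbar $ k\<bar> - \<delta>) ` {k. lbar $ k \<noteq> 0})"
  have T: "finite T" "T \<noteq> {}" by (auto simp: T_def)
  have "0 < Min T"
    using lbar_gapped T by (subst Min_gr_iff) (auto simp: T_def gapped_def)
  moreover have "\<delta> + Min T \<le> \<bar>lbar $ k\<bar>" if "lbar $ k \<noteq> 0" for k
  proof -
    have "\<bar>lbar $ k\<bar> - \<delta> \<in> T" using that by (auto simp: T_def)
    then show ?thesis using Min_le[OF T(1)] by fastforce
  qed
  ultimately show ?thesis by blast
qed

text \<open>Near the reference point the perturbation is below the margin \<open>\<mu>\<close>, so
  an eigenvalue of modulus at most \<open>\<delta>\<close> can only be close to a zero eigenvalue of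
  the reference matrix. The removed part is therefore no larger than a multiple of the distance
  itself.\<close>

lemma correction_close:
  "\<exists>r>0. \<exists>C\<ge>0. \<forall>Z\<in>Zspace. norm (Z - Zbar) < r \<longrightarrow> norm (correction g \<delta> Z - Zbar) \<le> C * norm (Z - Zbar)"
proof -
  obtain \<mu> where "\<mu> > 0" and \<mu>: "\<And>k. lbar $ k = 0 \<or> \<delta> + \<mu> \<le> \<bar>lbar $ k\<bar>"
    using spectral_gap by blast
  obtain r0 K where "r0 > 0" "K \<ge> 0" and K: "\<And>x. norm (x - xbar) < r0 \<Longrightarrow> norm (g x - g xbar) \<le> K * norm (x - xbar)"
    using second_derivs_local_bounds[OF g g'', of xbar] by blast
  define n where "n = (real CARD('n))\<^sup>2"
  have "0 \<le> n" by (simp add: n_def)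
  have main: "norm (correction g \<delta> Z - Zbar) \<le> (1 + n * (K + 1)) * norm (Z - Zbar)"
    if Z: "Z \<in> Zspace" and near: "norm (Z - Zbar) < min r0 (\<mu> / (K + 1))" for Z
  proof -
    obtain x \<xi> \<Gamma> where Zeq: "Z = (x, \<xi>, \<Gamma>)" by (metis surj_pair)
    define t where "t = norm (Z - Zbar)"
    have comp: "norm (x - xbar) \<le> t" "norm (\<Gamma> - \<Gamma>bar) \<le> t"
      using norm_components[where x=x and \<xi>=\<xi> and \<Gamma>=\<Gamma>] by (simp_all only: t_def Zeq)
    obtain P l where P: "eigen_decomp (g x + \<Gamma>) P l"
      and c: "correction g \<delta> (x, \<xi>, \<Gamma>) = (x, \<xi>, \<Gamma> - P ** Diag (\<chi> i. if \<bar>l $ i\<bar> \<le> \<delta> then l $ i else 0) ** transpose P)"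
      using correction_eq[where g = g and x = x and \<Gamma> = \<Gamma>, OF g_plus_sym[OF Z[unfolded Zeq]]] by blast
    let ?D = "P ** Diag (\<chi> i. if \<bar>l $ i\<bar> \<le> \<delta> then l $ i else 0) ** transpose P"
    define a where "a = norm ((g x + \<Gamma>) - (g xbar + \<Gamma>bar))"
    have "norm (g x - g xbar) \<le> K * t"
      using K[of x] comp near mult_left_mono[OF comp(1) \<open>K \<ge> 0\<close>] by (auto simp: t_def)
    then have a: "a \<le> (K + 1) * t"
      using norm_A_diff_le[of x \<Gamma>] comp by (simp add: a_def algebra_simps)
    also have "\<dots> < \<mu>" using near \<open>K \<ge> 0\<close> by (simp add: t_def pos_less_divide_eq mult.commute)
    finally have "a < \<mu>" .
    have small: "\<bar>l $ i\<bar> \<le> a" if "\<bar>l $ i\<bar> \<le> \<delta>" for i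
    proof -
      obtain k where k: "\<bar>l $ i - lbar $ k\<bar> \<le> a"
        using eigenvalue_perturbation[OF P Abar, of i] by (auto simp: a_def)
      then have "lbar $ k = 0" using \<mu>[of k] that \<open>a < \<mu>\<close> by linarith
      then show ?thesis using k by simp
    qed
    have "norm ?D = norm (Diag (\<chi> i. if \<bar>l $ i\<bar> \<le> \<delta> then l $ i else 0))"
      using P by (simp add: eigen_decomp_def norm_orthogonal_mul_left norm_orthogonal_mul_right)
    also have "\<dots> \<le> n * a"
      unfolding n_def using small by (intro norm_le_entry_bound) (auto simp: a_def)
    also have "\<dots> \<le> n * ((K + 1) * t)" using a \<open>0 \<le> n\<close> by (rule mult_left_mono)
    finally have D: "norm ?D \<le> n * ((K + 1) * t)" .
    have "correction g \<delta> Z - Zbar = (Z - Zbar) - (0, 0, ?D)"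
      by (simp add: Zeq c)
    also have "norm \<dots> \<le> t + norm ?D"
      unfolding t_def by (rule order_trans[OF norm_triangle_ineq4]) (simp add: norm_Pair)
    also have "\<dots> \<le> (1 + n * (K + 1)) * t" using D by (simp add: algebra_simps)
    finally show ?thesis by (simp add: t_def)
  qed
  have "0 < min r0 (\<mu> / (K + 1))" using \<open>r0 > 0\<close> \<open>\<mu> > 0\<close> \<open>K \<ge> 0\<close> by simp
  moreover have "0 \<le> 1 + n * (K + 1)" using \<open>0 \<le> n\<close> \<open>K \<ge> 0\<close> by simp
  ultimately show ?thesis using main by blast
qed

lemma V_op_near:
  fixes x \<xi> \<Gamma>
  assumes "(x, \<xi>, \<Gamma>) \<in> corrected"
  shows "norm (V_op w (g x + \<Gamma>) H - V_op w (g xbar + \<Gamma>bar) H)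
    \<le> (real CARD('n)) ^ 4 * (2 * (1 / \<delta>) * norm ((g x + \<Gamma>) - (g xbar + \<Gamma>bar)) * norm H)"
    and "norm (V_op w (g x + \<Gamma>) H) \<le> (real CARD('n))\<^sup>2 * norm H"
    and "norm (V_op w (g x + \<Gamma>) ((g x + \<Gamma>) - (g xbar + \<Gamma>bar)) - (proj_psd (g x + \<Gamma>) - g xbar))
    \<le> (real CARD('n))^3 / \<delta> * (norm ((g x + \<Gamma>) - (g xbar + \<Gamma>bar)))\<^sup>2"
proof -
  obtain P l where P: "eigen_decomp (g x + \<Gamma>) P l" and l: "\<And>i. l $ i \<in> gapped \<delta>"
    using assms by (auto simp: corrected_def)
  note V = V_op_eq_schur[OF P l \<delta> w01] and Vbar = V_op_eq_schur[OF Abar lbar_gapped \<delta> w01]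
  show "norm (V_op w (g x + \<Gamma>) H - V_op w (g xbar + \<Gamma>bar) H)
    \<le> (real CARD('n)) ^ 4 * (2 * (1 / \<delta>) * norm ((g x + \<Gamma>) - (g xbar + \<Gamma>bar)) * norm H)"
    unfolding V Vbar by (rule sign_weight_schur_lipschitz[OF P Abar l lbar_gapped \<delta> w01])
  show "norm (V_op w (g x + \<Gamma>) H) \<le> (real CARD('n))\<^sup>2 * norm H"
    unfolding V using P sign_weight_bounds[OF w01] by (intro norm_spectral_schur_le) (auto simp: eigen_decomp_def)
  show "norm (V_op w (g x + \<Gamma>) ((g x + \<Gamma>) - (g xbar + \<Gamma>bar)) - (proj_psd (g x + \<Gamma>) - g xbar))
    \<le> (real CARD('n))^3 / \<delta> * (norm ((g x + \<Gamma>) - (g xbar + \<Gamma>bar)))\<^sup>2"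
    unfolding V using proj_psd_semismooth[OF P Abar l lbar_gapped \<delta> w] by (simp only: kktD)
qed

lemma U_tendsto: "((\<lambda>Z. U Z d) \<longlongrightarrow> U Zbar d) (at Zbar within corrected)"
proof -
  obtain dx d\<xi> d\<Gamma> where d: "d = (dx, d\<xi>, d\<Gamma>)" by (metis surj_pair)
  let ?at = "at Zbar within corrected"
  have X: "((\<lambda>Z. fst Z) \<longlongrightarrow> xbar) ?at" and \<Xi>: "((\<lambda>Z. fst (snd Z)) \<longlongrightarrow> \<xi>bar) ?at"
    and G: "((\<lambda>Z. snd (snd Z)) \<longlongrightarrow> \<Gamma>bar) ?at"
    by (auto intro!: tendsto_eq_intros)
  have comp: "((\<lambda>Z. \<phi> (fst Z)) \<longlongrightarrow> \<phi> xbar) ?at" if "isCont \<phi> xbar" for \<phi> :: "'x \<Rightarrow> 'b::topological_space"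
    using isCont_tendsto_compose[OF that X] .
  have cont: "isCont f'' xbar" "isCont h'' xbar" "isCont g'' xbar" "isCont h' xbar" "isCont g' xbar" "isCont g xbar"
    using f'' h'' g'' derivs[THEN has_derivative_continuous] by (auto simp: continuous_on_eq_continuous_at)
  note lims = comp[OF cont(1)] comp[OF cont(2)] comp[OF cont(3)] comp[OF cont(4)] comp[OF cont(5)] comp[OF cont(6)]
  have 1: "((\<lambda>Z. hessL (fst (snd Z)) (snd (snd Z)) (fst Z) dx + badj (h' (fst Z)) d\<xi> + badj (g' (fst Z)) d\<Gamma>)
     \<longlongrightarrow> hessL \<xi>bar \<Gamma>bar xbar dx + badj (h' xbar) d\<xi> + badj (g' xbar) d\<Gamma>) ?at"
    unfolding hessL_def
    by (intro tendsto_add badj.tendsto blinfun.tendsto lims tendsto_const \<Xi> G)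
  have 2: "((\<lambda>Z. h' (fst Z) dx) \<longlongrightarrow> h' xbar dx) ?at"
    by (intro blinfun.tendsto lims tendsto_const)
  have g'lim: "((\<lambda>Z. g' (fst Z) dx) \<longlongrightarrow> g' xbar dx) ?at"
    by (intro blinfun.tendsto lims tendsto_const)
  define A where "A Z = g (fst Z) + snd (snd Z)" for Z :: "'x \<times> (real^'m) \<times> 'n rmat"
  define H where "H Z = g' (fst Z) dx + d\<Gamma>" for Z :: "'x \<times> (real^'m) \<times> 'n rmat"
  have Alim: "(A \<longlongrightarrow> A Zbar) ?at" and Hlim: "(H \<longlongrightarrow> H Zbar) ?at"
    unfolding A_def[abs_def] H_def[abs_def] by (auto intro!: tendsto_eq_intros lims G g'lim)
  have "bounded_linear (V_op w (A Zbar))"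
    using linear_V_op[OF g_plus_sym[OF Zbar_Zspace]] by (simp add: A_def linear_conv_bounded_linear)
  then have Vbar: "((\<lambda>Z. V_op w (A Zbar) (H Z)) \<longlongrightarrow> V_op w (A Zbar) (H Zbar)) ?at"
    by (rule bounded_linear.tendsto) (rule Hlim)
  \<comment> \<open>Matrix and argument vary together. The variation of the matrix is handled by the
    Lipschitz bound, available on corrected points only; the variation of the argument goes through
    the fixed linear operator at \<open>Zbar\<close>.\<close>
  have diff0: "((\<lambda>Z. V_op w (A Z) (H Z) - V_op w (A Zbar) (H Z)) \<longlongrightarrow> 0) ?at"
  proof (rule Lim_null_comparison)
    show "eventually (\<lambda>Z. norm (V_op w (A Z) (H Z) - V_op w (A Zbar) (H Z))
      \<le> (real CARD('n)) ^ 4 * (2 * (1 / \<delta>) * norm (A Z - A Zbar) * norm (H Z))) ?at"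
    proof (rule eventually_at_topological[THEN iffD2], intro exI[of _ UNIV] conjI ballI impI)
      fix Z assume "Z \<in> corrected"
      then show "norm (V_op w (A Z) (H Z) - V_op w (A Zbar) (H Z))
      \<le> (real CARD('n)) ^ 4 * (2 * (1 / \<delta>) * norm (A Z - A Zbar) * norm (H Z))"
        using V_op_near(1)[of "fst Z" "fst (snd Z)" "snd (snd Z)" "H Z"] by (simp add: A_def)
    qed auto
    have "((\<lambda>Z. (real CARD('n)) ^ 4 * (2 * (1 / \<delta>) * norm (A Z - A Zbar) * norm (H Z)))
      \<longlongrightarrow> (real CARD('n)) ^ 4 * (2 * (1 / \<delta>) * norm (A Zbar - A Zbar) * norm (H Zbar))) ?at"
      by (intro tendsto_mult tendsto_norm tendsto_diff tendsto_const Alim Hlim)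
    then show "((\<lambda>Z. (real CARD('n)) ^ 4 * (2 * (1 / \<delta>) * norm (A Z - A Zbar) * norm (H Z))) \<longlongrightarrow> 0) ?at"
      by simp
  qed
  have 3: "((\<lambda>Z. V_op w (A Z) (H Z)) \<longlongrightarrow> V_op w (A Zbar) (H Zbar)) ?at"
    using tendsto_add[OF diff0 Vbar] by simp
  have "U Z d = (hessL (fst (snd Z)) (snd (snd Z)) (fst Z) dx + badj (h' (fst Z)) d\<xi> + badj (g' (fst Z)) d\<Gamma>,
     h' (fst Z) dx, - g' (fst Z) dx + V_op w (A Z) (H Z))" for Z
    by (cases Z) (auto simp: d U_op_eq A_def H_def)
  then show ?thesis
    by (simp only: fst_conv snd_conv) (intro tendsto_Pair tendsto_add tendsto_minus 1 2 3 g'lim)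
qed

text \<open>Injectivity at \<open>Zbar\<close> gives a lower bound \<open>e\<close> on the subspace;
  operators within \<open>e / 2\<close> of it keep half of that bound. This gives uniformly bounded
  inverses although nonsingularity is assumed at one point only.\<close>

lemma U_bounds:
  assumes inj: "\<And>d. d \<in> Zspace \<Longrightarrow> U Zbar d = 0 \<Longrightarrow> d = 0"
  shows "\<exists>r>0. \<exists>c>0. \<exists>K\<ge>0. \<forall>Z\<in>corrected. norm (Z - Zbar) < r \<longrightarrow>
    (\<forall>d\<in>Zspace. c * norm d \<le> norm (U Z d) \<and> norm (U Z d) \<le> K * norm d)"
proof -
  note lin = linear_U_op[OF Zbar_Zspace, of w]
  have bl: "bounded_linear (U Zbar)" using lin by (simp add: linear_conv_bounded_linear)
  obtain e where "e > 0" and e: "\<And>d. d \<in> Zspace \<Longrightarrow> e * norm d \<le> norm (U Zbar d)"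
    using injective_imp_isometric[OF closed_subspace[OF subspace_Zspace] subspace_Zspace bl] inj by auto
  obtain K where "K > 0" and K: "\<And>d. norm (U Zbar d) \<le> norm d * K"
    using bounded_linear.pos_bounded[OF bl] by auto
  obtain r where "r > 0" and r: "\<And>Z d. Z \<in> corrected \<Longrightarrow> dist Z Zbar < r \<Longrightarrow> norm (U Z d - U Zbar d) \<le> e / 2 * norm d"
    using uniform_operator_limit[OF linear_U_op[OF correctedD] lin U_tendsto, of "e / 2"] \<open>e > 0\<close> by auto
  have "e / 2 * norm d \<le> norm (U Z d) \<and> norm (U Z d) \<le> (K + e / 2) * norm d"
    if "Z \<in> corrected" "norm (Z - Zbar) < r" "d \<in> Zspace" for Z d
  proof -
    have "norm (U Z d - U Zbar d) \<le> e / 2 * norm d" using r that by (simp add: dist_norm)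
    then show ?thesis
      using e[OF that(3)] K[of d] norm_triangle_sub[of "U Z d" "U Zbar d"] norm_triangle_sub[of "U Zbar d" "U Z d"]
      by (simp add: norm_minus_commute algebra_simps)
  qed
  moreover have "0 < e / 2" "0 \<le> K + e / 2" using \<open>e > 0\<close> \<open>K > 0\<close> by auto
  ultimately show ?thesis using \<open>r > 0\<close> by blast
qed

text \<open>The multipliers are frozen at the reference point, so this is a function of
  \<open>x\<close> alone; their variation contributes only quadratic terms, accounted for
  separately.\<close>

definition grad_rem :: "'x \<Rightarrow> real" where
  "grad_rem x = norm (gradL \<xi>bar \<Gamma>bar x - gradL \<xi>bar \<Gamma>bar xbar - hessL \<xi>bar \<Gamma>bar x (x - xbar))"

lemma grad_rem_bound:
  assumes "0 \<le> B" and B: "\<And>y. norm (y - xbar) \<le> norm (x - xbar) \<Longrightarrow>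
    norm (f'' y - f'' x) \<le> B \<and> norm (h'' y - h'' x) \<le> B \<and> norm (g'' y - g'' x) \<le> B"
  shows "grad_rem x \<le> B * (1 + norm \<xi>bar + norm \<Gamma>bar) * norm (x - xbar)"
  unfolding grad_rem_def
proof (rule remainder_bound[OF gradL_has_derivative])
  show "0 \<le> B * (1 + norm \<xi>bar + norm \<Gamma>bar)" using \<open>0 \<le> B\<close> by simp
  fix y v assume y: "norm (y - xbar) \<le> norm (x - xbar)"
  have *: "norm (badj (T v - T' v) z) \<le> B * norm v * norm z"
    if "norm (T - T') \<le> B" for T T' :: "'x \<Rightarrow>\<^sub>L 'x \<Rightarrow>\<^sub>L 'b::euclidean_space" and z
  proof -
    have "norm (T v - T' v) \<le> B * norm v"
      unfolding blinfun.diff_left[symmetric]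
      by (rule order_trans[OF norm_blinfun mult_right_mono[OF that]]) simp
    then show ?thesis by (rule order_trans[OF norm_badj mult_right_mono]) simp
  qed
  have "hessL \<xi>bar \<Gamma>bar y v - hessL \<xi>bar \<Gamma>bar x v
     = badj (f'' y v - f'' x v) 1 + badj (h'' y v - h'' x v) \<xi>bar + badj (g'' y v - g'' x v) \<Gamma>bar"
    by (simp add: hessL_def badj.diff_left)
  also have "norm \<dots> \<le> B * norm v * norm (1::real) + B * norm v * norm \<xi>bar + B * norm v * norm \<Gamma>bar"
    using B[OF y] by (intro norm_triangle_le add_mono *) auto
  finally show "norm (hessL \<xi>bar \<Gamma>bar y v - hessL \<xi>bar \<Gamma>bar x v) \<le> B * (1 + norm \<xi>bar + norm \<Gamma>bar) * norm v"
    by (simp add: algebra_simps)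
qed

lemma grad_rem_small:
  assumes "0 < \<epsilon>"
  shows "\<exists>r>0. \<forall>x. norm (x - xbar) < r \<longrightarrow> grad_rem x \<le> \<epsilon> * norm (x - xbar)"
proof -
  define m where "m = 1 + norm \<xi>bar + norm \<Gamma>bar"
  have "0 < m" by (simp add: m_def add_pos_nonneg)
  \<comment> \<open>The 2 pays for comparing \<open>y\<close> and \<open>x\<close> through
    \<open>xbar\<close>, and \<open>m\<close> collects the weights of the three second derivatives
    in the Hessian.\<close>
  define e where "e = \<epsilon> / (2 * m)"
  have "0 < e" using assms \<open>0 < m\<close> by (simp add: e_def)
  obtain r1 r2 r3 where r: "r1 > 0" "r2 > 0" "r3 > 0"
    and r1: "\<And>x. dist x xbar < r1 \<Longrightarrow> dist (f'' x) (f'' xbar) < e"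
    and r2: "\<And>x. dist x xbar < r2 \<Longrightarrow> dist (h'' x) (h'' xbar) < e"
    and r3: "\<And>x. dist x xbar < r3 \<Longrightarrow> dist (g'' x) (g'' xbar) < e"
    using continuous_on_UNIV_dist[OF f'' \<open>0 < e\<close>] continuous_on_UNIV_dist[OF h'' \<open>0 < e\<close>]
      continuous_on_UNIV_dist[OF g'' \<open>0 < e\<close>] by metis
  have "grad_rem x \<le> \<epsilon> * norm (x - xbar)" if x: "norm (x - xbar) < min r1 (min r2 r3)" for x
  proof -
    have tri: "norm (u - v) \<le> 2 * e" if "dist u c < e" "dist v c < e" for u v c :: "'c::real_normed_vector"
      using dist_triangle2[of u v c] that by (simp add: dist_norm)
    have "grad_rem x \<le> 2 * e * m * norm (x - xbar)"
      unfolding m_def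
    proof (rule grad_rem_bound)
      fix y assume "norm (y - xbar) \<le> norm (x - xbar)"
      then have "dist y xbar < min r1 (min r2 r3)" "dist x xbar < min r1 (min r2 r3)"
        using x by (simp_all add: dist_norm)
      then show "norm (f'' y - f'' x) \<le> 2 * e \<and> norm (h'' y - h'' x) \<le> 2 * e \<and> norm (g'' y - g'' x) \<le> 2 * e"
        by (intro conjI tri) (auto intro: r1 r2 r3)
    qed (use \<open>0 < e\<close> in simp)
    then show ?thesis using \<open>0 < m\<close> by (simp add: e_def)
  qed
  then show ?thesis using r by (intro exI[of _ "min r1 (min r2 r3)"]) auto
qed

lemma lipschitz_second_deriv:
  assumes "second_derivs \<phi> \<phi>' \<phi>''" "twice_lipschitz_diff \<phi>"
  shows "\<exists>r>0. \<exists>K. K-lipschitz_on (ball a r) \<phi>''"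
  using assms(2) second_derivs_unique(2)[OF assms(1)] unfolding twice_lipschitz_diff_def by metis

lemma grad_rem_quadratic:
  assumes "twice_lipschitz_diff f" "twice_lipschitz_diff h" "twice_lipschitz_diff g"
  shows "\<exists>r>0. \<exists>M\<ge>0. \<forall>x. norm (x - xbar) < r \<longrightarrow> grad_rem x \<le> M * (norm (x - xbar))\<^sup>2"
proof -
  obtain r1 r2 r3 K1 K2 K3 where r: "r1 > 0" "r2 > 0" "r3 > 0"
    and K: "K1-lipschitz_on (ball xbar r1) f''" "K2-lipschitz_on (ball xbar r2) h''" "K3-lipschitz_on (ball xbar r3) g''"
    using lipschitz_second_deriv[OF f assms(1), of xbar] lipschitz_second_deriv[OF h assms(2), of xbar]
      lipschitz_second_deriv[OF g assms(3), of xbar] by metis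
  have K0: "0 \<le> K1" "0 \<le> K2" "0 \<le> K3" using K lipschitz_on_nonneg by auto
  define L where "L = K1 + K2 + K3"
  define m where "m = 1 + norm \<xi>bar + norm \<Gamma>bar"
  have "grad_rem x \<le> (2 * L * m) * (norm (x - xbar))\<^sup>2" if x: "norm (x - xbar) < min r1 (min r2 r3)" for x
  proof -
    have "grad_rem x \<le> (L * (2 * norm (x - xbar))) * m * norm (x - xbar)"
      unfolding m_def
    proof (rule grad_rem_bound)
      fix y assume y: "norm (y - xbar) \<le> norm (x - xbar)"
      have lip: "norm (\<phi> y - \<phi> x) \<le> L * (2 * norm (x - xbar))"
        if "k-lipschitz_on (ball xbar r) \<phi>" "k \<le> L" "min r1 (min r2 r3) \<le> r"
        for \<phi> :: "'x \<Rightarrow> 'c::real_normed_vector" and k r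
      proof -
        have "norm (x - xbar) < r" "norm (y - xbar) < r"
          using that(3) x y by linarith+
        then have "y \<in> ball xbar r" "x \<in> ball xbar r"
          by (simp_all add: dist_norm norm_minus_commute)
        then have "norm (\<phi> y - \<phi> x) \<le> k * norm (y - x)"
          using lipschitz_onD[OF that(1), of y x] by (simp add: dist_norm)
        also have "\<dots> \<le> L * (2 * norm (x - xbar))"
          using that(2) lipschitz_on_nonneg[OF that(1)] y norm_triangle_ineq4[of "y - xbar" "x - xbar"]
          by (intro mult_mono) auto
        finally show ?thesis .
      qed
      show "norm (f'' y - f'' x) \<le> L * (2 * norm (x - xbar)) \<and> norm (h'' y - h'' x) \<le> L * (2 * norm (x - xbar)) \<and>
        norm (g'' y - g'' x) \<le> L * (2 * norm (x - xbar))"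
        using K0 by (intro conjI lip[OF K(1)] lip[OF K(2)] lip[OF K(3)]) (auto simp: L_def)
    qed (use K0 in \<open>simp add: L_def\<close>)
    then show ?thesis by (simp add: power2_eq_square mult_ac)
  qed
  moreover have "0 \<le> 2 * L * m" using K0 by (simp add: L_def m_def)
  ultimately show ?thesis using r by (intro exI[of _ "min r1 (min r2 r3)"] conjI exI[of _ "2 * L * m"]) auto
qed

text \<open>Componentwise: the gradient is affine in the multipliers, so their increments leave only
  products with the increment of \<open>x\<close>; the equality constraint leaves a Taylor
  remainder; the last component combines a Taylor remainder of \<open>g\<close> with the
  second-order expansion of the projection.\<close>

lemma residual_estimate:
  "\<exists>r>0. \<exists>M\<ge>0. \<forall>Z\<in>corrected. norm (Z - Zbar) < r \<longrightarrow>
    norm (F Z - U Z (Z - Zbar)) \<le> grad_rem (fst Z) + M * (norm (Z - Zbar))\<^sup>2"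
proof -
  obtain rh Kh where rh: "rh > 0" "Kh \<ge> 0" and Kh: "\<And>x. norm (x - xbar) < rh \<Longrightarrow>
      norm (h'' x) \<le> Kh \<and> norm (h x - h xbar) \<le> Kh * norm (x - xbar) \<and>
      norm (h x - h xbar - h' x (x - xbar)) \<le> Kh * (norm (x - xbar))\<^sup>2"
    using second_derivs_local_bounds[OF h h'', of xbar] by blast
  obtain rg Kg where rg: "rg > 0" "Kg \<ge> 0" and Kg: "\<And>x. norm (x - xbar) < rg \<Longrightarrow>
      norm (g'' x) \<le> Kg \<and> norm (g x - g xbar) \<le> Kg * norm (x - xbar) \<and>
      norm (g x - g xbar - g' x (x - xbar)) \<le> Kg * (norm (x - xbar))\<^sup>2"
    using second_derivs_local_bounds[OF g g'', of xbar] by blast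
  define n where "n = real CARD('n)"
  define N where "N = n^3 / \<delta>"
  have "0 \<le> n" "0 \<le> N" using \<delta> by (simp_all add: n_def N_def)
  define M where "M = (Kh + Kg) + Kh + (Kg + N * (Kg + 1)\<^sup>2 + n\<^sup>2 * Kg)"
  have "norm (F Z - U Z (Z - Zbar)) \<le> grad_rem (fst Z) + M * (norm (Z - Zbar))\<^sup>2"
    if Zc: "Z \<in> corrected" and near: "norm (Z - Zbar) < min rh rg" for Z
  proof -
    obtain x \<xi> \<Gamma> where Z: "Z = (x, \<xi>, \<Gamma>)" by (metis surj_pair)
    define t where "t = norm (Z - Zbar)"
    have comp: "norm (x - xbar) \<le> t" "norm (\<xi> - \<xi>bar) \<le> t" "norm (\<Gamma> - \<Gamma>bar) \<le> t"
      using norm_components[where x=x and \<xi>=\<xi> and \<Gamma>=\<Gamma>] by (simp_all only: t_def Z)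
    have "0 \<le> t" by (simp add: t_def)
    have sq: "(norm (x - xbar))\<^sup>2 \<le> t\<^sup>2" using comp by (intro power_mono) auto
    have nx: "norm (x - xbar) < rh" "norm (x - xbar) < rg" using comp near by (auto simp: t_def)
    note h_b = Kh[OF nx(1)] and g_b = Kg[OF nx(2)]
    define R1 where "R1 = gradL \<xi> \<Gamma> x
      - (hessL \<xi> \<Gamma> x (x - xbar) + badj (h' x) (\<xi> - \<xi>bar) + badj (g' x) (\<Gamma> - \<Gamma>bar))"
    define R2 where "R2 = h x - h' x (x - xbar)"
    define R3 where "R3 = - g x + proj_psd (g x + \<Gamma>)
      - (- g' x (x - xbar) + V_op w (g x + \<Gamma>) (g' x (x - xbar) + (\<Gamma> - \<Gamma>bar)))"
    have FU: "F Z - U Z (Z - Zbar) = (R1, R2, R3)"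
      by (simp add: Z KKT_residual_eq U_op_eq R1_def R2_def R3_def)
    have bl: "norm (badj (T (x - xbar)) z) \<le> K * t\<^sup>2"
      if "norm T \<le> K" "norm z \<le> t" for T :: "'x \<Rightarrow>\<^sub>L 'x \<Rightarrow>\<^sub>L 'b::euclidean_space" and K z
    proof -
      have "0 \<le> K" using that(1) norm_ge_zero order_trans by blast
      then have "norm (T (x - xbar)) \<le> K * t"
        by (intro order_trans[OF norm_blinfun] mult_mono that comp) auto
      then have "norm (T (x - xbar)) * norm z \<le> K * t * t"
        using that \<open>0 \<le> t\<close> \<open>0 \<le> K\<close> by (intro mult_mono) auto
      then show ?thesis using norm_badj[of "T (x - xbar)" z] by (simp add: power2_eq_square)
    qed
    have tri: "norm (u - v - z) \<le> a + b + c" if "norm u \<le> a" "norm v \<le> b" "norm z \<le> c"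
      for u v z :: "'c::real_normed_vector" and a b c
      using norm_triangle_ineq4[of "u - v" z] norm_triangle_ineq4[of u v] that by linarith
    have R1: "norm R1 \<le> grad_rem x + (Kh + Kg) * t\<^sup>2"
    proof -
      have "R1 = (gradL \<xi>bar \<Gamma>bar x - gradL \<xi>bar \<Gamma>bar xbar - hessL \<xi>bar \<Gamma>bar x (x - xbar))
        - badj (h'' x (x - xbar)) (\<xi> - \<xi>bar) - badj (g'' x (x - xbar)) (\<Gamma> - \<Gamma>bar)"
        unfolding kktD(1) by (simp add: R1_def gradL_def hessL_def badj.diff_right algebra_simps)
      also have "norm \<dots> \<le> grad_rem x + Kh * t\<^sup>2 + Kg * t\<^sup>2"
        unfolding grad_rem_def using h_b g_b comp
        by (intro tri bl order_refl) auto
      finally show ?thesis by (simp add: algebra_simps)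
    qed
    have R2: "norm R2 \<le> Kh * t\<^sup>2"
    proof -
      have "norm R2 \<le> Kh * (norm (x - xbar))\<^sup>2" using h_b by (simp add: R2_def kktD(2))
      then show ?thesis using mult_left_mono[OF sq \<open>Kh \<ge> 0\<close>] by linarith
    qed
    have R3: "norm R3 \<le> (Kg + N * (Kg + 1)\<^sup>2 + n\<^sup>2 * Kg) * t\<^sup>2"
    proof -
      define r where "r = g x - g xbar - g' x (x - xbar)"
      define A where "A = g x + \<Gamma>"
      define a where "a = (g x + \<Gamma>) - (g xbar + \<Gamma>bar)"
      have r: "norm r \<le> Kg * t\<^sup>2"
        using g_b mult_left_mono[OF sq \<open>Kg \<ge> 0\<close>] by (simp add: r_def)
      have "norm (g x - g xbar) \<le> Kg * t"
        using g_b mult_left_mono[OF comp(1) \<open>Kg \<ge> 0\<close>] by linarith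
      then have "norm a \<le> (Kg + 1) * t"
        using norm_A_diff_le[of x \<Gamma>] comp by (simp add: a_def algebra_simps)
      then have a2: "(norm a)\<^sup>2 \<le> (Kg + 1)\<^sup>2 * t\<^sup>2"
        unfolding power_mult_distrib[symmetric] by (intro power_mono) auto
      have V: "linear (V_op w A)"
        using g_plus_sym[OF correctedD[OF Zc, unfolded Z]] linear_V_op by (simp add: A_def)
      \<comment> \<open>Passing from the linearised increment to the true one, \<open>a\<close>,
        costs the Taylor remainder \<open>r\<close>, which \<open>V_op\<close> enlarges at most by a
        constant factor.\<close>
      have "g' x (x - xbar) + (\<Gamma> - \<Gamma>bar) = a - r" by (simp add: a_def r_def)
      then have "R3 = - r - (V_op w A a - (proj_psd A - g xbar)) - (- V_op w A r)"
        by (simp add: R3_def A_def[symmetric] linear_diff[OF V]) (simp add: r_def)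
      also have "norm \<dots> \<le> Kg * t\<^sup>2 + N * ((Kg + 1)\<^sup>2 * t\<^sup>2) + n\<^sup>2 * (Kg * t\<^sup>2)"
      proof (rule tri)
        show "norm (- r) \<le> Kg * t\<^sup>2" using r by simp
        show "norm (V_op w A a - (proj_psd A - g xbar)) \<le> N * ((Kg + 1)\<^sup>2 * t\<^sup>2)"
          using V_op_near(3)[OF Zc[unfolded Z]] mult_left_mono[OF a2 \<open>0 \<le> N\<close>]
          unfolding A_def a_def N_def n_def by linarith
        show "norm (- V_op w A r) \<le> n\<^sup>2 * (Kg * t\<^sup>2)"
          using V_op_near(2)[OF Zc[unfolded Z], of r] mult_left_mono[OF r zero_le_power2[of n]]
          unfolding A_def n_def norm_minus_cancel by linarith
      qed
      finally show ?thesis by (simp add: algebra_simps)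
    qed
    have "norm (F Z - U Z (Z - Zbar)) \<le> norm R1 + (norm R2 + norm R3)"
      unfolding FU by (rule order_trans[OF norm_Pair_le add_left_mono[OF norm_Pair_le]])
    also have "\<dots> \<le> grad_rem x + M * t\<^sup>2"
      using R1 R2 R3 by (simp add: M_def algebra_simps)
    finally show ?thesis by (simp add: Z t_def)
  qed
  moreover have "0 \<le> M" using rh rg \<open>0 \<le> n\<close> \<open>0 \<le> N\<close> by (simp add: M_def)
  ultimately show ?thesis using rh rg by (intro exI[of _ "min rh rg"]) auto
qed

section \<open>Error estimates for a single step\<close>

definition newton_step :: "real \<Rightarrow> real \<Rightarrow> 'x \<times> (real^'m) \<times> 'n rmat \<Rightarrow> 'x \<times> (real^'m) \<times> 'n rmat \<Rightarrow> bool" where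
  "newton_step \<eta> \<tau> Z d \<longleftrightarrow> d \<in> Zspace \<and> norm (U Z d + F Z) \<le> min \<eta> (norm (F Z) powr \<tau>) * norm (F Z)"

text \<open>Applying the operator to the new error leaves the inexactness minus the linearisation
  error, and the uniform lower bound inverts this. The inexactness is of order
  \<open>t powr \<tau> * t\<close> for the distance \<open>t\<close>, because the residual is at
  most of order \<open>t\<close>.\<close>

lemma newton_estimate:
  assumes inj: "\<And>d. d \<in> Zspace \<Longrightarrow> U Zbar d = 0 \<Longrightarrow> d = 0" and "0 < \<tau>"
  shows "\<exists>r>0. \<exists>C\<ge>0. \<forall>Z\<in>corrected. norm (Z - Zbar) < r \<longrightarrow>
    nonsingular_on Zspace (U Z) \<and>
    (\<forall>\<eta> d. newton_step \<eta> \<tau> Z d \<longrightarrow> norm (Z + d - Zbar) \<le>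
       C * (grad_rem (fst Z) + (norm (Z - Zbar))\<^sup>2 + norm (Z - Zbar) powr \<tau> * norm (Z - Zbar)))"
proof -
  obtain r1 c K where "r1 > 0" "c > 0" "K \<ge> 0" and UB: "\<And>Z d. Z \<in> corrected \<Longrightarrow> norm (Z - Zbar) < r1 \<Longrightarrow> d \<in> Zspace \<Longrightarrow>
     c * norm d \<le> norm (U Z d) \<and> norm (U Z d) \<le> K * norm d"
    using U_bounds[OF inj] by blast
  obtain r2 M where "r2 > 0" "M \<ge> 0" and RE: "\<And>Z. Z \<in> corrected \<Longrightarrow> norm (Z - Zbar) < r2 \<Longrightarrow>
     norm (F Z - U Z (Z - Zbar)) \<le> grad_rem (fst Z) + M * (norm (Z - Zbar))\<^sup>2"
    using residual_estimate by blast
  obtain r3 where "r3 > 0" and GR: "\<And>x. norm (x - xbar) < r3 \<Longrightarrow> grad_rem x \<le> 1 * norm (x - xbar)"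
    using grad_rem_small[of 1] by auto
  define r where "r = min 1 (min r1 (min r2 r3))"
  \<comment> \<open>Bound for the residual relative to the distance \<open>t\<close>:
    \<open>K\<close> from the operator, 1 from \<open>grad_rem\<close>, and \<open>M\<close> from
    the quadratic term, where \<open>t\<close> below 1 allows replacing the square of
    \<open>t\<close> by \<open>t\<close>.\<close>
  define L where "L = K + 1 + M"
  have "0 \<le> L" using \<open>K \<ge> 0\<close> \<open>M \<ge> 0\<close> by (simp add: L_def)
  define C where "C = (1 + M + L powr \<tau> * L) / c"
  have main: "nonsingular_on Zspace (U Z) \<and>
    (\<forall>\<eta> d. newton_step \<eta> \<tau> Z d \<longrightarrow> norm (Z + d - Zbar) \<le>
       C * (grad_rem (fst Z) + (norm (Z - Zbar))\<^sup>2 + norm (Z - Zbar) powr \<tau> * norm (Z - Zbar)))"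
    if Z: "Z \<in> corrected" and near: "norm (Z - Zbar) < r" for Z
  proof (intro conjI allI impI)
    define t where "t = norm (Z - Zbar)"
    have t: "0 \<le> t" "t < 1" "t < r1" "t < r2" "t < r3" using near by (auto simp: t_def r_def)
    note ZZ = correctedD[OF Z]
    note UBZ = UB[OF Z t(3)[unfolded t_def]] and REZ = RE[OF Z t(4)[unfolded t_def], folded t_def]
    show "nonsingular_on Zspace (U Z)"
    proof (rule nonsingular_U_op[OF ZZ])
      fix d assume "d \<in> Zspace" "U Z d = 0"
      then have "c * norm d \<le> 0" using UBZ[of d] by simp
      then show "d = 0" using \<open>c > 0\<close> by (simp add: mult_le_0_iff)
    qed
    fix \<eta> d assume step: "newton_step \<eta> \<tau> Z d"
    have ZD: "Z - Zbar \<in> Zspace" by (rule subspace_diff[OF subspace_Zspace ZZ Zbar_Zspace])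
    have "fst Z - xbar = fst (Z - Zbar)" by simp
    then have fx: "norm (fst Z - xbar) \<le> t"
      unfolding t_def by (metis norm_fst_le prod.collapse)
    then have gr: "grad_rem (fst Z) \<le> t" using GR[of "fst Z"] t by simp
    have gr0: "0 \<le> grad_rem (fst Z)" by (simp add: grad_rem_def)
    have "t\<^sup>2 \<le> t" using t by (simp add: power2_eq_square mult_left_le)
    have FL: "norm (F Z) \<le> L * t"
    proof -
      have "norm (F Z) \<le> norm (F Z - U Z (Z - Zbar)) + norm (U Z (Z - Zbar))"
        using norm_triangle_sub[of "F Z" "U Z (Z - Zbar)"] by simp
      also have "\<dots> \<le> (t + M * t) + K * t"
        using REZ gr UBZ[OF ZD] mult_left_mono[OF \<open>t\<^sup>2 \<le> t\<close> \<open>M \<ge> 0\<close>] by (simp add: t_def)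
      finally show ?thesis by (simp add: L_def algebra_simps)
    qed
    have inexact: "norm (U Z d + F Z) \<le> L powr \<tau> * L * (t powr \<tau> * t)"
    proof -
      have "norm (U Z d + F Z) \<le> norm (F Z) powr \<tau> * norm (F Z)"
        using step unfolding newton_step_def
        by (meson min.cobounded2 mult_right_mono norm_ge_zero order_trans)
      also have "\<dots> \<le> (L * t) powr \<tau> * (L * t)"
        using FL \<open>0 < \<tau>\<close> by (intro mult_mono powr_mono2) auto
      also have "\<dots> = L powr \<tau> * L * (t powr \<tau> * t)"
        using \<open>0 \<le> L\<close> t by (simp add: powr_mult)
      finally show ?thesis .
    qed
    have dZ: "d \<in> Zspace" using step by (simp add: newton_step_def)
    have eq: "U Z (Z - Zbar + d) = (U Z d + F Z) - (F Z - U Z (Z - Zbar))"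
      by (simp add: linear_add[OF linear_U_op[OF ZZ]])
    have sd: "Z - Zbar + d \<in> Zspace" by (rule subspace_add[OF subspace_Zspace ZD dZ])
    have "c * norm (Z - Zbar + d) \<le> norm (U Z d + F Z) + norm (F Z - U Z (Z - Zbar))"
      using UBZ[OF sd] norm_triangle_ineq4[of "U Z d + F Z" "F Z - U Z (Z - Zbar)"] by (simp only: eq) linarith
    also have "\<dots> \<le> L powr \<tau> * L * (t powr \<tau> * t) + (grad_rem (fst Z) + M * t\<^sup>2)"
      using inexact REZ by simp
    also have "\<dots> \<le> (1 + M + L powr \<tau> * L) * (grad_rem (fst Z) + t\<^sup>2 + t powr \<tau> * t)"
    proof -
      have "0 \<le> (M + L powr \<tau> * L) * grad_rem (fst Z) + (1 + L powr \<tau> * L) * t\<^sup>2 + (1 + M) * (t powr \<tau> * t)"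
        using gr0 \<open>M \<ge> 0\<close> \<open>0 \<le> L\<close> t by (intro add_nonneg_nonneg mult_nonneg_nonneg) auto
      then show ?thesis by (simp add: algebra_simps)
    qed
    finally have "norm (Z - Zbar + d) \<le> C * (grad_rem (fst Z) + t\<^sup>2 + t powr \<tau> * t)"
      using \<open>c > 0\<close> by (simp add: C_def pos_le_divide_eq mult.commute)
    then show "norm (Z + d - Zbar) \<le> C * (grad_rem (fst Z) + (norm (Z - Zbar))\<^sup>2 + norm (Z - Zbar) powr \<tau> * norm (Z - Zbar))"
      unfolding t_def by (simp only: diff_add_eq)
  qed
  have "0 \<le> C" using \<open>c > 0\<close> \<open>M \<ge> 0\<close> \<open>0 \<le> L\<close> by (simp add: C_def)
  moreover have "0 < r" using \<open>r1 > 0\<close> \<open>r2 > 0\<close> \<open>r3 > 0\<close> by (simp add: r_def)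
  ultimately show ?thesis using main by blast
qed

lemma corrected_step:
  assumes inj: "\<And>d. d \<in> Zspace \<Longrightarrow> U Zbar d = 0 \<Longrightarrow> d = 0" and "0 < \<tau>"
  shows "\<exists>r>0. \<exists>C\<ge>0. \<forall>Z\<in>corrected. norm (Z - Zbar) < r \<longrightarrow>
    nonsingular_on Zspace (U Z) \<and>
    (\<forall>\<eta> d. newton_step \<eta> \<tau> Z d \<longrightarrow> correction g \<delta> (Z + d) \<in> corrected \<and>
       norm (correction g \<delta> (Z + d) - Zbar) \<le>
       C * (grad_rem (fst Z) + (norm (Z - Zbar))\<^sup>2 + norm (Z - Zbar) powr \<tau> * norm (Z - Zbar)))"
proof -
  obtain r1 C1 where "r1 > 0" "C1 \<ge> 0" and NE: "\<And>Z. Z \<in> corrected \<Longrightarrow> norm (Z - Zbar) < r1 \<Longrightarrow>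
    nonsingular_on Zspace (U Z) \<and>
    (\<forall>\<eta> d. newton_step \<eta> \<tau> Z d \<longrightarrow> norm (Z + d - Zbar) \<le>
       C1 * (grad_rem (fst Z) + (norm (Z - Zbar))\<^sup>2 + norm (Z - Zbar) powr \<tau> * norm (Z - Zbar)))"
    using newton_estimate[OF assms] by blast
  obtain r2 C2 where "r2 > 0" "C2 \<ge> 0" and CC: "\<And>Z. Z \<in> Zspace \<Longrightarrow> norm (Z - Zbar) < r2 \<Longrightarrow>
     norm (correction g \<delta> Z - Zbar) \<le> C2 * norm (Z - Zbar)"
    using correction_close by blast
  obtain r3 where "r3 > 0" and GR: "\<And>x. norm (x - xbar) < r3 \<Longrightarrow> grad_rem x \<le> 1 * norm (x - xbar)"
    using grad_rem_small[of 1] by auto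
  \<comment> \<open>The three error terms are each at most \<open>t\<close>, so the uncorrected new
    point has distance at most \<open>3 * C1 * t\<close>. The radius keeps this below
    \<open>r2\<close>, where the bound on the correction applies; the added 1 avoids division by
    0.\<close>
  define r where "r = min (min 1 (r2 / (3 * C1 + 1))) (min r1 r3)"
  have r: "0 < r" using \<open>r1 > 0\<close> \<open>r2 > 0\<close> \<open>r3 > 0\<close> \<open>C1 \<ge> 0\<close> by (simp add: r_def)
  have "nonsingular_on Zspace (U Z) \<and>
    (\<forall>\<eta> d. newton_step \<eta> \<tau> Z d \<longrightarrow> correction g \<delta> (Z + d) \<in> corrected \<and>
       norm (correction g \<delta> (Z + d) - Zbar) \<le>
       (C2 * C1) * (grad_rem (fst Z) + (norm (Z - Zbar))\<^sup>2 + norm (Z - Zbar) powr \<tau> * norm (Z - Zbar)))"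
    if Z: "Z \<in> corrected" and near: "norm (Z - Zbar) < r" for Z
  proof (intro conjI allI impI)
    define t where "t = norm (Z - Zbar)"
    have t: "0 \<le> t" "t < 1" "t < r1" "t < r2 / (3 * C1 + 1)" "t < r3" using near by (auto simp: t_def r_def)
    note ne = NE[OF Z t(3)[unfolded t_def], folded t_def]
    then show "nonsingular_on Zspace (U Z)" by blast
    fix \<eta> d assume step: "newton_step \<eta> \<tau> Z d"
    have Zd: "Z + d \<in> Zspace"
      using step correctedD[OF Z] by (auto simp: newton_step_def intro: subspace_add[OF subspace_Zspace])
    then show "correction g \<delta> (Z + d) \<in> corrected" by (rule correction_corrected)
    define E where "E = grad_rem (fst Z) + t\<^sup>2 + t powr \<tau> * t"
    have est: "norm (Z + d - Zbar) \<le> C1 * E" using ne step unfolding E_def by blast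
    have "fst Z - xbar = fst (Z - Zbar)" by simp
    then have fx: "norm (fst Z - xbar) \<le> t"
      unfolding t_def by (metis norm_fst_le prod.collapse)
    then have "grad_rem (fst Z) \<le> t" using GR[of "fst Z"] t by simp
    moreover have "t\<^sup>2 \<le> t" using t by (simp add: power2_eq_square mult_left_le)
    moreover have "t powr \<tau> * t \<le> t"
      using t \<open>0 < \<tau>\<close> powr_mono2[of \<tau> t 1] by (intro mult_left_le_one_le) auto
    ultimately have "E \<le> 3 * t" by (simp add: E_def)
    then have "C1 * E \<le> C1 * (3 * t)" using \<open>C1 \<ge> 0\<close> by (rule mult_left_mono)
    also have "\<dots> \<le> (3 * C1 + 1) * t" using t by (simp add: algebra_simps)
    also have "\<dots> < r2" using t(4) \<open>C1 \<ge> 0\<close> by (simp add: pos_less_divide_eq mult.commute)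
    finally have "norm (Z + d - Zbar) < r2" using est by simp
    from CC[OF Zd this] have "norm (correction g \<delta> (Z + d) - Zbar) \<le> C2 * (C1 * E)"
      using mult_left_mono[OF est \<open>C2 \<ge> 0\<close>] by simp
    then show "norm (correction g \<delta> (Z + d) - Zbar) \<le>
       (C2 * C1) * (grad_rem (fst Z) + (norm (Z - Zbar))\<^sup>2 + norm (Z - Zbar) powr \<tau> * norm (Z - Zbar))"
      by (simp add: E_def t_def mult.assoc)
  qed
  moreover have "0 \<le> C2 * C1" using \<open>C1 \<ge> 0\<close> \<open>C2 \<ge> 0\<close> by simp
  ultimately show ?thesis using r by blast
qed

lemma superlinear_step:
  assumes inj: "\<And>d. d \<in> Zspace \<Longrightarrow> U Zbar d = 0 \<Longrightarrow> d = 0" and "0 < \<tau>" and "0 < \<epsilon>"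
  shows "\<exists>r>0. \<forall>Z\<in>corrected. norm (Z - Zbar) < r \<longrightarrow> nonsingular_on Zspace (U Z) \<and>
    (\<forall>\<eta> d. newton_step \<eta> \<tau> Z d \<longrightarrow> correction g \<delta> (Z + d) \<in> corrected \<and>
       norm (correction g \<delta> (Z + d) - Zbar) \<le> \<epsilon> * norm (Z - Zbar))"
proof -
  obtain r1 C where "r1 > 0" "C \<ge> 0" and CS: "\<And>Z. Z \<in> corrected \<Longrightarrow> norm (Z - Zbar) < r1 \<Longrightarrow>
    nonsingular_on Zspace (U Z) \<and>
    (\<forall>\<eta> d. newton_step \<eta> \<tau> Z d \<longrightarrow> correction g \<delta> (Z + d) \<in> corrected \<and>
       norm (correction g \<delta> (Z + d) - Zbar) \<le>
       C * (grad_rem (fst Z) + (norm (Z - Zbar))\<^sup>2 + norm (Z - Zbar) powr \<tau> * norm (Z - Zbar)))"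
    using corrected_step[OF assms(1,2)] by blast
  \<comment> \<open>Each of the three error terms will be at most \<open>e * t\<close>; hence the 3,
    while \<open>C + 1\<close> keeps the denominator positive.\<close>
  define e where "e = \<epsilon> / (3 * (C + 1))"
  have "0 < e" using \<open>0 < \<epsilon>\<close> \<open>C \<ge> 0\<close> by (simp add: e_def)
  obtain r2 where "r2 > 0" and GR: "\<And>x. norm (x - xbar) < r2 \<Longrightarrow> grad_rem x \<le> e * norm (x - xbar)"
    using grad_rem_small[OF \<open>0 < e\<close>] by auto
  \<comment> \<open>The last two bounds on \<open>t\<close> treat the quadratic term and the
    inexactness: \<open>t \<le> e\<close> and \<open>t powr \<tau> \<le> e\<close>.\<close>
  define r where "r = min (min r1 r2) (min e (e powr (1 / \<tau>)))"
  have "0 < r" using \<open>r1 > 0\<close> \<open>r2 > 0\<close> \<open>0 < e\<close> by (simp add: r_def)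
  have "norm (correction g \<delta> (Z + d) - Zbar) \<le> \<epsilon> * norm (Z - Zbar)"
    if Z: "Z \<in> corrected" and near: "norm (Z - Zbar) < r" and step: "newton_step \<eta> \<tau> Z d" for Z \<eta> d
  proof -
    define t where "t = norm (Z - Zbar)"
    have t: "0 \<le> t" "t < r1" "t < r2" "t < e" "t < e powr (1 / \<tau>)" using near by (auto simp: t_def r_def)
    have "fst Z - xbar = fst (Z - Zbar)" by simp
    then have fx: "norm (fst Z - xbar) \<le> t"
      unfolding t_def by (metis norm_fst_le prod.collapse)
    have "grad_rem (fst Z) \<le> e * norm (fst Z - xbar)"
      using fx t by (intro GR) simp
    also have "\<dots> \<le> e * t"
      using fx \<open>0 < e\<close> by (intro mult_left_mono) auto
    finally have "grad_rem (fst Z) \<le> e * t" .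
    moreover have "t\<^sup>2 \<le> e * t" using t by (simp add: power2_eq_square mult_right_mono)
    moreover have "t powr \<tau> * t \<le> e * t"
    proof (rule mult_right_mono)
      have "t powr \<tau> \<le> (e powr (1 / \<tau>)) powr \<tau>" using t \<open>0 < \<tau>\<close> by (intro powr_mono2) auto
      then show "t powr \<tau> \<le> e" using \<open>0 < e\<close> \<open>0 < \<tau>\<close> by (simp add: powr_powr)
    qed (use t in simp)
    ultimately have "grad_rem (fst Z) + t\<^sup>2 + t powr \<tau> * t \<le> 3 * e * t" by simp
    then have "C * (grad_rem (fst Z) + t\<^sup>2 + t powr \<tau> * t) \<le> C * (3 * e * t)"
      using \<open>C \<ge> 0\<close> by (rule mult_left_mono)
    also have "\<dots> \<le> (C + 1) * (3 * e * t)" using t \<open>0 < e\<close> by (intro mult_right_mono) auto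
    also have "\<dots> = \<epsilon> * t" using \<open>C \<ge> 0\<close> by (simp add: e_def field_simps)
    finally have *: "C * (grad_rem (fst Z) + t\<^sup>2 + t powr \<tau> * t) \<le> \<epsilon> * t" .
    have "norm (correction g \<delta> (Z + d) - Zbar) \<le> C * (grad_rem (fst Z) + t\<^sup>2 + t powr \<tau> * t)"
      using CS[OF Z t(2)[unfolded t_def]] step unfolding t_def by blast
    then show ?thesis using * by (simp add: t_def)
  qed
  moreover have "r \<le> r1" by (simp add: r_def)
  ultimately show ?thesis using CS \<open>0 < r\<close> by (intro exI[of _ r]) (meson less_le_trans)
qed

lemma quadratic_step:
  assumes inj: "\<And>d. d \<in> Zspace \<Longrightarrow> U Zbar d = 0 \<Longrightarrow> d = 0"
    and "twice_lipschitz_diff f" "twice_lipschitz_diff h" "twice_lipschitz_diff g"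
  shows "\<exists>r>0. \<exists>M. \<forall>Z\<in>corrected. norm (Z - Zbar) < r \<longrightarrow>
    (\<forall>\<eta> d. newton_step \<eta> 1 Z d \<longrightarrow> norm (correction g \<delta> (Z + d) - Zbar) \<le> M * (norm (Z - Zbar))\<^sup>2)"
proof -
  obtain r1 C where "r1 > 0" "C \<ge> 0" and CS: "\<And>Z. Z \<in> corrected \<Longrightarrow> norm (Z - Zbar) < r1 \<Longrightarrow>
    (\<forall>\<eta> d. newton_step \<eta> 1 Z d \<longrightarrow> norm (correction g \<delta> (Z + d) - Zbar) \<le>
       C * (grad_rem (fst Z) + (norm (Z - Zbar))\<^sup>2 + norm (Z - Zbar) powr 1 * norm (Z - Zbar)))"
    using corrected_step[OF assms(1), of 1] by (metis zero_less_one)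
  obtain r2 M where "r2 > 0" "M \<ge> 0" and GR: "\<And>x. norm (x - xbar) < r2 \<Longrightarrow> grad_rem x \<le> M * (norm (x - xbar))\<^sup>2"
    using grad_rem_quadratic[OF assms(2-4)] by blast
  have "norm (correction g \<delta> (Z + d) - Zbar) \<le> (C * (M + 2)) * (norm (Z - Zbar))\<^sup>2"
    if Z: "Z \<in> corrected" and near: "norm (Z - Zbar) < min r1 r2" and step: "newton_step \<eta> 1 Z d" for Z \<eta> d
  proof -
    define t where "t = norm (Z - Zbar)"
    have t: "0 \<le> t" "t < r1" "t < r2" using near by (auto simp: t_def)
    have "fst Z - xbar = fst (Z - Zbar)" by simp
    then have fx: "norm (fst Z - xbar) \<le> t"
      unfolding t_def by (metis norm_fst_le prod.collapse)
    then have "(norm (fst Z - xbar))\<^sup>2 \<le> t\<^sup>2" by (intro power_mono) auto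
    then have "M * (norm (fst Z - xbar))\<^sup>2 \<le> M * t\<^sup>2" using \<open>0 \<le> M\<close> by (rule mult_left_mono)
    moreover have "grad_rem (fst Z) \<le> M * (norm (fst Z - xbar))\<^sup>2" using fx t by (intro GR) simp
    \<comment> \<open>For exponent 1 the inexactness term is another square, hence
      \<open>M + 2\<close>.\<close>
    ultimately have "grad_rem (fst Z) + t\<^sup>2 + t powr 1 * t \<le> (M + 2) * t\<^sup>2"
      using t by (simp add: power2_eq_square algebra_simps)
    then have "C * (grad_rem (fst Z) + t\<^sup>2 + t powr 1 * t) \<le> C * ((M + 2) * t\<^sup>2)"
      using \<open>C \<ge> 0\<close> by (rule mult_left_mono)
    moreover have "norm (correction g \<delta> (Z + d) - Zbar) \<le> C * (grad_rem (fst Z) + t\<^sup>2 + t powr 1 * t)"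
      using CS[OF Z t(2)[unfolded t_def]] step unfolding t_def by blast
    ultimately show ?thesis by (simp add: t_def mult.assoc)
  qed
  moreover have "0 < min r1 r2" using \<open>r1 > 0\<close> \<open>r2 > 0\<close> by simp
  ultimately show ?thesis by blast
qed

section \<open>Convergence\<close>

lemma newton_steps_step:
  assumes "newton_steps f h g U \<delta> \<eta> \<tau> Zhat0 Z d K" "k < K"
  shows "newton_step \<eta> \<tau> (Z k) (d k)" "Z (Suc k) = correction g \<delta> (Z k + d k)"
  using assms by (auto simp: newton_steps_def newton_step_def)

theorem local_convergence:
  assumes inj: "\<And>d. d \<in> Zspace \<Longrightarrow> U Zbar d = 0 \<Longrightarrow> d = 0" and "0 < \<tau>"
  shows "\<exists>\<eta>bar>0. \<exists>\<epsilon>>0. \<forall>Zhat0 \<in> Zspace \<inter> ball Zbar \<epsilon>. \<forall>\<eta>. 0 \<le> \<eta> \<and> \<eta> \<le> \<eta>bar \<longrightarrow>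
      newton_well_defined f h g U \<delta> \<eta> \<tau> Zhat0 \<and>
      (\<forall>Z. newton_sequence f h g U \<delta> \<eta> \<tau> Zhat0 Z \<longrightarrow>
         superlinear_conv Z Zbar \<and>
         (twice_lipschitz_diff f \<and> twice_lipschitz_diff g \<and> twice_lipschitz_diff h \<and> \<tau> = 1
            \<longrightarrow> quadratic_conv Z Zbar))"
proof -
  \<comment> \<open>A fixed contraction factor below 1 keeps the iterates in the ball and proves
    convergence; the superlinear rate is obtained afterwards by using the same step estimate with
    arbitrarily small factors.\<close>
  have "(0::real) < 1 / 2" by simp
  from superlinear_step[OF assms this] obtain r where "r > 0"
    and ns: "\<And>Z. Z \<in> corrected \<Longrightarrow> norm (Z - Zbar) < r \<Longrightarrow> nonsingular_on Zspace (U Z)"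
    and st: "\<And>Z \<eta> d. Z \<in> corrected \<Longrightarrow> norm (Z - Zbar) < r \<Longrightarrow> newton_step \<eta> \<tau> Z d \<Longrightarrow>
      correction g \<delta> (Z + d) \<in> corrected \<and> norm (correction g \<delta> (Z + d) - Zbar) \<le> 1 / 2 * norm (Z - Zbar)"
    by blast
  obtain r0 C where "r0 > 0" "C \<ge> 0" and CC: "\<And>Z. Z \<in> Zspace \<Longrightarrow> norm (Z - Zbar) < r0 \<Longrightarrow>
     norm (correction g \<delta> Z - Zbar) \<le> C * norm (Z - Zbar)"
    using correction_close by blast
  \<comment> \<open>The start is itself corrected and may move away by the factor \<open>C\<close>;
    the radius ensures that the first iterate still lies in the contraction ball.\<close>
  define \<epsilon> where "\<epsilon> = min r0 (r / (C + 1))"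
  have "0 < \<epsilon>" using \<open>r > 0\<close> \<open>r0 > 0\<close> \<open>C \<ge> 0\<close> by (simp add: \<epsilon>_def)
  \<comment> \<open>Formulated for runs of finite length, since well-definedness speaks about every
    reachable iterate without presupposing an infinite sequence.\<close>
  have iter: "Z k \<in> corrected \<and> norm (Z k - Zbar) \<le> (1 / 2) ^ k * norm (Z 0 - Zbar) \<and> norm (Z k - Zbar) < r"
    if Zh: "Zhat0 \<in> Zspace \<inter> ball Zbar \<epsilon>" and steps: "newton_steps f h g U \<delta> \<eta> \<tau> Zhat0 Z d K" and "k \<le> K"
    for Zhat0 Z d K \<eta> k
    using \<open>k \<le> K\<close>
  proof (induction k)
    case 0
    have Z0: "Z 0 = correction g \<delta> Zhat0" using steps by (simp add: newton_steps_def)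
    have n: "norm (Zhat0 - Zbar) < \<epsilon>" using Zh by (simp add: dist_norm norm_minus_commute)
    then have "norm (Z 0 - Zbar) \<le> C * norm (Zhat0 - Zbar)"
      using Zh CC[of Zhat0] by (simp add: Z0 \<epsilon>_def)
    also have "\<dots> \<le> (C + 1) * norm (Zhat0 - Zbar)" by (intro mult_right_mono) auto
    also have "\<dots> < r" using n \<open>C \<ge> 0\<close> by (simp add: \<epsilon>_def pos_less_divide_eq mult.commute)
    finally show ?case using correction_corrected[of Zhat0] Zh by (simp add: Z0)
  next
    case (Suc k)
    then have IH: "Z k \<in> corrected" "norm (Z k - Zbar) \<le> (1 / 2) ^ k * norm (Z 0 - Zbar)" "norm (Z k - Zbar) < r"
      and "k < K" by auto
    note s = newton_steps_step[OF steps \<open>k < K\<close>]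
    have *: "Z (Suc k) \<in> corrected" "norm (Z (Suc k) - Zbar) \<le> 1 / 2 * norm (Z k - Zbar)"
      using st[OF IH(1,3) s(1)] by (simp_all add: s(2))
    then have "norm (Z (Suc k) - Zbar) < r"
      using IH(3) norm_ge_zero[of "Z k - Zbar"] by linarith
    then show ?case using IH * by simp
  qed
  have wd: "newton_well_defined f h g U \<delta> \<eta> \<tau> Zhat0" if "Zhat0 \<in> Zspace \<inter> ball Zbar \<epsilon>" for Zhat0 \<eta>
    unfolding newton_well_defined_def using iter[OF that] ns by blast
  have conv: "superlinear_conv Z Zbar \<and>
         (twice_lipschitz_diff f \<and> twice_lipschitz_diff g \<and> twice_lipschitz_diff h \<and> \<tau> = 1
            \<longrightarrow> quadratic_conv Z Zbar)"
    if Zh: "Zhat0 \<in> Zspace \<inter> ball Zbar \<epsilon>" and seq: "newton_sequence f h g U \<delta> \<eta> \<tau> Zhat0 Z" for Zhat0 \<eta> Z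
  proof -
    obtain d where steps: "\<And>K. newton_steps f h g U \<delta> \<eta> \<tau> Zhat0 Z d K"
      using seq by (auto simp: newton_sequence_def)
    have it: "Z k \<in> corrected" "norm (Z k - Zbar) \<le> (1 / 2) ^ k * norm (Z 0 - Zbar)" for k
      using iter[OF Zh steps order_refl, of k] by auto
    have step: "newton_step \<eta> \<tau> (Z k) (d k)" "Z (Suc k) = correction g \<delta> (Z k + d k)" for k
      using newton_steps_step[OF steps lessI] by auto
    have "(\<lambda>k. (1 / 2) ^ k * norm (Z 0 - Zbar)) \<longlonglongrightarrow> 0 * norm (Z 0 - Zbar)"
      by (intro tendsto_mult LIMSEQ_realpow_zero tendsto_const) auto
    then have "(\<lambda>k. (1 / 2) ^ k * norm (Z 0 - Zbar)) \<longlonglongrightarrow> 0" by simp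
    then have "(\<lambda>k. Z k - Zbar) \<longlonglongrightarrow> 0"
      by (rule Lim_null_comparison[rotated]) (simp add: it)
    then have lim: "Z \<longlonglongrightarrow> Zbar" by (rule LIM_zero_cancel)
    have near: "eventually (\<lambda>k. norm (Z k - Zbar) < r) sequentially" if "0 < r" for r
      using tendstoD[OF lim that] by (simp add: dist_norm)
    have "(\<lambda>k. norm (Z (Suc k) - Zbar)) \<in> o(\<lambda>k. norm (Z k - Zbar))"
    proof (rule landau_o.smallI)
      fix c :: real assume "0 < c"
      obtain r where "r > 0" and "\<And>Z \<eta> d. Z \<in> corrected \<Longrightarrow> norm (Z - Zbar) < r \<Longrightarrow> newton_step \<eta> \<tau> Z d \<Longrightarrow>
          norm (correction g \<delta> (Z + d) - Zbar) \<le> c * norm (Z - Zbar)"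
        using superlinear_step[OF assms \<open>0 < c\<close>] by blast
      note small = this(2)
      show "eventually (\<lambda>k. norm (norm (Z (Suc k) - Zbar)) \<le> c * norm (norm (Z k - Zbar))) sequentially"
        using near[OF \<open>r > 0\<close>]
      proof eventually_elim
        case (elim k)
        then show ?case using small[OF it(1) elim step(1)] by (simp add: step(2))
      qed
    qed
    then have "superlinear_conv Z Zbar" using lim by (simp add: superlinear_conv_def)
    moreover have "quadratic_conv Z Zbar"
      if L: "twice_lipschitz_diff f \<and> twice_lipschitz_diff g \<and> twice_lipschitz_diff h \<and> \<tau> = 1"
    proof -
      obtain r M where "r > 0" and qs: "\<And>Z \<eta> d. Z \<in> corrected \<Longrightarrow> norm (Z - Zbar) < r \<Longrightarrow> newton_step \<eta> 1 Z d \<Longrightarrow>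
          norm (correction g \<delta> (Z + d) - Zbar) \<le> M * (norm (Z - Zbar))\<^sup>2"
        using quadratic_step[OF inj] L by blast
      have "eventually (\<lambda>k. norm (norm (Z (Suc k) - Zbar)) \<le> M * norm ((norm (Z k - Zbar))\<^sup>2)) sequentially"
        using near[OF \<open>r > 0\<close>]
      proof eventually_elim
        case (elim k)
        then show ?case using qs[OF it(1) elim, of \<eta> "d k"] step L by simp
      qed
      then have "(\<lambda>k. norm (Z (Suc k) - Zbar)) \<in> O(\<lambda>k. (norm (Z k - Zbar))\<^sup>2)"
        by (rule bigoI)
      then show ?thesis using lim by (simp add: quadratic_conv_def)
    qed
    ultimately show ?thesis by blast
  qed
  \<comment> \<open>The bound 1 for \<open>\<eta>\<close> is an arbitrary positive choice, as the
    step estimates hold uniformly in \<open>\<eta>\<close>.\<close>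
  show ?thesis
    using \<open>0 < \<epsilon>\<close> wd conv by (intro exI[of _ 1] conjI exI[of _ \<epsilon>] ballI allI impI) auto
qed

end

section \<open>The two methods as instances of the local convergence theorem\<close>

theorem theorem2:
  fixes f :: "'x::euclidean_space \<Rightarrow> real"
    and h :: "'x \<Rightarrow> real^'m"
    and g :: "'x \<Rightarrow> 'n::{finite,linorder} rmat"
    and xbar :: 'x and \<xi>bar :: "real^'m" and \<Gamma>bar :: "'n rmat"
    and Pbar :: "'n rmat" and lbar :: "'n rvec"
    and \<delta> \<tau> :: real
  assumes "Zbar = (xbar, \<xi>bar, \<Gamma>bar)"
    and "twice_cont_diff f" and "twice_cont_diff h" and "twice_cont_diff g"
    and "\<And>x. g x \<in> sym_mats"
    and "stationary_point f h g xbar"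
    and "(\<xi>bar, \<Gamma>bar) \<in> multipliers f h g xbar"
    and "ordered_eigen_decomp (g xbar + \<Gamma>bar) Pbar lbar"
    and "0 < \<delta>" and "\<forall>i \<in> pos_idx lbar \<union> neg_idx lbar. \<delta> < \<bar>lbar $ i\<bar>"
    and "0 < \<tau>" and "\<tau> \<le> 1"
  shows "(W_SOC f h g Zbar Pbar lbar \<and> constraint_nondegeneracy h g xbar Pbar lbar \<longrightarrow>
           (\<exists>\<eta>bar>0. \<exists>\<epsilon>>0. \<forall>Zhat0 \<in> Zspace \<inter> ball Zbar \<epsilon>. \<forall>\<eta>. 0 \<le> \<eta> \<and> \<eta> \<le> \<eta>bar \<longrightarrow>
              newton_well_defined f h g (U_zero f h g) \<delta> \<eta> \<tau> Zhat0 \<and>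
              (\<forall>Z. newton_sequence f h g (U_zero f h g) \<delta> \<eta> \<tau> Zhat0 Z \<longrightarrow>
                 superlinear_conv Z Zbar \<and>
                 (twice_lipschitz_diff f \<and> twice_lipschitz_diff g \<and> twice_lipschitz_diff h \<and> \<tau> = 1
                    \<longrightarrow> quadratic_conv Z Zbar)))) \<and>
         (S_SOSC f h g Zbar Pbar lbar \<and> W_SRCQ h g xbar Pbar lbar \<longrightarrow>
           (\<exists>\<eta>bar>0. \<exists>\<epsilon>>0. \<forall>Zhat0 \<in> Zspace \<inter> ball Zbar \<epsilon>. \<forall>\<eta>. 0 \<le> \<eta> \<and> \<eta> \<le> \<eta>bar \<longrightarrow>
              newton_well_defined f h g (U_id f h g) \<delta> \<eta> \<tau> Zhat0 \<and>
              (\<forall>Z. newton_sequence f h g (U_id f h g) \<delta> \<eta> \<tau> Zhat0 Z \<longrightarrow>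
                 superlinear_conv Z Zbar \<and>
                 (twice_lipschitz_diff f \<and> twice_lipschitz_diff g \<and> twice_lipschitz_diff h \<and> \<tau> = 1
                    \<longrightarrow> quadratic_conv Z Zbar))))"
proof -
  obtain f' f'' h' h'' g' g'' where "second_derivs f f' f''" "continuous_on UNIV f''"
    "second_derivs h h' h''" "continuous_on UNIV h''" "second_derivs g g' g''" "continuous_on UNIV g''"
    using assms(2-4) unfolding twice_cont_diff_def by metis
  then have nlsdp: "nlsdp f h g f' f'' h' h'' g' g''"
    using assms(5) by (intro nlsdp.intro)
  \<comment> \<open>The condition on \<open>\<delta>\<close> bounds the nonzero eigenvalues; those
    equal to 0 are gapped by definition, so the reference point is a corrected point.\<close>
  have gapped: "lbar $ i \<in> gapped \<delta>" for i
    using assms(10)[rule_format, of i] by (cases "lbar $ i" "0 :: real" rule: linorder_cases)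
      (auto simp: gapped_def pos_idx_def neg_idx_def)
  have kkt: "kkt f h g f' f'' h' h'' g' g'' xbar \<xi>bar \<Gamma>bar Pbar lbar \<delta> w" if "w = 0 \<or> w = 1" for w
    using nlsdp assms(7-9) gapped that
    by (auto intro!: kkt.intro kkt_axioms.intro simp: multipliers_def ordered_eigen_decomp_def)
  interpret nlsdp f h g f' f'' h' h'' g' g'' by (rule nlsdp)
  interpret zero: kkt f h g f' f'' h' h'' g' g'' xbar \<xi>bar \<Gamma>bar Pbar lbar \<delta> 0 by (rule kkt) simp
  interpret one: kkt f h g f' f'' h' h'' g' g'' xbar \<xi>bar \<Gamma>bar Pbar lbar \<delta> 1 by (rule kkt) simp
  show ?thesis
    unfolding assms(1)
  proof (intro conjI impI; elim conjE)
    assume soc: "W_SOC f h g (xbar, \<xi>bar, \<Gamma>bar) Pbar lbar" and cq: "constraint_nondegeneracy h g xbar Pbar lbar"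
    have "\<exists>dx B. B \<in> sym_mats \<and> ((0::real) = 0 \<longrightarrow> zero_block (zero_idx lbar) (zero_idx lbar) B) \<and>
      zero_block (zero_idx lbar) (neg_idx lbar) B \<and> zero_block (neg_idx lbar) (neg_idx lbar) B \<and>
      \<eta> = h' xbar dx \<and> \<Theta> = g' xbar dx + Pbar ** B ** transpose Pbar" if "\<Theta> \<in> sym_mats" for \<eta> \<Theta>
    proof -
      have "(\<eta>, \<Theta>) \<in> UNIV \<times> sym_mats" using that by simp
      then show ?thesis
        unfolding cq[unfolded constraint_nondegeneracy_def jac_eq, symmetric] by (auto elim!: set_plus_elim) blast
    qed
    then show "\<exists>\<eta>bar>0. \<exists>\<epsilon>>0. \<forall>Zhat0 \<in> Zspace \<inter> ball (xbar, \<xi>bar, \<Gamma>bar) \<epsilon>. \<forall>\<eta>. 0 \<le> \<eta> \<and> \<eta> \<le> \<eta>bar \<longrightarrow>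
              newton_well_defined f h g (U_zero f h g) \<delta> \<eta> \<tau> Zhat0 \<and>
              (\<forall>Z. newton_sequence f h g (U_zero f h g) \<delta> \<eta> \<tau> Zhat0 Z \<longrightarrow>
                 superlinear_conv Z (xbar, \<xi>bar, \<Gamma>bar) \<and>
                 (twice_lipschitz_diff f \<and> twice_lipschitz_diff g \<and> twice_lipschitz_diff h \<and> \<tau> = 1
                    \<longrightarrow> quadratic_conv Z (xbar, \<xi>bar, \<Gamma>bar)))"
      using soc
      by (intro zero.local_convergence[OF zero.U_Zbar_inj \<open>0 < \<tau>\<close>]) (auto simp: W_SOC_def jac_eq)
  next
    assume soc: "S_SOSC f h g (xbar, \<xi>bar, \<Gamma>bar) Pbar lbar" and cq: "W_SRCQ h g xbar Pbar lbar"
    \<comment> \<open>The premise \<open>1 = 0\<close> switches off the condition on the block of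
      zero eigenvalues, which is how the qualification for \<open>w = 1\<close> becomes W-SRCQ; for
      \<open>w = 0\<close> that block is required to vanish, as in nondegeneracy.\<close>
    have "\<exists>dx B. B \<in> sym_mats \<and> ((1::real) = 0 \<longrightarrow> zero_block (zero_idx lbar) (zero_idx lbar) B) \<and>
      zero_block (zero_idx lbar) (neg_idx lbar) B \<and> zero_block (neg_idx lbar) (neg_idx lbar) B \<and>
      \<eta> = h' xbar dx \<and> \<Theta> = g' xbar dx + Pbar ** B ** transpose Pbar" if "\<Theta> \<in> sym_mats" for \<eta> \<Theta>
    proof -
      have "(\<eta>, \<Theta>) \<in> UNIV \<times> sym_mats" using that by simp
      then show ?thesis
        unfolding cq[unfolded W_SRCQ_def jac_eq, symmetric] by (auto elim!: set_plus_elim) blast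
    qed
    then show "\<exists>\<eta>bar>0. \<exists>\<epsilon>>0. \<forall>Zhat0 \<in> Zspace \<inter> ball (xbar, \<xi>bar, \<Gamma>bar) \<epsilon>. \<forall>\<eta>. 0 \<le> \<eta> \<and> \<eta> \<le> \<eta>bar \<longrightarrow>
              newton_well_defined f h g (U_id f h g) \<delta> \<eta> \<tau> Zhat0 \<and>
              (\<forall>Z. newton_sequence f h g (U_id f h g) \<delta> \<eta> \<tau> Zhat0 Z \<longrightarrow>
                 superlinear_conv Z (xbar, \<xi>bar, \<Gamma>bar) \<and>
                 (twice_lipschitz_diff f \<and> twice_lipschitz_diff g \<and> twice_lipschitz_diff h \<and> \<tau> = 1
                    \<longrightarrow> quadratic_conv Z (xbar, \<xi>bar, \<Gamma>bar)))"
      using soc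
      by (intro one.local_convergence[OF one.U_Zbar_inj \<open>0 < \<tau>\<close>]) (auto simp: S_SOSC_def jac_eq)
  qed
qed

end
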